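(* Let $\alpha,\varepsilon>0$ and let $W\in C^2(\mathbb{R})$, $W:\mathbb{R}\to[0,\infty)$, be a function which grows at most quadratically at infinity and such that $W(u)=0$ if and only if $u\in\{0,1\}$. Assume that $u\in C^2([0,\infty)\times\Omega)$ solves the PDE $$(\partial_{tt}+\alpha\,\partial_t)u=\Delta u-\frac1{\varepsilon^2}\,W'(u)$$ in a domain $\Omega$ and that either 1. $\partial_t u(t,x)\equiv 0$ for all $t>0$ and $x\in\partial\Omega$, or 2. $\partial_\nu u(t,x)\equiv 0$ for all $t>0$ and $x\in\partial\Omega$, or 3. $\partial\Omega=\emptyset$. Then the total energy $$E_\varepsilon(u)=F_\varepsilon^{GL}(u)+\frac\varepsilon2\,\|\partial_t u\|_{L^2(\Omega)}^2$$ is monotone decreasing in time.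
   Context: The Ginzburg-Landau energy $F_\varepsilon^{GL}:L^2(\Omega)\to[0,\infty]$ is defined by $F_\varepsilon^{GL}(u)=\int_\Omega\frac\varepsilon2\|\nabla u\|^2+\frac{W(u)}\varepsilon\,\mathrm{d}x$ if $u\in H^1(\Omega)$ and $F_\varepsilon^{GL}(u)=+\infty$ otherwise; the total energy at time $t$ is evaluated at $u(t,\cdot)$ and $\partial_tu(t,\cdot)$. Here $\Delta$ and $\nabla$ act in the space variable $x$ and $\partial_\nu$ denotes the normal derivative on $\partial\Omega$. The three cases correspond to time-independent Dirichlet boundary conditions, homogeneous Neumann boundary conditions, and periodic boundary conditions, respectively. "Monotone decreasing" is meant in the sense of non-increasing. *)

theory Defs
  imports "HOL-Analysis.Analysis" "HOL-Library.Landau_Symbols"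
begin

text \<open>
  Spatial domains. \<open>Flat_Torus L\<close> is the torus with period \<open>L \<bullet> b\<close> in each coordinate direction
  \<open>b\<close>. Functions on it are represented as periodic functions on the whole space (\<open>points\<close>) and are
  integrated over one period cell (\<open>cell\<close>). Thus \<open>frontier (points X)\<close> is the boundary of \<open>X\<close>, and
  it is empty for a torus.
\<close>

datatype 'a spatial_domain = Euclidean "'a set" | Flat_Torus 'a

fun is_domain :: "'a::euclidean_space spatial_domain \<Rightarrow> bool" where
  "is_domain (Euclidean \<Omega>) \<longleftrightarrow> open \<Omega> \<and> connected \<Omega> \<and> \<Omega> \<noteq> {}"
| "is_domain (Flat_Torus L) \<longleftrightarrow> (\<forall>b\<in>Basis. L \<bullet> b > 0)"

fun points :: "'a::euclidean_space spatial_domain \<Rightarrow> 'a set" where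
  "points (Euclidean \<Omega>) = \<Omega>"
| "points (Flat_Torus L) = UNIV"

fun cell :: "'a::euclidean_space spatial_domain \<Rightarrow> 'a set" where
  "cell (Euclidean \<Omega>) = \<Omega>"
| "cell (Flat_Torus L) = {x. \<forall>b\<in>Basis. 0 \<le> x \<bullet> b \<and> x \<bullet> b < L \<bullet> b}"

fun function_on :: "'a::euclidean_space spatial_domain \<Rightarrow> ('a \<Rightarrow> real) \<Rightarrow> bool" where
  "function_on (Euclidean \<Omega>) f \<longleftrightarrow> True"
| "function_on (Flat_Torus L) f \<longleftrightarrow> (\<forall>b\<in>Basis. \<forall>x. f (x + (L \<bullet> b) *\<^sub>R b) = f x)"

definition grad :: "('a::euclidean_space \<Rightarrow> real) \<Rightarrow> 'a \<Rightarrow> 'a" where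
  "grad f x = (THE D. GDERIV f x :> D)"

definition laplacian :: "('a::euclidean_space \<Rightarrow> real) \<Rightarrow> 'a \<Rightarrow> real" where
  "laplacian f x = (\<Sum>b\<in>Basis. grad (\<lambda>y. grad f y \<bullet> b) x \<bullet> b)"

text \<open>Time derivative on \<open>[0,\<infinity>)\<close>; it is one-sided at \<open>0\<close>.\<close>

definition dt :: "(real \<Rightarrow> 'a \<Rightarrow> real) \<Rightarrow> real \<Rightarrow> 'a \<Rightarrow> real" where
  "dt u t x = vector_derivative (\<lambda>s. u s x) (at t within {0..})"

definition C1 :: "('a::euclidean_space \<Rightarrow> real) \<Rightarrow> bool" where
  "C1 f \<longleftrightarrow> (\<exists>D. continuous_on UNIV D \<and> (\<forall>x. GDERIV f x :> D x))"

text \<open>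
  Twice continuously differentiable up to the boundary: the function and its derivatives up to order
  two, taken in the open set \<open>G\<close>, extend continuously to \<open>closure G\<close>.
\<close>

definition C2_closure :: "'b::euclidean_space set \<Rightarrow> ('b \<Rightarrow> real) \<Rightarrow> bool" where
  "C2_closure G U \<longleftrightarrow> continuous_on (closure G) U \<and>
    (\<exists>(D :: 'b \<Rightarrow> 'b) (H :: 'b \<Rightarrow> 'b \<Rightarrow>\<^sub>L 'b).
       continuous_on (closure G) D \<and> continuous_on (closure G) H \<and>
       (\<forall>z\<in>G. (GDERIV U z :> D z) \<and> (D has_derivative blinfun_apply (H z)) (at z)))"

text \<open>
  \<open>outer_unit_normal \<Omega> x \<nu>\<close>: after relabelling and reorienting the coordinate axes, \<open>\<Omega>\<close> is near \<open>x\<close>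
  the region below the graph of a \<open>C\<^sup>1\<close> function \<open>\<gamma>\<close> of the remaining coordinates (\<open>e\<close> is the
  distinguished axis), and \<open>\<nu>\<close> is the resulting outer unit normal.
\<close>

definition outer_unit_normal :: "'a::euclidean_space set \<Rightarrow> 'a \<Rightarrow> 'a \<Rightarrow> bool" where
  "outer_unit_normal \<Omega> x \<nu> \<longleftrightarrow>
    (\<exists>e \<gamma> r. (e \<in> Basis \<or> - e \<in> Basis) \<and> C1 \<gamma> \<and> r > 0 \<and>
       (\<forall>y\<in>ball x r. y \<in> \<Omega> \<longleftrightarrow> y \<bullet> e < \<gamma> (y - (y \<bullet> e) *\<^sub>R e)) \<and>
       \<nu> = sgn (grad (\<lambda>y. y \<bullet> e - \<gamma> (y - (y \<bullet> e) *\<^sub>R e)) x))"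

definition C1_boundary :: "'a::euclidean_space set \<Rightarrow> bool" where
  "C1_boundary \<Omega> \<longleftrightarrow> (\<forall>x\<in>frontier \<Omega>. \<exists>\<nu>. outer_unit_normal \<Omega> x \<nu>)"

text \<open>At a boundary point the gradient is the continuous extension of the gradient from inside.\<close>

definition normal_deriv :: "'a::euclidean_space set \<Rightarrow> ('a \<Rightarrow> real) \<Rightarrow> 'a \<Rightarrow> real" where
  "normal_deriv \<Omega> f x = Lim (at x within \<Omega>) (grad f) \<bullet> (THE \<nu>. outer_unit_normal \<Omega> x \<nu>)"

definition L2 :: "'a::euclidean_space spatial_domain \<Rightarrow> ('a \<Rightarrow> 'b::euclidean_space) set" where
  "L2 X = {f \<in> borel_measurable (lebesgue_on (cell X)).
             integrable (lebesgue_on (cell X)) (\<lambda>x. (norm (f x))\<^sup>2)}"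

text \<open>
  Testing with \<open>C\<^sup>1\<close> instead of \<open>C\<^sup>\<infinity>\<close> functions gives the same weak gradients (mollification).
\<close>

fun test_functions :: "'a::euclidean_space spatial_domain \<Rightarrow> ('a \<Rightarrow> real) set" where
  "test_functions (Euclidean \<Omega>) =
     {\<phi>. C1 \<phi> \<and> compact (closure {x. \<phi> x \<noteq> 0}) \<and> closure {x. \<phi> x \<noteq> 0} \<subseteq> \<Omega>}"
| "test_functions (Flat_Torus L) = {\<phi>. C1 \<phi> \<and> function_on (Flat_Torus L) \<phi>}"

definition has_weak_gradient ::
    "'a::euclidean_space spatial_domain \<Rightarrow> ('a \<Rightarrow> real) \<Rightarrow> ('a \<Rightarrow> 'a) \<Rightarrow> bool" where
  "has_weak_gradient X f g \<longleftrightarrow>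
    (\<forall>\<phi>\<in>test_functions X.
       (\<integral>x. f x *\<^sub>R grad \<phi> x \<partial>lebesgue_on (cell X)) = - (\<integral>x. \<phi> x *\<^sub>R g x \<partial>lebesgue_on (cell X)))"

definition H1 :: "'a::euclidean_space spatial_domain \<Rightarrow> ('a \<Rightarrow> real) set" where
  "H1 X = {f \<in> L2 X. \<exists>g\<in>L2 X. has_weak_gradient X f g}"

text \<open>The choice is immaterial, since weak gradients are unique up to null sets.\<close>

definition weak_gradient :: "'a::euclidean_space spatial_domain \<Rightarrow> ('a \<Rightarrow> real) \<Rightarrow> 'a \<Rightarrow> 'a" where
  "weak_gradient X f = (SOME g. g \<in> L2 X \<and> has_weak_gradient X f g)"

definition GL_energy ::
    "(real \<Rightarrow> real) \<Rightarrow> real \<Rightarrow> 'a::euclidean_space spatial_domain \<Rightarrow> ('a \<Rightarrow> real) \<Rightarrow> ennreal" where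
  "GL_energy W \<epsilon> X f =
    (if f \<in> H1 X
     then \<integral>\<^sup>+x. ennreal (\<epsilon> / 2 * (norm (weak_gradient X f x))\<^sup>2 + W (f x) / \<epsilon>) \<partial>lebesgue_on (cell X)
     else \<infinity>)"

definition total_energy ::
    "(real \<Rightarrow> real) \<Rightarrow> real \<Rightarrow> 'a::euclidean_space spatial_domain \<Rightarrow> (real \<Rightarrow> 'a \<Rightarrow> real) \<Rightarrow> real \<Rightarrow> ennreal"
  where
  "total_energy W \<epsilon> X u t =
    GL_energy W \<epsilon> X (u t) +
    ennreal (\<epsilon> / 2) * (\<integral>\<^sup>+x. ennreal ((dt u t x)\<^sup>2) \<partial>lebesgue_on (cell X))"

end

theory Submission
  imports Defs
begin

text \<open>
  Write \<open>v = \<partial>\<^sub>t u\<close> and \<open>e = \<epsilon>/2 \<bar>\<nabla>u\<bar>\<^sup>2 + W(u)/\<epsilon> + \<epsilon>/2 v\<^sup>2\<close> for the energy density.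
  Multiplying the equation by \<open>\<epsilon> v\<close> gives \<open>\<partial>\<^sub>t e = \<epsilon> div (v \<nabla>u) - \<epsilon> \<alpha> v\<^sup>2\<close>. If the flux
  \<open>v \<nabla>u\<close> does not cross the boundary, the integral of the divergence is zero and the energy
  decreases. Three points need care.

  \<^item> Nothing is assumed about the behaviour of \<open>u\<close> at infinity. The density is therefore
    multiplied by a weight supported in a backward cone of slope one, for which the flux through the
    side of the cone has the right sign (\<open>weighted_energy_antimono\<close>, \<open>cone_energy_le\<close>). Letting
    the cone grow, monotone convergence yields the inequality for \<open>\<integral> e\<close>.

  \<^item> The divergence theorem is required for an arbitrary open set if \<open>v = 0\<close> on the boundary, and
    for a \<open>C\<^sup>1\<close> boundary if \<open>\<partial>\<^sub>\<nu> u = 0\<close>. In the first case one integrates along coordinate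
    lines (\<open>integral_partial_deriv_eq_0\<close>). The second is reduced to the first by a cutoff in a
    boundary layer of thickness \<open>\<delta>\<close>: the field has no normal component at the boundary, so the
    error tends to zero with \<open>\<delta>\<close> (\<open>integral_div_eq_0_graph\<close>,
    \<open>divergence_theorem_no_flux\<close>). A Euclidean domain without boundary is an instance of the first
    case, and on the torus periodicity replaces the boundary condition.

  \<^item> The Ginzburg-Landau energy is defined with weak gradients and is infinite outside \<open>H\<^sup>1\<close>.
    Weak gradients are unique up to null sets (\<open>weak_gradient_unique\<close>) and the classical gradient is
    one (\<open>has_weak_gradient_classical\<close>), so on \<open>H\<^sup>1\<close> the total energy is \<open>\<integral> e\<close>. If it is finite
    at time \<open>s\<close>, then \<open>u(t) - u(s) = \<integral> v\<close> and the energy bound put \<open>u(t)\<close> into \<open>H\<^sup>1\<close> for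
    all later \<open>t\<close> (\<open>square_integral_finite\<close>).
\<close>

section \<open>Integration along coordinate lines\<close>

text \<open>
  A substitute for splitting the space as a line times a hyperplane: integrating \<open>g (x + s b)\<close>
  over all \<open>s\<close> and over the slab \<open>0 \<le> x \<bullet> b \<le> 1\<close> meets every point once for each
  \<open>s\<close> in an interval of length one, so translation invariance and Tonelli's theorem give back
  \<open>\<integral> g\<close>.
\<close>

lemma nn_integral_slices:
  fixes g :: "'a::euclidean_space \<Rightarrow> ennreal"
  assumes g [measurable]: "g \<in> borel_measurable borel" and b: "b \<in> Basis"
  shows "(\<integral>\<^sup>+x. indicator {x. 0 \<le> x \<bullet> b \<and> x \<bullet> b \<le> 1} x * (\<integral>\<^sup>+s. g (x + s *\<^sub>R b) \<partial>lborel) \<partial>lborel)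
       = (\<integral>\<^sup>+x. g x \<partial>lborel)"
proof -
  let ?A = "{x::'a. 0 \<le> x \<bullet> b \<and> x \<bullet> b \<le> 1}"
  have [measurable]: "?A \<in> sets borel"
    by measurable
  interpret lborel_pair: pair_sigma_finite "lborel :: 'a measure" "lborel :: real measure" ..
  have "(\<integral>\<^sup>+x. indicator ?A x * (\<integral>\<^sup>+s. g (x + s *\<^sub>R b) \<partial>lborel) \<partial>lborel)
      = (\<integral>\<^sup>+x. (\<integral>\<^sup>+s. indicator ?A x * g (x + s *\<^sub>R b) \<partial>lborel) \<partial>lborel)"
    by (simp add: nn_integral_cmult)
  also have "\<dots> = (\<integral>\<^sup>+s. (\<integral>\<^sup>+x. indicator ?A x * g (x + s *\<^sub>R b) \<partial>lborel) \<partial>lborel)"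
    by (rule lborel_pair.Fubini'[symmetric]) simp
  also have "\<dots> = (\<integral>\<^sup>+s. (\<integral>\<^sup>+y. indicator ?A (y - s *\<^sub>R b) * g y \<partial>lborel) \<partial>lborel)"
  proof (rule nn_integral_cong)
    fix s :: real
    have "(\<integral>\<^sup>+y. indicator ?A (y - s *\<^sub>R b) * g y \<partial>lborel)
        = (\<integral>\<^sup>+y. indicator ?A (y - s *\<^sub>R b) * g y \<partial>distr lborel borel ((+) (s *\<^sub>R b)))"
      by (simp add: lborel_distr_plus)
    also have "\<dots> = (\<integral>\<^sup>+x. indicator ?A x * g (x + s *\<^sub>R b) \<partial>lborel)"
      by (subst nn_integral_distr) (simp_all add: add.commute)
    finally show "(\<integral>\<^sup>+x. indicator ?A x * g (x + s *\<^sub>R b) \<partial>lborel)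
      = (\<integral>\<^sup>+y. indicator ?A (y - s *\<^sub>R b) * g y \<partial>lborel)" by simp
  qed
  also have "\<dots> = (\<integral>\<^sup>+y. (\<integral>\<^sup>+s. indicator ?A (y - s *\<^sub>R b) * g y \<partial>lborel) \<partial>lborel)"
    by (rule lborel_pair.Fubini') simp
  also have "\<dots> = (\<integral>\<^sup>+y. g y \<partial>lborel)"
  proof (rule nn_integral_cong)
    fix y :: 'a
    have "indicator ?A (y - s *\<^sub>R b) = (indicator {y \<bullet> b - 1..y \<bullet> b} s :: ennreal)" for s
      using b by (auto simp: indicator_def inner_diff_left)
    then have "(\<integral>\<^sup>+s. indicator ?A (y - s *\<^sub>R b) * g y \<partial>lborel)
        = (\<integral>\<^sup>+s. g y * indicator {y \<bullet> b - 1..y \<bullet> b} s \<partial>lborel)"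
      by (simp add: mult.commute)
    also have "\<dots> = g y"
      by (subst nn_integral_cmult_indicator) auto
    finally show "(\<integral>\<^sup>+s. indicator ?A (y - s *\<^sub>R b) * g y \<partial>lborel) = g y" .
  qed
  finally show ?thesis .
qed

text \<open>
  On every line the positive and the negative part of \<open>g\<close> have the same finite integral; the
  previous lemma, applied to each part, transfers this to the whole space.
\<close>

lemma integral_eq_0_if_slices_0:
  fixes g :: "'a::euclidean_space \<Rightarrow> real"
  assumes int: "integrable lborel g" and b: "b \<in> Basis"
    and slice: "\<And>x. integrable lborel (\<lambda>s. g (x + s *\<^sub>R b))"
    and slice_0: "\<And>x. (LINT s|lborel. g (x + s *\<^sub>R b)) = 0"
  shows "integral\<^sup>L lborel g = 0"
proof -
  have [measurable]: "g \<in> borel_measurable borel"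
    using borel_measurable_integrable[OF int] by simp
  have "(\<integral>\<^sup>+s. ennreal (g (x + s *\<^sub>R b)) \<partial>lborel) = (\<integral>\<^sup>+s. ennreal (- g (x + s *\<^sub>R b)) \<partial>lborel)" for x
  proof -
    have fin: "(\<integral>\<^sup>+s. ennreal (g (x + s *\<^sub>R b)) \<partial>lborel) < \<infinity>"
      "(\<integral>\<^sup>+s. ennreal (- g (x + s *\<^sub>R b)) \<partial>lborel) < \<infinity>"
      using slice[of x] by (simp_all add: real_integrable_def less_top)
    have "enn2real (\<integral>\<^sup>+s. ennreal (g (x + s *\<^sub>R b)) \<partial>lborel)
        = enn2real (\<integral>\<^sup>+s. ennreal (- g (x + s *\<^sub>R b)) \<partial>lborel)"
      using slice_0[of x] by (simp add: real_lebesgue_integral_def[OF slice])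
    then show ?thesis
      using fin by (metis ennreal_enn2real infinity_ennreal_def)
  qed
  then have "(\<integral>\<^sup>+x. ennreal (g x) \<partial>lborel) = (\<integral>\<^sup>+x. ennreal (- g x) \<partial>lborel)"
    using nn_integral_slices[OF _ b, of "\<lambda>x. ennreal (g x)"] nn_integral_slices[OF _ b, of "\<lambda>x. ennreal (- g x)"]
    by simp
  then show ?thesis
    by (simp add: real_lebesgue_integral_def[OF int])
qed

lemma continuous_bounded_set_integrable:
  fixes f :: "'a::euclidean_space \<Rightarrow> 'b::{banach, second_countable_topology}"
  assumes S: "S \<in> sets borel" "bounded S" and f: "continuous_on S f" "bounded (f ` S)"
  shows "set_integrable lborel S f"
proof -
  obtain B where B: "\<And>x. x \<in> S \<Longrightarrow> norm (f x) \<le> B"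
    using f(2) by (auto simp: bounded_iff)
  show ?thesis
    unfolding set_integrable_def
  proof (rule integrableI_bounded_set[where A = S and B = B])
    show "(\<lambda>x. indicat_real S x *\<^sub>R f x) \<in> borel_measurable lborel"
      using borel_measurable_continuous_on_indicator[OF S(1) f(1)] by simp
    show "emeasure lborel S < \<infinity>"
      using emeasure_bounded_finite[OF S(2)] by simp
  qed (use S B in auto)
qed

lemma open_component_is_interval:
  fixes S :: "real set"
  assumes "open S" "bounded S" "c \<in> components S"
  obtains a b where "a < b" "c = {a<..<b}" "a \<in> frontier S" "b \<in> frontier S"
proof -
  have c: "open c" "connected c" "c \<noteq> {}" "c \<subseteq> S"
    using open_components[OF assms(1,3)] in_components_connected[OF assms(3)]
      in_components_nonempty[OF assms(3)] in_components_subset[OF assms(3)] by auto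
  have cb: "bounded c"
    using bounded_subset[OF assms(2) c(4)] .
  define a b where "a = Inf c" and "b = Sup c"
  have bdd: "bdd_below c" "bdd_above c"
    using cb bounded_imp_bdd_below bounded_imp_bdd_above by auto
  have Ia: "x > a" if "x \<in> c" for x
  proof -
    obtain e where "e > 0" "ball x e \<subseteq> c" using openE[OF c(1) \<open>x \<in> c\<close>] by auto
    moreover have "x - e/2 \<in> ball x e" using \<open>e > 0\<close> by (simp add: dist_real_def)
    ultimately have "x - e/2 \<in> c" by blast
    then have "a \<le> x - e/2" unfolding a_def using bdd cInf_lower by blast
    then show ?thesis using \<open>e > 0\<close> by simp
  qed
  have Ib: "x < b" if "x \<in> c" for x
  proof -
    obtain e where "e > 0" "ball x e \<subseteq> c" using openE[OF c(1) \<open>x \<in> c\<close>] by auto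
    moreover have "x + e/2 \<in> ball x e" using \<open>e > 0\<close> by (simp add: dist_real_def)
    ultimately have "x + e/2 \<in> c" by blast
    then have "x + e/2 \<le> b" unfolding b_def using bdd cSup_upper by blast
    then show ?thesis using \<open>e > 0\<close> by simp
  qed
  have ceq: "c = {a<..<b}"
  proof
    show "c \<subseteq> {a<..<b}" using Ia Ib by auto
    show "{a<..<b} \<subseteq> c"
    proof
      fix x assume x: "x \<in> {a<..<b}"
      obtain y where "y \<in> c" "y < x" using x c(3) bdd cInf_lessD[of c x] unfolding a_def by auto
      moreover obtain z where "z \<in> c" "x < z" using x c(3) bdd less_cSupD[of c x] unfolding b_def by auto
      ultimately show "x \<in> c" using connectedD_interval[OF c(2)] by (metis less_imp_le)
    qed
  qed
  have ab: "a < b" using c(3) ceq by auto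
  have cl: "closure c = {a..b}" using ceq ab by simp
  have "z \<in> frontier S" if "z \<in> {a, b}" for z
  proof -
    have "z \<notin> S"
    proof
      assume z: "z \<in> S"
      have "insert z c \<subseteq> c"
      proof (rule components_maximal[OF assms(3)])
        show "connected (insert z c)"
          by (rule connected_intermediate_closure[OF c(2)]) (use cl that ab closure_subset[of c] in auto)
        show "insert z c \<subseteq> S" using z c by auto
        show "c \<inter> insert z c \<noteq> {}" using c(3) by auto
      qed
      then show False using ceq that by auto
    qed
    moreover have "z \<in> closure S" using that ab cl closure_mono[OF c(4)] by auto
    ultimately show ?thesis using assms(1) by (simp add: frontier_def interior_open)
  qed
  then show ?thesis using that ab ceq by blast
qed

lemma set_integral_eq_0_countable_partition:
  fixes f :: "'a \<Rightarrow> real"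
  assumes "countable C" "disjoint C" "C \<subseteq> sets M" "set_integrable M (\<Union>C) f"
    and 0: "\<And>c. c \<in> C \<Longrightarrow> (LINT x:c|M. f x) = 0"
  shows "(LINT x:\<Union>C|M. f x) = 0"
proof -
  \<comment> \<open>Indices that enumerate no member of \<open>C\<close> carry the empty set, which keeps the sequence disjoint when \<open>C\<close> is finite.\<close>
  define A where "A n = (if n \<in> to_nat_on C ` C then from_nat_into C n else {})" for n
  have A: "A n \<in> C \<or> A n = {}" for n
    using assms(1) by (auto simp: A_def)
  have AU: "(\<Union>n. A n) = \<Union>C"
  proof
    show "(\<Union>n. A n) \<subseteq> \<Union>C" using A by blast
    show "\<Union>C \<subseteq> (\<Union>n. A n)"
    proof
      fix x assume "x \<in> \<Union>C"
      then obtain c where "c \<in> C" "x \<in> c" by auto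
      then have "x \<in> A (to_nat_on C c)" using assms(1) by (simp add: A_def)
      then show "x \<in> (\<Union>n. A n)" by auto
    qed
  qed
  have "(LINT x:(\<Union>n. A n)|M. f x) = (\<Sum>n. (LINT x:(A n)|M. f x))"
  proof (rule lebesgue_integral_countable_add)
    show "A n \<in> sets M" for n using A[of n] assms(3) by auto
    show "A i \<inter> A j = {}" if "i \<noteq> j" for i j
    proof (cases "i \<in> to_nat_on C ` C \<and> j \<in> to_nat_on C ` C")
      case True
      then obtain c d where cd: "c \<in> C" "d \<in> C" "i = to_nat_on C c" "j = to_nat_on C d" by auto
      then have "A i = c" "A j = d" using assms(1) by (auto simp: A_def)
      moreover have "c \<noteq> d" using cd that by auto
      ultimately show ?thesis using assms(2) cd by (metis disjointD)
    qed (auto simp: A_def)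
    show "set_integrable M (\<Union>n. A n) f" using AU assms(4) by simp
  qed
  also have "\<dots> = 0"
  proof -
    have "(LINT x:(A n)|M. f x) = 0" for n using A[of n] 0 by (auto simp: set_lebesgue_integral_def)
    then show ?thesis by simp
  qed
  finally show ?thesis using AU by simp
qed

text \<open>
  The end points of a component of \<open>S\<close> belong to \<open>frontier S\<close>, so the fundamental theorem of
  calculus gives \<open>0\<close> on each of the countably many components.
\<close>

lemma integral_deriv_eq_0_if_0_on_frontier:
  fixes f f' :: "real \<Rightarrow> real"
  assumes S: "open S" "bounded S"
    and f: "continuous_on (closure S) f" "\<And>x. x \<in> frontier S \<Longrightarrow> f x = 0"
    and der: "\<And>x. x \<in> S \<Longrightarrow> (f has_real_derivative f' x) (at x)"
    and f': "continuous_on S f'" "bounded (f' ` S)"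
  shows "(LINT x:S|lborel. f' x) = 0"
proof -
  have "(LINT x:\<Union>(components S)|lborel. f' x) = 0"
  proof (rule set_integral_eq_0_countable_partition)
    show "countable (components S)"
      using S(1) by (intro countable_disjoint_open_subsets) (auto simp: open_components disjoint_def components_nonoverlap)
    show "disjoint (components S)" 
      using components_nonoverlap by (auto simp: disjoint_def)
    show "components S \<subseteq> sets lborel" using open_components[OF S(1)] by auto
    show "set_integrable lborel (\<Union>(components S)) f'"
      using continuous_bounded_set_integrable[OF _ S(2) f'] S(1) by simp
    fix c assume c: "c \<in> components S"
    obtain a b where ab: "a < b" "c = {a<..<b}" "a \<in> frontier S" "b \<in> frontier S"
      using open_component_is_interval[OF S c] by blast
    have cS: "c \<subseteq> S" using c in_components_subset by blast
    have "{a..b} \<subseteq> closure S" using closure_mono[OF cS] ab by simp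
    then have "continuous_on {a..b} f" using f(1) continuous_on_subset by blast
    then have "(f' has_integral f b - f a) {a..b}"
      using ab cS der by (intro fundamental_theorem_of_calculus_interior)
        (auto simp flip: has_real_derivative_iff_has_vector_derivative)
    then have "integral c f' = 0"
      using ab f(2) integral_open_interval[of a b f'] by (simp add: integral_unique)
    moreover have "set_integrable lborel c f'"
      using cS f' S ab by (intro continuous_bounded_set_integrable)
        (auto intro: continuous_on_subset bounded_subset)
    ultimately show "(LINT x:c|lborel. f' x) = 0"
      using set_borel_integral_eq_integral(2) by metis
  qed
  then show ?thesis by simp
qed

lemma continuous_on_line [continuous_intros]: "continuous_on S (\<lambda>s::real. x + s *\<^sub>R (b::'a::real_normed_vector))"
  by (intro continuous_intros)

lemma bounded_slice:
  fixes b :: "'a::euclidean_space"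
  assumes "bounded \<Omega>" "b \<in> Basis"
  shows "bounded {s. x + s *\<^sub>R b \<in> \<Omega>}"
proof -
  obtain B where B: "\<And>y. y \<in> \<Omega> \<Longrightarrow> norm y \<le> B" using assms(1) bounded_iff by blast
  have "\<bar>s\<bar> \<le> B + norm x" if "x + s *\<^sub>R b \<in> \<Omega>" for s
  proof -
    have "norm (s *\<^sub>R b) \<le> norm (x + s *\<^sub>R b) + norm x"
      by (metis add_diff_cancel_left' norm_triangle_ineq4)
    then show ?thesis using B[OF that] assms(2) by simp
  qed
  then show ?thesis by (auto simp: bounded_iff)
qed

lemma has_real_derivative_along_line:
  fixes F :: "'a::real_normed_vector \<Rightarrow> real"
  assumes "((\<lambda>r. F ((x + s *\<^sub>R b) + r *\<^sub>R b)) has_real_derivative d) (at 0)"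
  shows "((\<lambda>r. F (x + r *\<^sub>R b)) has_real_derivative d) (at s)"
proof -
  have "(\<lambda>r. F ((x + s *\<^sub>R b) + r *\<^sub>R b)) = (\<lambda>r. F (x + (r + s) *\<^sub>R b))"
    by (simp add: scaleR_add_left add_ac)
  then show ?thesis
    using assms DERIV_shift[of "\<lambda>r. F (x + r *\<^sub>R b)" d 0 s] by simp
qed

text \<open>
  A line in direction \<open>b\<close> meets \<open>\<Omega>\<close> in an open subset of \<open>\<real>\<close> whose frontier is mapped
  into \<open>frontier \<Omega>\<close>. The one-dimensional statement therefore applies on every line, whatever the
  shape of \<open>\<Omega>\<close>.
\<close>

lemma integral_partial_deriv_eq_0_bounded:
  fixes F F' :: "'a::euclidean_space \<Rightarrow> real"
  assumes \<Omega>: "open \<Omega>" "bounded \<Omega>" and b: "b \<in> Basis"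
    and F: "continuous_on (closure \<Omega>) F" "\<And>x. x \<in> frontier \<Omega> \<Longrightarrow> F x = 0"
    and der: "\<And>x. x \<in> \<Omega> \<Longrightarrow> ((\<lambda>s. F (x + s *\<^sub>R b)) has_real_derivative F' x) (at 0)"
    and F': "continuous_on \<Omega> F'" "bounded (F' ` \<Omega>)"
  shows "(LINT x:\<Omega>|lborel. F' x) = 0"
  unfolding set_lebesgue_integral_def
proof (rule integral_eq_0_if_slices_0[OF _ b])
  show "integrable lborel (\<lambda>x. indicat_real \<Omega> x *\<^sub>R F' x)"
    using continuous_bounded_set_integrable[OF _ \<Omega>(2) F'] \<Omega>(1) by (simp add: set_integrable_def)
  fix x :: 'a
  define S where "S = {s. x + s *\<^sub>R b \<in> \<Omega>}"
  have S: "open S"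
    using open_vimage[OF \<Omega>(1), of "\<lambda>s. x + s *\<^sub>R b"] by (simp add: S_def vimage_def continuous_on_line)
  have Sb: "bounded S"
    unfolding S_def by (rule bounded_slice[OF \<Omega>(2) b])
  have clS: "x + s *\<^sub>R b \<in> closure \<Omega>" if "s \<in> closure S" for s
  proof -
    have "(\<lambda>s. x + s *\<^sub>R b) ` closure S \<subseteq> closure \<Omega>"
      by (rule image_closure_subset) (auto simp: S_def closure_subset intro: continuous_on_line subsetD[OF closure_subset])
    then show ?thesis using that by auto
  qed
  have cont: "continuous_on S (\<lambda>s. F' (x + s *\<^sub>R b))"
    by (rule continuous_on_compose2[OF F'(1) continuous_on_line]) (auto simp: S_def)
  have bdd: "bounded ((\<lambda>s. F' (x + s *\<^sub>R b)) ` S)"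
    by (rule bounded_subset[OF F'(2)]) (auto simp: S_def)
  have "set_integrable lborel S (\<lambda>s. F' (x + s *\<^sub>R b))"
    by (rule continuous_bounded_set_integrable[OF _ Sb cont bdd]) (simp add: S)
  then show "integrable lborel (\<lambda>s. indicat_real \<Omega> (x + s *\<^sub>R b) *\<^sub>R F' (x + s *\<^sub>R b))"
    by (simp add: set_integrable_def S_def indicator_def)
  have "(LINT s:S|lborel. F' (x + s *\<^sub>R b)) = 0"
  proof (rule integral_deriv_eq_0_if_0_on_frontier[where f = "\<lambda>s. F (x + s *\<^sub>R b)", OF S Sb _ _ _ cont bdd])
    show "continuous_on (closure S) (\<lambda>s. F (x + s *\<^sub>R b))"
      by (rule continuous_on_compose2[OF F(1) continuous_on_line]) (auto simp: clS)
    show "F (x + s *\<^sub>R b) = 0" if "s \<in> frontier S" for s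
    proof -
      have "s \<in> closure S" "s \<notin> S" using that S by (auto simp: frontier_def interior_open)
      then show ?thesis using F(2) clS \<Omega>(1) by (auto simp: S_def frontier_def interior_open)
    qed
    show "((\<lambda>s. F (x + s *\<^sub>R b)) has_real_derivative F' (x + s *\<^sub>R b)) (at s)" if "s \<in> S" for s
    proof (rule has_real_derivative_along_line[where F = F])
      show "((\<lambda>r. F (x + s *\<^sub>R b + r *\<^sub>R b)) has_real_derivative F' (x + s *\<^sub>R b)) (at 0)"
        using der[of "x + s *\<^sub>R b"] that unfolding S_def by blast
    qed
  qed
  then show "(LINT s|lborel. indicat_real \<Omega> (x + s *\<^sub>R b) *\<^sub>R F' (x + s *\<^sub>R b)) = 0"
    by (simp add: set_lebesgue_integral_def S_def indicator_def)
qed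

lemma directional_deriv_eq_0_if_locally_0:
  fixes F :: "'a::real_normed_vector \<Rightarrow> real"
  assumes der: "((\<lambda>s. F (x + s *\<^sub>R b)) has_real_derivative d) (at 0)"
    and U: "open U" "x \<in> U" "\<And>y. y \<in> U \<Longrightarrow> F y = 0"
  shows "d = 0"
proof -
  define V where "V = {s. x + s *\<^sub>R b \<in> U}"
  have "open V"
    using open_vimage[OF U(1), of "\<lambda>s. x + s *\<^sub>R b"] by (simp add: V_def vimage_def continuous_on_line)
  moreover have "0 \<in> V" using U by (simp add: V_def)
  moreover have "F (x + s *\<^sub>R b) = 0" if "s \<in> V" for s using U that by (simp add: V_def)
  ultimately have "((\<lambda>s. 0) has_real_derivative d) (at 0)"
    using has_field_derivative_transform_within_open[OF der, of V] by auto
  then show ?thesis using DERIV_unique[OF _ DERIV_const] by blast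
qed

lemma integral_partial_deriv_eq_0:
  fixes F F' :: "'a::euclidean_space \<Rightarrow> real"
  assumes \<Omega>: "open \<Omega>" and K: "compact K" and b: "b \<in> Basis"
    and F: "continuous_on (closure \<Omega>) F" "\<And>x. x \<in> frontier \<Omega> \<Longrightarrow> F x = 0"
      "\<And>x. x \<in> closure \<Omega> - K \<Longrightarrow> F x = 0"
    and der: "\<And>x. x \<in> \<Omega> \<Longrightarrow> ((\<lambda>s. F (x + s *\<^sub>R b)) has_real_derivative F' x) (at 0)"
    and F': "continuous_on \<Omega> F'" "bounded (F' ` (\<Omega> \<inter> K))"
  shows "(LINT x:\<Omega>|lborel. F' x) = 0"
proof -
  \<comment> \<open>The set can be replaced by its intersection with a ball around \<open>K\<close>: the new frontier points lie outside \<open>K\<close>.\<close>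
  obtain R where R: "K \<subseteq> ball 0 R"
    using bounded_subset_ballD[OF compact_imp_bounded[OF K]] by blast
  define \<Omega>' where "\<Omega>' = \<Omega> \<inter> ball 0 R"
  have F'0: "F' x = 0" if "x \<in> \<Omega> - K" for x
    using der[of x] that F(3) closure_subset[of \<Omega>] K \<Omega> 
    by (intro directional_deriv_eq_0_if_locally_0[of F x b "F' x" "\<Omega> - K"])
      (auto intro: open_Diff compact_imp_closed)
  have "(LINT x:\<Omega>'|lborel. F' x) = 0"
  proof (rule integral_partial_deriv_eq_0_bounded[where F = F, OF _ _ b])
    show "open \<Omega>'" "bounded \<Omega>'" using \<Omega> by (auto simp: \<Omega>'_def intro: bounded_subset)
    show "continuous_on (closure \<Omega>') F"
      by (rule continuous_on_subset[OF F(1)]) (auto simp: \<Omega>'_def intro: subsetD[OF closure_mono])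
    show "F x = 0" if "x \<in> frontier \<Omega>'" for x
    proof -
      have "x \<in> closure \<Omega>'" "x \<notin> \<Omega>'"
        using that interior_open[OF \<open>open \<Omega>'\<close>] by (auto simp: frontier_def)
      then have "x \<in> closure \<Omega>" "x \<in> frontier \<Omega> \<or> x \<notin> K"
        using closure_mono[of \<Omega>' \<Omega>] R interior_open[OF \<Omega>] by (auto simp: \<Omega>'_def frontier_def)
      then show ?thesis using F(2,3) by auto
    qed
    show "((\<lambda>s. F (x + s *\<^sub>R b)) has_real_derivative F' x) (at 0)" if "x \<in> \<Omega>'" for x
      using der[of x] that by (simp add: \<Omega>'_def)
    show "continuous_on \<Omega>' F'" by (rule continuous_on_subset[OF F'(1)]) (auto simp: \<Omega>'_def)
    have "F' ` \<Omega>' \<subseteq> insert 0 (F' ` (\<Omega> \<inter> K))" using F'0 by (auto simp: \<Omega>'_def)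
    then show "bounded (F' ` \<Omega>')" by (rule bounded_subset[rotated]) (simp add: F'(2))
  qed
  moreover have "(LINT x:\<Omega>|lborel. F' x) = (LINT x:\<Omega>'|lborel. F' x)"
    unfolding set_lebesgue_integral_def
    using F'0 R by (intro Bochner_Integration.integral_cong) (fastforce simp: \<Omega>'_def indicator_def)+
  ultimately show ?thesis by simp
qed

lemma borel_cell_torus: "cell (Flat_Torus L) \<in> sets borel"
proof -
  have "cell (Flat_Torus L) = (\<Inter>b\<in>Basis. {x. 0 \<le> x \<bullet> b} \<inter> {x. x \<bullet> b < L \<bullet> b})"
    by auto
  moreover have "{x. 0 \<le> x \<bullet> b} \<inter> {x. x \<bullet> b < L \<bullet> b} \<in> sets borel" for b :: 'a
    by measurable
  ultimately show ?thesis by (simp add: sets.finite_INT)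
qed

lemma cell_torus_subset_cbox: "cell (Flat_Torus L) \<subseteq> cbox 0 L"
  by (auto simp: mem_box less_imp_le)

text \<open>
  A line in direction \<open>b\<close> meets the cell in nothing or in a half-open interval of length
  \<open>L \<bullet> b\<close>, a period of \<open>F\<close> along that line.
\<close>

lemma integral_partial_deriv_eq_0_torus:
  fixes F F' :: "'a::euclidean_space \<Rightarrow> real"
  assumes L: "is_domain (Flat_Torus L)" and b: "b \<in> Basis"
    and F: "function_on (Flat_Torus L) F"
    and der: "\<And>x. ((\<lambda>s. F (x + s *\<^sub>R b)) has_real_derivative F' x) (at 0)"
    and F': "continuous_on UNIV F'"
  shows "(LINT x:cell (Flat_Torus L)|lborel. F' x) = 0"
  unfolding set_lebesgue_integral_def
proof (rule integral_eq_0_if_slices_0[OF _ b])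
  have "bounded (F' ` cell (Flat_Torus L))"
    by (rule bounded_subset[OF compact_imp_bounded image_mono[OF cell_torus_subset_cbox]])
      (intro compact_continuous_image continuous_on_subset[OF F'] compact_cbox subset_UNIV)
  moreover have "bounded (cell (Flat_Torus L))"
    by (rule bounded_subset[OF bounded_cbox cell_torus_subset_cbox])
  ultimately show "integrable lborel (\<lambda>x. indicat_real (cell (Flat_Torus L)) x *\<^sub>R F' x)"
    using continuous_bounded_set_integrable[OF borel_cell_torus _ continuous_on_subset[OF F']]
    by (simp add: set_integrable_def del: cell.simps)
  fix x :: 'a
  define a where "a = - (x \<bullet> b)"
  define T where "T = L \<bullet> b"
  have T: "T > 0" using L b by (simp add: T_def)
  have slice: "integrable lborel (\<lambda>s. indicator {a..a+T} s *\<^sub>R F' (x + s *\<^sub>R b)) \<and>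
    (LINT s|lborel. indicator {a..a+T} s *\<^sub>R F' (x + s *\<^sub>R b)) = 0"
  proof -
    have "(\<lambda>s. F (x + s *\<^sub>R b)) (a + T) = F ((x + a *\<^sub>R b) + (L \<bullet> b) *\<^sub>R b)"
      by (simp add: T_def scaleR_add_left add_ac)
    also have "\<dots> = F (x + a *\<^sub>R b)" using F b by simp
    finally have per: "F (x + (a + T) *\<^sub>R b) - F (x + a *\<^sub>R b) = 0" by simp
    have "((\<lambda>s. F (x + s *\<^sub>R b)) has_vector_derivative F' (x + s *\<^sub>R b)) (at s within {a..a+T})" for s
      using has_real_derivative_along_line[OF der]
      by (metis has_real_derivative_iff_has_vector_derivative has_vector_derivative_at_within)
    moreover have "continuous_on {a..a+T} (\<lambda>s. F' (x + s *\<^sub>R b))"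
      by (rule continuous_on_compose2[OF F' continuous_on_line]) auto
    ultimately have "has_bochner_integral lborel (\<lambda>s. indicator {a..a+T} s *\<^sub>R F' (x + s *\<^sub>R b))
        (F (x + (a + T) *\<^sub>R b) - F (x + a *\<^sub>R b))"
      using T by (intro has_bochner_integral_FTC_Icc) auto
    then show ?thesis unfolding per by (simp add: has_bochner_integral_iff)
  qed
  have cell_iff: "x + s *\<^sub>R b \<in> cell (Flat_Torus L) \<longleftrightarrow>
      (\<forall>i\<in>Basis - {b}. 0 \<le> x \<bullet> i \<and> x \<bullet> i < L \<bullet> i) \<and> s \<in> {a..<a + T}" for s
  proof -
    have "(x + s *\<^sub>R b) \<bullet> i = (if i = b then x \<bullet> b + s else x \<bullet> i)" if "i \<in> Basis" for i
      using b that by (simp add: inner_add_left inner_Basis)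
    then show ?thesis using b by (auto simp: a_def T_def)
  qed
  have AE: "AE s in lborel. indicator {a..a+T} s *\<^sub>R F' (x + s *\<^sub>R b) = indicator {a..<a+T} s *\<^sub>R F' (x + s *\<^sub>R b)"
    using AE_lborel_singleton[of "a + T"] by eventually_elim (auto simp: indicator_def)
  have cont: "continuous_on UNIV (\<lambda>s. F' (x + s *\<^sub>R b))"
    by (rule continuous_on_compose2[OF F' continuous_on_line]) auto
  have [measurable]: "(\<lambda>s. F' (x + s *\<^sub>R b)) \<in> borel_measurable borel"
    using borel_measurable_continuous_onI[OF cont] .
  have half: "integrable lborel (\<lambda>s. indicator {a..<a+T} s *\<^sub>R F' (x + s *\<^sub>R b))"
     "(LINT s|lborel. indicator {a..<a+T} s *\<^sub>R F' (x + s *\<^sub>R b)) = 0"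
    using slice integrable_cong_AE[OF _ _ AE] integral_cong_AE[OF _ _ AE] by simp_all
  have "integrable lborel (\<lambda>s. indicat_real (cell (Flat_Torus L)) (x + s *\<^sub>R b) *\<^sub>R F' (x + s *\<^sub>R b)) \<and>
    (LINT s|lborel. indicat_real (cell (Flat_Torus L)) (x + s *\<^sub>R b) *\<^sub>R F' (x + s *\<^sub>R b)) = 0"
  proof (cases "\<forall>i\<in>Basis - {b}. 0 \<le> x \<bullet> i \<and> x \<bullet> i < L \<bullet> i")
    case True
    then have "indicat_real (cell (Flat_Torus L)) (x + s *\<^sub>R b) = indicator {a..<a+T} s" for s
      using cell_iff[of s] by (simp add: indicator_def del: cell.simps)
    then show ?thesis using half by simp
  next
    case False
    then have "indicat_real (cell (Flat_Torus L)) (x + s *\<^sub>R b) = 0" for s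
      using cell_iff[of s] by (simp add: indicator_def del: cell.simps)
    then show ?thesis by simp
  qed
  then show "integrable lborel (\<lambda>s. indicat_real (cell (Flat_Torus L)) (x + s *\<^sub>R b) *\<^sub>R F' (x + s *\<^sub>R b))"
    "(LINT s|lborel. indicat_real (cell (Flat_Torus L)) (x + s *\<^sub>R b) *\<^sub>R F' (x + s *\<^sub>R b)) = 0"
    by auto
qed

section \<open>Cutoff functions and the divergence of a field that vanishes on the boundary\<close>

lemma grad_eqI: "GDERIV f x :> D \<Longrightarrow> grad f x = D"
proof -
  assume D: "GDERIV f x :> D"
  have "D' = D" if "GDERIV f x :> D'" for D'
  proof -
    have "(\<lambda>h. h \<bullet> D') = (\<lambda>h. h \<bullet> D)"
      using has_derivative_unique[OF that[unfolded gderiv_def] D[unfolded gderiv_def]] .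
    then have "h \<bullet> (D' - D) = 0" for h by (metis inner_diff_right diff_self)
    then show ?thesis using inner_eq_zero_iff[of "D' - D"] by simp
  qed
  then show ?thesis using D unfolding grad_def by blast
qed

lemma GDERIV_directional:
  assumes "GDERIV f x :> D"
  shows "((\<lambda>s. f (x + s *\<^sub>R b)) has_real_derivative D \<bullet> b) (at 0)"
proof -
  have "((\<lambda>s. x + s *\<^sub>R b) has_derivative (\<lambda>s. s *\<^sub>R b)) (at 0)"
    by (auto intro!: derivative_eq_intros)
  moreover have "(f has_derivative (\<lambda>h. h \<bullet> D)) (at (x + 0 *\<^sub>R b))"
    using assms by (simp add: gderiv_def)
  ultimately have "((\<lambda>s. f (x + s *\<^sub>R b)) has_derivative (\<lambda>s. (s *\<^sub>R b) \<bullet> D)) (at 0)"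
    by (rule has_derivative_compose[where g = f])
  then show ?thesis
    by (simp add: has_field_derivative_def mult_commute_abs inner_commute)
qed

lemma GDERIV_continuous_on: "(\<And>x. GDERIV f x :> D x) \<Longrightarrow> continuous_on S f"
  unfolding gderiv_def by (intro continuous_at_imp_continuous_on ballI) (rule has_derivative_continuous)

lemma has_real_derivative_max_0_power2:
  "((\<lambda>z. (max 0 z)\<^sup>2) has_real_derivative 2 * max 0 z) (at z)"
proof -
  consider "z < 0" | "z = 0" | "z > 0" by linarith
  then show ?thesis
  proof cases
    case 1
    have "((\<lambda>z. 0) has_real_derivative 0) (at z)" by simp
    then show ?thesis
      using 1 has_field_derivative_transform_within_open[of "\<lambda>z. 0" 0 z "{..<0}" "\<lambda>z. (max 0 z)\<^sup>2"] by simp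
  next
    case 2
    have "((\<lambda>y. (max 0 y)\<^sup>2 / y) \<longlongrightarrow> (0::real)) (at 0)"
    proof (rule Lim_null_comparison)
      show "\<forall>\<^sub>F y in at 0. norm ((max 0 y)\<^sup>2 / y) \<le> \<bar>y::real\<bar>"
        by (rule always_eventually) (auto simp: max_def power2_eq_square)
      show "((\<lambda>y::real. \<bar>y\<bar>) \<longlongrightarrow> 0) (at 0)"
        by (rule tendsto_eq_intros | simp)+
    qed
    then show ?thesis using 2 by (simp add: has_field_derivative_iff)
  next
    case 3
    have "((\<lambda>z. z\<^sup>2) has_real_derivative 2 * z) (at z)" by (auto intro!: derivative_eq_intros)
    then show ?thesis
      using 3 has_field_derivative_transform_within_open[of "\<lambda>z. z\<^sup>2" "2 * z" z "{0<..}" "\<lambda>z. (max 0 z)\<^sup>2"] by simp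
  qed
qed

text \<open>
  A \<open>C\<^sup>1\<close> transition from \<open>0\<close> on \<open>(-\<infinity>,0]\<close> to \<open>1\<close> on \<open>[1,\<infinity>)\<close>;
  it is built from the \<open>C\<^sup>1\<close> function \<open>z \<mapsto> (max 0 z)\<^sup>2\<close>, and \<open>step'\<close> is its derivative.
\<close>

definition step :: "real \<Rightarrow> real" where
  "step z = 1 - (max 0 (1 - (max 0 z)\<^sup>2))\<^sup>2"

definition step' :: "real \<Rightarrow> real" where
  "step' z = 4 * max 0 (1 - (max 0 z)\<^sup>2) * max 0 z"

lemma step_deriv: "(step has_real_derivative step' z) (at z)"
  unfolding step_def[abs_def] step'_def
  by (rule derivative_eq_intros DERIV_chain2[OF has_real_derivative_max_0_power2]
      has_real_derivative_max_0_power2 refl)+ simp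

lemma continuous_on_step': "continuous_on S step'"
  unfolding step'_def by (intro continuous_intros)

lemma step_eq_0: "z \<le> 0 \<Longrightarrow> step z = 0" by (simp add: step_def)

lemma step_eq_1: "z \<ge> 1 \<Longrightarrow> step z = 1"
  using power_mono[of 1 z 2] by (simp add: step_def)

lemma step_bounds: "0 \<le> step z" "step z \<le> 1"
  by (auto simp: step_def max_def power2_le_iff_abs_le power_le_one)

lemma GDERIV_compose:
  assumes "GDERIV f x :> D" "(g has_real_derivative d) (at (f x))"
  shows "GDERIV (\<lambda>x. g (f x)) x :> d *\<^sub>R D"
  using has_derivative_compose[OF assms(1)[unfolded gderiv_def] assms(2)[unfolded has_field_derivative_def]]
  by (simp add: gderiv_def)

lemma C1_bump:
  fixes c :: "'a::euclidean_space"
  assumes "r > 0"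
  obtains \<theta> :: "'a \<Rightarrow> real" and D where
    "\<And>x. GDERIV \<theta> x :> D x" "continuous_on UNIV D"
    "\<And>x. dist c x \<le> r / 2 \<Longrightarrow> \<theta> x = 1" "\<And>x. dist c x \<ge> r \<Longrightarrow> \<theta> x = 0"
proof
  \<comment> \<open>\<open>p\<close> is at least \<open>3 / 2\<close> on the ball of radius \<open>r / 2\<close> and at most \<open>0\<close> outside the ball of radius \<open>r\<close>.\<close>
  define p where "p x = 2 / r\<^sup>2 * (r\<^sup>2 - (x - c) \<bullet> (x - c))" for x
  have p: "GDERIV p x :> - (4 / r\<^sup>2) *\<^sub>R (x - c)" for x
    unfolding p_def gderiv_def
    by (rule derivative_eq_intros refl)+ (auto simp: inner_commute fun_eq_iff inner_diff_right inner_diff_left algebra_simps)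
  show "GDERIV (\<lambda>x. step (p x)) x :> step' (p x) *\<^sub>R (- (4 / r\<^sup>2) *\<^sub>R (x - c))" for x
    by (rule GDERIV_compose[OF p step_deriv])
  show "continuous_on UNIV (\<lambda>x. step' (p x) *\<^sub>R (- (4 / r\<^sup>2) *\<^sub>R (x - c)))"
    unfolding p_def by (intro continuous_intros continuous_on_compose2[OF continuous_on_step']) auto
  have pd: "p x = 2 / r\<^sup>2 * (r\<^sup>2 - (dist c x)\<^sup>2)" for x
    unfolding p_def power2_norm_eq_inner[symmetric] dist_norm norm_minus_commute[of x c] ..
  show "step (p x) = 1" if "dist c x \<le> r / 2" for x
  proof (rule step_eq_1)
    have "(dist c x)\<^sup>2 \<le> (r/2)\<^sup>2" using that by (intro power_mono) auto
    then have "r\<^sup>2 - (dist c x)\<^sup>2 \<ge> r\<^sup>2 / 2" by (simp add: power_divide) (use zero_le_power2[of r] in linarith)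
    then show "1 \<le> p x" unfolding pd using assms by (simp add: field_simps)
  qed
  show "step (p x) = 0" if "dist c x \<ge> r" for x
  proof (rule step_eq_0)
    have "r\<^sup>2 \<le> (dist c x)\<^sup>2" using that assms by (intro power_mono) auto
    then show "p x \<le> 0" unfolding pd by (intro mult_nonneg_nonpos) auto
  qed
qed

text \<open>
  A vector field \<open>F\<close>, continuous up to the boundary, that vanishes outside the compact set
  \<open>K\<close>. Only the partial derivatives \<open>Q b = \<partial>\<^sub>b F\<^sub>b\<close> that enter the divergence
  \<open>\<Sum>b\<in>Basis. Q b\<close> are recorded. This makes the class stable under products with
  \<open>C\<^sup>1\<close> functions although \<open>F\<close> need not be differentiable as a map.
\<close>

definition div_field :: "'a::euclidean_space set \<Rightarrow> 'a set \<Rightarrow> ('a \<Rightarrow> 'a) \<Rightarrow> ('a \<Rightarrow> 'a \<Rightarrow> real) \<Rightarrow> bool" where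
  "div_field \<Omega> K F Q \<longleftrightarrow> compact K \<and> continuous_on (closure \<Omega>) F \<and> (\<forall>x\<in>closure \<Omega> - K. F x = 0) \<and>
     (\<forall>b\<in>Basis. (\<forall>x\<in>\<Omega>. ((\<lambda>s. F (x + s *\<^sub>R b) \<bullet> b) has_real_derivative Q b x) (at 0)) \<and>
        continuous_on \<Omega> (Q b) \<and> bounded (Q b ` (\<Omega> \<inter> K)))"

lemma div_field_mult:
  assumes Q: "div_field \<Omega> K F Q" and K': "closed K'"
    and \<theta>: "\<And>x. GDERIV \<theta> x :> D x" "continuous_on UNIV D" "\<And>x. x \<notin> K' \<Longrightarrow> \<theta> x = 0"
  shows "div_field \<Omega> (K \<inter> K') (\<lambda>x. \<theta> x *\<^sub>R F x) (\<lambda>b x. \<theta> x * Q b x + (D x \<bullet> b) * (F x \<bullet> b))"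
proof -
  have F: "compact K" "continuous_on (closure \<Omega>) F" "\<And>x. x \<in> closure \<Omega> - K \<Longrightarrow> F x = 0"
    and der: "\<And>b x. b \<in> Basis \<Longrightarrow> x \<in> \<Omega> \<Longrightarrow> ((\<lambda>s. F (x + s *\<^sub>R b) \<bullet> b) has_real_derivative Q b x) (at 0)"
    and cont: "\<And>b. b \<in> Basis \<Longrightarrow> continuous_on \<Omega> (Q b)"
    and bdd: "\<And>b. b \<in> Basis \<Longrightarrow> bounded (Q b ` (\<Omega> \<inter> K))"
    using Q by (auto simp: div_field_def)
  have c\<theta>: "continuous_on S \<theta>" "continuous_on S D" for S
    using GDERIV_continuous_on[OF \<theta>(1)] continuous_on_subset[OF \<theta>(2)] by auto
  have cF: "continuous_on \<Omega> F"
    using continuous_on_subset[OF F(2) closure_subset] .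
  show ?thesis
    unfolding div_field_def
  proof (intro conjI ballI)
    show "compact (K \<inter> K')" using F(1) K' by (rule compact_Int_closed)
    show "continuous_on (closure \<Omega>) (\<lambda>x. \<theta> x *\<^sub>R F x)" by (intro continuous_intros c\<theta> F)
    show "\<theta> x *\<^sub>R F x = 0" if "x \<in> closure \<Omega> - K \<inter> K'" for x
      using that F(3) \<theta>(3) by auto
    fix b :: 'a assume b: "b \<in> Basis"
    show "((\<lambda>s. \<theta> (x + s *\<^sub>R b) *\<^sub>R F (x + s *\<^sub>R b) \<bullet> b) has_real_derivative
           \<theta> x * Q b x + D x \<bullet> b * (F x \<bullet> b)) (at 0)" if x: "x \<in> \<Omega>" for x
      using DERIV_mult[OF GDERIV_directional[OF \<theta>(1)[of x], of b] der[OF b x]] by (simp add: algebra_simps)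
    show "continuous_on \<Omega> (\<lambda>x. \<theta> x * Q b x + D x \<bullet> b * (F x \<bullet> b))"
      by (intro continuous_intros c\<theta> cont b cF)
    have "compact (closure \<Omega> \<inter> K)" using F(1) by (simp add: closed_Int_compact)
    moreover have "continuous_on (closure \<Omega> \<inter> K) (\<lambda>x. D x \<bullet> b * (F x \<bullet> b))"
      by (intro continuous_intros c\<theta> continuous_on_subset[OF F(2)]) auto
    ultimately have "bounded ((\<lambda>x. D x \<bullet> b * (F x \<bullet> b)) ` (closure \<Omega> \<inter> K))"
      using compact_continuous_image compact_imp_bounded by blast
    then have b1: "bounded ((\<lambda>x. D x \<bullet> b * (F x \<bullet> b)) ` (\<Omega> \<inter> K \<inter> K'))"
      by (rule bounded_subset) (use closure_subset[of \<Omega>] in auto)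
    have "bounded (\<theta> ` K)"
      using compact_continuous_image[OF c\<theta>(1) F(1)] compact_imp_bounded by blast
    then obtain B where B: "\<And>x. x \<in> K \<Longrightarrow> \<bar>\<theta> x\<bar> \<le> B" by (auto simp: bounded_iff)
    obtain B' where B': "\<And>x. x \<in> \<Omega> \<inter> K \<Longrightarrow> \<bar>Q b x\<bar> \<le> B'" using bdd[OF b] by (auto simp: bounded_iff)
    have "norm (\<theta> x * Q b x) \<le> B * B'" if "x \<in> \<Omega> \<inter> K \<inter> K'" for x
      using B[of x] B'[of x] that by (auto simp: abs_mult intro!: mult_mono)
    then have b2: "bounded ((\<lambda>x. \<theta> x * Q b x) ` (\<Omega> \<inter> K \<inter> K'))" by (auto simp: bounded_iff)
    show "bounded ((\<lambda>x. \<theta> x * Q b x + D x \<bullet> b * (F x \<bullet> b)) ` (\<Omega> \<inter> (K \<inter> K')))"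
      using bounded_plus_comp[OF b2 b1] by (simp add: Int_assoc)
  qed
qed

lemma div_field_eq_0:
  assumes "div_field \<Omega> K F Q" "open \<Omega>" "b \<in> Basis" "x \<in> \<Omega> - K"
  shows "Q b x = 0"
proof (rule directional_deriv_eq_0_if_locally_0[where F = "\<lambda>x. F x \<bullet> b" and U = "\<Omega> - K"])
  show "((\<lambda>s. F (x + s *\<^sub>R b) \<bullet> b) has_real_derivative Q b x) (at 0)"
    using assms by (simp add: div_field_def)
  show "open (\<Omega> - K)" using assms by (auto simp: div_field_def intro: compact_imp_closed)
  show "F y \<bullet> b = 0" if "y \<in> \<Omega> - K" for y
    using assms that closure_subset[of \<Omega>] by (auto simp: div_field_def)
qed fact

lemma div_field_integrable:
  assumes Q: "div_field \<Omega> K F Q" and \<Omega>: "open \<Omega>" and b: "b \<in> Basis"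
  shows "set_integrable lborel \<Omega> (Q b)"
proof -
  have K: "compact K" "continuous_on \<Omega> (Q b)" "bounded (Q b ` (\<Omega> \<inter> K))"
    using Q b by (auto simp: div_field_def)
  have "set_integrable lborel (\<Omega> \<inter> K) (Q b)"
    using K \<Omega> by (intro continuous_bounded_set_integrable)
      (auto intro: continuous_on_subset bounded_subset[OF compact_imp_bounded] borel_compact)
  moreover have "(\<lambda>x. indicat_real (\<Omega> \<inter> K) x *\<^sub>R Q b x) = (\<lambda>x. indicat_real \<Omega> x *\<^sub>R Q b x)"
    using div_field_eq_0[OF Q \<Omega> b] by (auto simp: indicator_def fun_eq_iff)
  ultimately show ?thesis by (simp add: set_integrable_def)
qed

lemma div_field_integrable_sum:
  assumes Q: "div_field \<Omega> K F Q" and \<Omega>: "open \<Omega>"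
  shows "set_integrable lborel \<Omega> (\<lambda>x. \<Sum>b\<in>Basis. Q b x)"
  using div_field_integrable[OF assms] unfolding set_integrable_def scaleR_sum_right
  by (intro Bochner_Integration.integrable_sum) auto

lemma integral_div_sum:
  assumes Q: "div_field \<Omega> K F Q" and \<Omega>: "open \<Omega>"
  shows "(LINT x:\<Omega>|lborel. \<Sum>b\<in>Basis. Q b x) = (\<Sum>b\<in>Basis. LINT x:\<Omega>|lborel. Q b x)"
  using div_field_integrable[OF assms] unfolding set_integrable_def scaleR_sum_right set_lebesgue_integral_def
  by (intro Bochner_Integration.integral_sum) auto

lemma integral_div_eq_0_if_0_on_frontier:
  assumes Q: "div_field \<Omega> K F Q" and \<Omega>: "open \<Omega>" and F0: "\<And>x. x \<in> frontier \<Omega> \<Longrightarrow> F x = 0"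
  shows "(LINT x:\<Omega>|lborel. \<Sum>b\<in>Basis. Q b x) = 0"
proof -
  have "(LINT x:\<Omega>|lborel. Q b x) = 0" if b: "b \<in> Basis" for b
  proof (rule integral_partial_deriv_eq_0[OF \<Omega> _ b, where F = "\<lambda>x. F x \<bullet> b" and K = K])
    show "continuous_on (closure \<Omega>) (\<lambda>x. F x \<bullet> b)"
      using Q by (auto simp: div_field_def intro!: continuous_intros)
  qed (use Q b F0 in \<open>auto simp: div_field_def\<close>)
  then show ?thesis by (simp add: integral_div_sum[OF Q \<Omega>])
qed

section \<open>Outer normals and boundary layers\<close>

text \<open>
  A negative value would put \<open>x\<close> into the open set \<open>\<Omega>\<close>; a positive one would persist
  nearby and make \<open>x\<close> an exterior point.
\<close>

lemma boundary_function_eq_0: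
  assumes "open \<Omega>" "open B" "continuous_on B \<psi>" "\<And>y. y \<in> B \<Longrightarrow> y \<in> \<Omega> \<longleftrightarrow> \<psi> y < (0::real)"
    and x: "x \<in> frontier \<Omega>" "x \<in> B"
  shows "\<psi> x = 0"
proof (rule ccontr)
  assume "\<psi> x \<noteq> 0"
  have "x \<in> closure \<Omega>" "x \<notin> \<Omega>" using x interior_open[OF assms(1)] by (auto simp: frontier_def)
  then have "\<psi> x > 0" using assms(4)[OF x(2)] \<open>\<psi> x \<noteq> 0\<close> by auto
  define U where "U = B \<inter> \<psi> -` {0<..}"
  have "open U"
    unfolding U_def using continuous_open_preimage[OF assms(3,2)] by auto
  moreover have "x \<in> U" using x \<open>\<psi> x > 0\<close> by (simp add: U_def)
  moreover have "U \<inter> \<Omega> = {}" using assms(4) by (fastforce simp: U_def)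
  ultimately show False using \<open>x \<in> closure \<Omega>\<close> open_Int_closure_eq_empty[of U \<Omega>] by auto
qed

text \<open>
  If the unit vectors differed, their difference \<open>d\<close> would satisfy \<open>a \<bullet> d < 0 < c \<bullet> d\<close>
  by the Cauchy-Schwarz inequality. Moving from \<open>x\<close> in direction \<open>d\<close> would then enter
  \<open>\<Omega>\<close> according to \<open>\<psi>\<close> and leave it according to \<open>\<phi>\<close>.
\<close>

lemma unit_normals_eq:
  fixes a c :: "'a::euclidean_space"
  assumes \<psi>: "GDERIV \<psi> x :> a" "\<psi> x = (0::real)" "r > 0" "\<And>y. y \<in> ball x r \<Longrightarrow> y \<in> \<Omega> \<longleftrightarrow> \<psi> y < 0" "a \<noteq> 0"
    and \<phi>: "GDERIV \<phi> x :> c" "\<phi> x = (0::real)" "q > 0" "\<And>y. y \<in> ball x q \<Longrightarrow> y \<in> \<Omega> \<longleftrightarrow> \<phi> y < 0" "c \<noteq> 0"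
  shows "sgn a = sgn c"
proof (rule ccontr)
  assume "sgn a \<noteq> sgn c"
  define d where "d = sgn c - sgn a"
  have n: "norm (sgn a) = 1" "norm (sgn c) = 1" using assms by (simp_all add: norm_sgn)
  then have "sgn a \<bullet> sgn a = 1" "sgn c \<bullet> sgn c = 1" by (simp_all add: dot_square_norm)
  then have eq: "d \<bullet> d = 2 - 2 * (sgn a \<bullet> sgn c)" "sgn a \<bullet> d = sgn a \<bullet> sgn c - 1" "sgn c \<bullet> d = 1 - sgn a \<bullet> sgn c"
    unfolding d_def by (simp_all add: inner_diff_left inner_diff_right inner_commute)
  moreover have "d \<bullet> d > 0" using \<open>sgn a \<noteq> sgn c\<close> by (simp add: d_def)
  ultimately have "sgn a \<bullet> d < 0" "sgn c \<bullet> d > 0" by auto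
  then have ad: "a \<bullet> d < 0" and cd: "c \<bullet> d > 0"
    using assms(5,10) by (auto simp: sgn_div_norm mult_less_0_iff zero_less_mult_iff)
  obtain e1 where e1: "e1 > 0" "\<And>h. 0 < h \<Longrightarrow> h < e1 \<Longrightarrow> \<psi> (x + h *\<^sub>R d) < 0"
    using DERIV_neg_dec_right[OF GDERIV_directional[OF \<psi>(1), of d] ad] \<psi>(2) by auto
  obtain e2 where e2: "e2 > 0" "\<And>h. 0 < h \<Longrightarrow> h < e2 \<Longrightarrow> \<phi> (x + h *\<^sub>R d) > 0"
    using DERIV_pos_inc_right[OF GDERIV_directional[OF \<phi>(1), of d] cd] \<phi>(2) by auto
  have dn: "norm d > 0" using \<open>d \<bullet> d > 0\<close> by auto
  define m where "m = Min {e1, e2, r / norm d, q / norm d}"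
  define h where "h = m / 2"
  have m: "m > 0" using e1 e2 \<psi>(3) \<phi>(3) dn by (simp add: m_def)
  then have "h > 0" by (simp add: h_def)
  have "h < z" if "z \<in> {e1, e2, r / norm d, q / norm d}" for z
  proof -
    have "m \<le> z" unfolding m_def using that by (intro Min_le) auto
    then show ?thesis using m by (simp add: h_def)
  qed
  then have h: "h < e1" "h < e2" "h < r / norm d" "h < q / norm d" by auto
  have "x + h *\<^sub>R d \<in> ball x r" "x + h *\<^sub>R d \<in> ball x q"
    using h \<open>h > 0\<close> dn by (auto simp: dist_norm pos_less_divide_eq)
  then show False using e1(2)[OF \<open>h > 0\<close>] e2(2)[OF \<open>h > 0\<close>] h \<psi>(4) \<phi>(4) by fastforce
qed

lemma graph_function_GDERIV:
  fixes e :: "'a::euclidean_space"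
  assumes e: "e \<in> Basis \<or> - e \<in> Basis" and \<gamma>: "C1 \<gamma>"
  obtains D where "\<And>y. GDERIV (\<lambda>y. y \<bullet> e - \<gamma> (y - (y \<bullet> e) *\<^sub>R e)) y :> D y" "continuous_on UNIV D"
    "\<And>y. D y \<bullet> e = 1"
proof -
  obtain G where G: "continuous_on UNIV G" "\<And>x. GDERIV \<gamma> x :> G x" using \<gamma> by (auto simp: C1_def)
  define P where "P y = y - (y \<bullet> e) *\<^sub>R e" for y
  have ee: "e \<bullet> e = 1" using e by (metis inner_Basis inner_minus_left inner_minus_right minus_minus)
  show ?thesis
  proof
    fix y
    have "(P has_derivative P) (at y)"
      unfolding P_def by (auto intro!: derivative_eq_intros)
    then have "((\<lambda>y. \<gamma> (P y)) has_derivative (\<lambda>h. P h \<bullet> G (P y))) (at y)"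
      using has_derivative_compose G(2)[unfolded gderiv_def] by blast
    then have "((\<lambda>y. y \<bullet> e - \<gamma> (P y)) has_derivative (\<lambda>h. h \<bullet> e - P h \<bullet> G (P y))) (at y)"
      by (intro has_derivative_diff has_derivative_inner_left) auto
    moreover have "h \<bullet> e - P h \<bullet> G (P y) = h \<bullet> (e - G (P y) + (G (P y) \<bullet> e) *\<^sub>R e)" for h
      by (simp add: P_def inner_diff_left inner_diff_right inner_add_right inner_commute algebra_simps)
    ultimately show "GDERIV (\<lambda>y. y \<bullet> e - \<gamma> (y - (y \<bullet> e) *\<^sub>R e)) y :> e - G (P y) + (G (P y) \<bullet> e) *\<^sub>R e"
      by (simp add: gderiv_def P_def)
    show "(e - G (P y) + (G (P y) \<bullet> e) *\<^sub>R e) \<bullet> e = 1"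
      by (simp add: inner_diff_left inner_add_left ee)
  next
    have "continuous_on UNIV (\<lambda>y. G (P y))"
      by (rule continuous_on_compose2[OF G(1)]) (auto simp: P_def intro!: continuous_intros)
    then show "continuous_on UNIV (\<lambda>y. e - G (P y) + (G (P y) \<bullet> e) *\<^sub>R e)"
      by (intro continuous_intros)
  qed
qed

text \<open>
  Different graph representations of the boundary near \<open>x\<close> give the same normal; hence the
  description operator in \<open>normal_deriv\<close> denotes any normal that a graph representation provides.
\<close>

lemma outer_unit_normal_unique:
  fixes \<Omega> :: "'a::euclidean_space set"
  assumes \<Omega>: "open \<Omega>" and x: "x \<in> frontier \<Omega>"
    and \<nu>: "outer_unit_normal \<Omega> x \<nu>" and \<mu>: "outer_unit_normal \<Omega> x \<mu>"
  shows "\<nu> = \<mu>"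
proof -
  have repr: "\<exists>\<psi> a r. GDERIV \<psi> x :> a \<and> \<psi> x = (0::real) \<and> r > 0 \<and>
      (\<forall>y\<in>ball x r. y \<in> \<Omega> \<longleftrightarrow> \<psi> y < 0) \<and> a \<noteq> 0 \<and> \<eta> = sgn a"
    if oun: "outer_unit_normal \<Omega> x \<eta>" for \<eta>
  proof -
    obtain e \<gamma> r where e: "e \<in> Basis \<or> - e \<in> Basis" "C1 \<gamma>" "r > 0"
       and y: "\<forall>y\<in>ball x r. y \<in> \<Omega> \<longleftrightarrow> y \<bullet> e < \<gamma> (y - (y \<bullet> e) *\<^sub>R e)"
       and \<eta>: "\<eta> = sgn (grad (\<lambda>y. y \<bullet> e - \<gamma> (y - (y \<bullet> e) *\<^sub>R e)) x)"
      using oun by (auto simp: outer_unit_normal_def)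
    obtain D where D: "\<And>y. GDERIV (\<lambda>y. y \<bullet> e - \<gamma> (y - (y \<bullet> e) *\<^sub>R e)) y :> D y" "\<And>y. D y \<bullet> e = 1"
      using graph_function_GDERIV[OF e(1,2)] by metis
    have "x \<bullet> e - \<gamma> (x - (x \<bullet> e) *\<^sub>R e) = 0"
    proof (rule boundary_function_eq_0[OF \<Omega> _ _ _ x])
      show "continuous_on (ball x r) (\<lambda>y. y \<bullet> e - \<gamma> (y - (y \<bullet> e) *\<^sub>R e))"
        by (rule GDERIV_continuous_on[OF D(1)])
    qed (use y e in auto)
    moreover have "D x \<noteq> 0" using D(2)[of x] by auto
    ultimately show ?thesis
      using D(1)[of x] e(3) y \<eta> grad_eqI[OF D(1)[of x]]
      by (intro exI[of _ "\<lambda>y. y \<bullet> e - \<gamma> (y - (y \<bullet> e) *\<^sub>R e)"] exI[of _ "D x"] exI[of _ r]) auto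
  qed
  obtain \<psi> a r where 1: "GDERIV \<psi> x :> a" "\<psi> x = (0::real)" "r > 0"
      "\<forall>y\<in>ball x r. y \<in> \<Omega> \<longleftrightarrow> \<psi> y < 0" "a \<noteq> 0" "\<nu> = sgn a"
    using repr[OF \<nu>] by blast
  obtain \<phi> c q where 2: "GDERIV \<phi> x :> c" "\<phi> x = (0::real)" "q > 0"
      "\<forall>y\<in>ball x q. y \<in> \<Omega> \<longleftrightarrow> \<phi> y < 0" "c \<noteq> 0" "\<mu> = sgn c"
    using repr[OF \<mu>] by blast
  show ?thesis
    unfolding 1(6) 2(6) by (rule unit_normals_eq[where \<Omega> = \<Omega>, OF 1(1-3) _ 1(5) 2(1-3) _ 2(5)]) (use 1(4) 2(4) in auto)
qed

text \<open>
  Along lines in direction \<open>b\<close> the function \<open>\<psi>\<close> is affine with slope \<open>\<plusminus>1\<close>, so such a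
  line meets the layer in a set of length at most \<open>\<delta>\<close>, and only lines from a bounded set meet
  \<open>K\<close>. This is the only information on the size of the boundary that the divergence theorem uses.
\<close>

lemma layer_measure:
  fixes \<psi> :: "'a::euclidean_space \<Rightarrow> real"
  assumes b: "b \<in> Basis" and \<psi>: "continuous_on UNIV \<psi>" and K: "compact K"
    and c: "\<bar>c\<bar> = 1" and shift: "\<And>x s. \<psi> (x + s *\<^sub>R b) = \<psi> x + c * s"
  obtains C where "C \<ge> 0" "\<And>\<delta>. \<delta> > 0 \<Longrightarrow> measure lborel (K \<inter> {x. -\<delta> < \<psi> x \<and> \<psi> x < 0}) \<le> C * \<delta>"
proof -
  obtain R where R: "\<And>x. x \<in> K \<Longrightarrow> norm x \<le> R" "R > 0"
    using compact_imp_bounded[OF K] bounded_pos by blast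
  \<comment> \<open>If \<open>0 \<le> x \<bullet> b \<le> 1\<close> and \<open>x + s b \<in> K\<close> then \<open>\<bar>s\<bar> \<le> R + 1\<close>, hence \<open>x \<in> B\<close>.\<close>
  define B where "B = cball (0::'a) (2 * R + 1)"
  show ?thesis
  proof
    show "measure lborel B \<ge> 0" by simp
    fix \<delta> :: real assume \<delta>: "\<delta> > 0"
    define A where "A = K \<inter> {x. -\<delta> < \<psi> x \<and> \<psi> x < 0}"
    have [measurable]: "\<psi> \<in> borel_measurable borel" using \<psi> by (rule borel_measurable_continuous_onI)
    have [measurable]: "K \<in> sets borel" using K by (rule borel_compact)
    have A [measurable]: "A \<in> sets borel" unfolding A_def by measurable
    have "emeasure lborel A = (\<integral>\<^sup>+x. indicator A x \<partial>lborel)" by simp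
    also have "\<dots> = (\<integral>\<^sup>+x. indicator {x. 0 \<le> x \<bullet> b \<and> x \<bullet> b \<le> 1} x * (\<integral>\<^sup>+s. indicator A (x + s *\<^sub>R b) \<partial>lborel) \<partial>lborel)"
      by (subst nn_integral_slices[OF _ b]) simp_all
    also have "\<dots> \<le> (\<integral>\<^sup>+x. ennreal \<delta> * indicator B x \<partial>lborel)"
    proof (rule nn_integral_mono)
      fix x :: 'a
      have in_slice: "(\<integral>\<^sup>+s. indicator A (x + s *\<^sub>R b) \<partial>lborel) \<le> ennreal \<delta>"
      proof -
        have *: "\<exists>l. \<forall>s. -\<delta> < \<psi> x + c * s \<and> \<psi> x + c * s < 0 \<longrightarrow> s \<in> {l..l + \<delta>}"
        proof (cases "c = 1")
          case True then show ?thesis by (intro exI[of _ "- \<psi> x - \<delta>"]) auto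
        next
          case False then have "c = -1" using c by linarith
          then show ?thesis by (intro exI[of _ "\<psi> x"]) auto
        qed
        then obtain l where l: "\<And>s. -\<delta> < \<psi> x + c * s \<Longrightarrow> \<psi> x + c * s < 0 \<Longrightarrow> s \<in> {l..l + \<delta>}" by blast
        have "(\<integral>\<^sup>+s. indicator A (x + s *\<^sub>R b) \<partial>lborel) \<le> (\<integral>\<^sup>+s. indicator {l..l + \<delta>} s \<partial>lborel)"
        proof (rule nn_integral_mono)
          fix s show "indicator A (x + s *\<^sub>R b) \<le> (indicator {l..l + \<delta>} s :: ennreal)"
            using l[of s] by (auto simp: indicator_def A_def shift)
        qed
        also have "\<dots> = ennreal \<delta>" using \<delta> by simp
        finally show ?thesis .
      qed
      show "indicator {x. 0 \<le> x \<bullet> b \<and> x \<bullet> b \<le> 1} x * (\<integral>\<^sup>+s. indicator A (x + s *\<^sub>R b) \<partial>lborel) \<le> ennreal \<delta> * indicator B x"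
      proof (cases "0 \<le> x \<bullet> b \<and> x \<bullet> b \<le> 1 \<and> (\<exists>s. x + s *\<^sub>R b \<in> A)")
        case True
        then obtain s where s: "0 \<le> x \<bullet> b" "x \<bullet> b \<le> 1" "x + s *\<^sub>R b \<in> A" by auto
        then have n: "norm (x + s *\<^sub>R b) \<le> R" using R by (auto simp: A_def)
        have "\<bar>(x + s *\<^sub>R b) \<bullet> b\<bar> \<le> R" using Basis_le_norm[OF b, of "x + s *\<^sub>R b"] n by simp
        moreover have "(x + s *\<^sub>R b) \<bullet> b = x \<bullet> b + s" using b by (simp add: inner_add_left)
        ultimately have "\<bar>s\<bar> \<le> R + 1" using s by linarith
        moreover have "norm x \<le> norm (x + s *\<^sub>R b) + norm (s *\<^sub>R b)" by (metis add_diff_cancel norm_triangle_ineq4)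
        ultimately have "norm x \<le> 2 * R + 1" using n b by simp
        then show ?thesis using in_slice s by (simp add: B_def)
      next
        case False
        then have "x \<in> {x. 0 \<le> x \<bullet> b \<and> x \<bullet> b \<le> 1} \<Longrightarrow> indicator A (x + s *\<^sub>R b) = (0::ennreal)" for s by auto
        then have "indicator {x. 0 \<le> x \<bullet> b \<and> x \<bullet> b \<le> 1} x * (\<integral>\<^sup>+s. indicator A (x + s *\<^sub>R b) \<partial>lborel) = 0"
          by (cases "x \<in> {x. 0 \<le> x \<bullet> b \<and> x \<bullet> b \<le> 1}") simp_all
        then show ?thesis by (simp only: zero_le)
      qed
    qed
    also have "\<dots> = ennreal \<delta> * emeasure lborel B" unfolding B_def by (rule nn_integral_cmult_indicator) simp
    also have "emeasure lborel B = ennreal (measure lborel B)"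
      using emeasure_bounded_finite[of B] by (intro emeasure_eq_ennreal_measure) (auto simp: B_def)
    also have "ennreal \<delta> * ennreal (measure lborel B) = ennreal (measure lborel B * \<delta>)"
      using \<delta> by (simp add: ennreal_mult mult.commute)
    finally have "emeasure lborel A \<le> ennreal (measure lborel B * \<delta>)" .
    then show "measure lborel (K \<inter> {x. -\<delta> < \<psi> x \<and> \<psi> x < 0}) \<le> measure lborel B * \<delta>"
      unfolding A_def[symmetric] measure_def using \<delta> by (metis enn2real_leI mult_nonneg_nonneg measure_nonneg less_imp_le measure_def)
  qed
qed

section \<open>The divergence theorem for fields without boundary flux\<close>

text \<open>
  Near \<open>K\<close> the set \<open>\<Omega>\<close> is \<open>{\<psi> < 0}\<close>, and \<open>F \<bullet> \<nabla>\<psi> = 0\<close> on its boundary. The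
  cutoff \<open>\<eta> \<delta>\<close> vanishes where \<open>\<psi> = 0\<close> and equals \<open>1\<close> where \<open>\<psi> \<le> - \<delta>\<close>, so
  \<open>\<integral> div (\<eta> F) = 0\<close>, that is, \<open>\<integral> \<eta> div F = - \<integral> \<nabla>\<eta> \<bullet> F\<close>. The right-hand side lives on a
  layer of measure \<open>O(\<delta>)\<close>, its integrand is \<open>O(1 / \<delta>)\<close> times \<open>\<nabla>\<psi> \<bullet> F\<close>, and
  \<open>\<nabla>\<psi> \<bullet> F\<close> is uniformly small there by continuity. Letting \<open>\<delta> \<rightarrow> 0\<close> gives
  \<open>\<integral> div F = 0\<close> without any surface measure.
\<close>

lemma integral_div_eq_0_graph:
  fixes \<Omega> :: "'a::euclidean_space set"
  assumes Q: "div_field \<Omega> K F Q" and \<Omega>: "open \<Omega>" and KB: "K \<subseteq> ball p r"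
    and \<psi>: "\<And>y. GDERIV \<psi> y :> D y" "continuous_on UNIV D"
    and graph: "\<And>y. y \<in> ball p r \<Longrightarrow> y \<in> \<Omega> \<longleftrightarrow> \<psi> y < (0::real)"
    and b: "b \<in> Basis" and c: "\<bar>c\<bar> = 1" and shift: "\<And>x s. \<psi> (x + s *\<^sub>R b) = \<psi> x + c * s"
    and flux: "\<And>y. y \<in> frontier \<Omega> \<Longrightarrow> y \<in> ball p r \<Longrightarrow> F y \<bullet> D y = 0"
  shows "(LINT x:\<Omega>|lborel. \<Sum>b\<in>Basis. Q b x) = 0"
proof -
  define S where "S x = (\<Sum>b\<in>Basis. Q b x)" for x
  have K: "compact K" and F: "continuous_on (closure \<Omega>) F" "\<And>x. x \<in> closure \<Omega> - K \<Longrightarrow> F x = 0"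
    using Q by (auto simp: div_field_def)
  have S_int: "set_integrable lborel \<Omega> S"
    using div_field_integrable_sum[OF Q \<Omega>] by (simp add: S_def[abs_def])
  have S_0: "S x = 0" if "x \<in> \<Omega> - K" for x
    using div_field_eq_0[OF Q \<Omega> _ that] by (simp add: S_def)
  have c\<psi>: "continuous_on A \<psi>" for A by (rule GDERIV_continuous_on[OF \<psi>(1)])
  have [measurable]: "\<psi> \<in> borel_measurable borel" by (rule borel_measurable_continuous_onI[OF c\<psi>])
  have [measurable]: "K \<in> sets borel" "\<Omega> \<in> sets borel" using K \<Omega> by (auto intro: borel_compact)
  have \<psi>0: "\<psi> y = 0" if "y \<in> frontier \<Omega>" "y \<in> ball p r" for y
    by (rule boundary_function_eq_0[OF \<Omega> open_ball c\<psi> graph that])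
  define m where "m \<delta> y = max 0 (1 + \<psi> y / \<delta>)" for \<delta> y
  define \<eta> where "\<eta> \<delta> y = 1 - (m \<delta> y)\<^sup>2" for \<delta> y
  define g where "g \<delta> y = 2 * m \<delta> y / \<delta> * (D y \<bullet> F y)" for \<delta> y
  have m_bound: "0 \<le> m \<delta> y" "y \<in> \<Omega> \<inter> K \<Longrightarrow> \<delta> > 0 \<Longrightarrow> m \<delta> y \<le> 1" for \<delta> y
    using graph[of y] KB by (auto simp: m_def divide_le_0_iff)
  have \<eta>: "GDERIV (\<eta> \<delta>) y :> (- (2 * m \<delta> y / \<delta>)) *\<^sub>R D y" if "\<delta> > 0" for \<delta> y
  proof -
    have "((\<lambda>z. 1 - (max 0 (1 + z / \<delta>))\<^sup>2) has_real_derivative - (2 * m \<delta> y / \<delta>)) (at (\<psi> y))"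
      unfolding m_def
    proof -
      have "((\<lambda>z. 1 + z / \<delta>) has_real_derivative 1 / \<delta>) (at (\<psi> y))"
        using that by (auto intro!: derivative_eq_intros)
      from DERIV_diff[OF DERIV_const DERIV_chain2[OF has_real_derivative_max_0_power2 this], of 1]
      show "((\<lambda>z. 1 - (max 0 (1 + z / \<delta>))\<^sup>2) has_real_derivative - (2 * max 0 (1 + \<psi> y / \<delta>) / \<delta>)) (at (\<psi> y))"
        by simp
    qed
    from GDERIV_compose[OF \<psi>(1) this] show ?thesis by (simp add: \<eta>_def[abs_def] m_def)
  qed
  have c\<eta>': "continuous_on UNIV (\<lambda>y. (- (2 * m \<delta> y / \<delta>)) *\<^sub>R D y)" if "\<delta> > 0" for \<delta>
    unfolding m_def using that by (intro continuous_intros c\<psi> \<psi>) auto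
  \<comment> \<open>The product of \<open>F\<close> with the cutoff vanishes on the frontier and has divergence \<open>\<eta> S - g\<close>.\<close>
  have int: "set_integrable lborel \<Omega> (\<lambda>x. \<eta> \<delta> x * S x)" (is ?i1)
      and eq: "(LINT x:\<Omega>|lborel. \<eta> \<delta> x * S x) = (LINT x:\<Omega>|lborel. g \<delta> x)" (is ?i2)
      and int_g: "set_integrable lborel \<Omega> (g \<delta>)" (is ?i3)
    if \<delta>: "\<delta> > 0" for \<delta>
  proof -
    have df: "div_field \<Omega> (K \<inter> UNIV) (\<lambda>x. \<eta> \<delta> x *\<^sub>R F x)
      (\<lambda>b x. \<eta> \<delta> x * Q b x + ((- (2 * m \<delta> x / \<delta>)) *\<^sub>R D x \<bullet> b) * (F x \<bullet> b))"
      by (rule div_field_mult[OF Q closed_UNIV \<eta>[OF \<delta>] c\<eta>'[OF \<delta>]]) auto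
    have sum: "(\<Sum>b\<in>Basis. \<eta> \<delta> x * Q b x + ((- (2 * m \<delta> x / \<delta>)) *\<^sub>R D x \<bullet> b) * (F x \<bullet> b)) = \<eta> \<delta> x * S x - g \<delta> x" for x
    proof -
      have "D x \<bullet> F x = (\<Sum>b\<in>Basis. (D x \<bullet> b) * (F x \<bullet> b))" by (rule euclidean_inner)
      then show ?thesis
        by (simp add: sum.distrib sum_subtractf S_def g_def sum_distrib_left mult.assoc)
    qed
    have "(LINT x:\<Omega>|lborel. \<Sum>b\<in>Basis. \<eta> \<delta> x * Q b x + ((- (2 * m \<delta> x / \<delta>)) *\<^sub>R D x \<bullet> b) * (F x \<bullet> b)) = 0"
    proof (rule integral_div_eq_0_if_0_on_frontier[OF df \<Omega>])
      fix x assume x: "x \<in> frontier \<Omega>"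
      show "\<eta> \<delta> x *\<^sub>R F x = 0"
      proof (cases "x \<in> K")
        case True then show ?thesis using \<psi>0[OF x] KB by (auto simp: \<eta>_def m_def)
      next
        case False then show ?thesis using F(2) x by (auto simp: frontier_def)
      qed
    qed
    then have 0: "(LINT x:\<Omega>|lborel. \<eta> \<delta> x * S x - g \<delta> x) = 0" unfolding sum .
    have i: "set_integrable lborel \<Omega> (\<lambda>x. \<eta> \<delta> x * S x - g \<delta> x)"
      using div_field_integrable_sum[OF df \<Omega>] unfolding sum .
    have "set_integrable lborel (\<Omega> \<inter> K) (g \<delta>)"
    proof (rule set_integrable_subset)
      have "continuous_on (closure \<Omega> \<inter> K) (g \<delta>)"
        unfolding g_def m_def using \<delta> by (intro continuous_intros c\<psi> continuous_on_subset[OF \<psi>(2)] continuous_on_subset[OF F(1)]) auto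
      moreover have "compact (closure \<Omega> \<inter> K)" using K by (simp add: closed_Int_compact)
      ultimately show "set_integrable lborel (closure \<Omega> \<inter> K) (g \<delta>)"
        by (intro continuous_bounded_set_integrable)
          (auto intro: compact_imp_bounded compact_continuous_image borel_compact)
    qed (use closure_subset[of \<Omega>] in auto)
    moreover have "(\<lambda>x. indicat_real (\<Omega> \<inter> K) x *\<^sub>R g \<delta> x) = (\<lambda>x. indicat_real \<Omega> x *\<^sub>R g \<delta> x)"
      using F(2) closure_subset[of \<Omega>] by (auto simp: indicator_def g_def fun_eq_iff)
    ultimately show ?i3 unfolding set_integrable_def by (simp only:)
    have "(\<lambda>x. (\<eta> \<delta> x * S x - g \<delta> x) + g \<delta> x) = (\<lambda>x. \<eta> \<delta> x * S x)" by auto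
    with set_integral_add(1)[OF i \<open>?i3\<close>] show ?i1 by simp
    with 0 \<open>?i3\<close> show ?i2 by simp
  qed
  obtain C where C: "C \<ge> 0" "\<And>\<delta>. \<delta> > 0 \<Longrightarrow> measure lborel (K \<inter> {x. -\<delta> < \<psi> x \<and> \<psi> x < 0}) \<le> C * \<delta>"
    using layer_measure[OF b c\<psi> K c shift] by blast
  have lim: "(\<lambda>n. LINT x:\<Omega>|lborel. \<eta> (inverse (real (Suc n))) x * S x) \<longlonglongrightarrow> (LINT x:\<Omega>|lborel. S x)"
    unfolding set_lebesgue_integral_def
  proof (rule integral_dominated_convergence)
    show "(\<lambda>x. indicat_real \<Omega> x *\<^sub>R S x) \<in> borel_measurable lborel"
      using S_int unfolding set_integrable_def by (rule borel_measurable_integrable)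
    show "(\<lambda>x. indicat_real \<Omega> x *\<^sub>R (\<eta> (inverse (real (Suc n))) x * S x)) \<in> borel_measurable lborel" for n
      using int[of "inverse (real (Suc n))"] unfolding set_integrable_def by (intro borel_measurable_integrable) auto
    show "integrable lborel (\<lambda>x. norm (indicat_real \<Omega> x *\<^sub>R S x))"
      using S_int unfolding set_integrable_def by (rule integrable_norm)
    show "AE x in lborel. norm (indicat_real \<Omega> x *\<^sub>R (\<eta> (inverse (real (Suc n))) x * S x)) \<le> norm (indicat_real \<Omega> x *\<^sub>R S x)" for n
    proof (rule AE_I2)
      fix x
      have "\<bar>\<eta> (inverse (real (Suc n))) x\<bar> \<le> 1" if "x \<in> \<Omega> \<inter> K"
        using m_bound(1)[of "inverse (real (Suc n))" x] m_bound(2)[of x "inverse (real (Suc n))"] that by (auto simp: \<eta>_def power_le_one abs_le_iff)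
      then show "norm (indicat_real \<Omega> x *\<^sub>R (\<eta> (inverse (real (Suc n))) x * S x)) \<le> norm (indicat_real \<Omega> x *\<^sub>R S x)"
        using S_0[of x] by (cases "x \<in> K") (auto simp: indicator_def abs_mult intro: mult_left_le_one_le)
    qed
    show "AE x in lborel. (\<lambda>n. indicat_real \<Omega> x *\<^sub>R (\<eta> (inverse (real (Suc n))) x * S x)) \<longlonglongrightarrow> indicat_real \<Omega> x *\<^sub>R S x"
    proof (rule AE_I2)
      fix x
      show "(\<lambda>n. indicat_real \<Omega> x *\<^sub>R (\<eta> (inverse (real (Suc n))) x * S x)) \<longlonglongrightarrow> indicat_real \<Omega> x *\<^sub>R S x"
      proof (cases "x \<in> \<Omega> \<inter> K")
        case True
        then have neg: "\<psi> x < 0" using graph[of x] KB by auto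
        have "\<forall>\<^sub>F n in sequentially. inverse (real (Suc n)) < - \<psi> x"
          using LIMSEQ_inverse_real_of_nat neg by (intro order_tendstoD(2)) auto
        then have "\<forall>\<^sub>F n in sequentially. \<eta> (inverse (real (Suc n))) x = 1"
        proof eventually_elim
          case (elim n)
          then have "1 + \<psi> x / inverse (real (Suc n)) \<le> 0"
            by (simp add: field_simps)
          then show ?case by (simp add: \<eta>_def m_def)
        qed
        then have "(\<lambda>n. \<eta> (inverse (real (Suc n))) x) \<longlonglongrightarrow> 1" by (rule tendsto_eventually)
        then show ?thesis by (auto intro!: tendsto_eq_intros)
      next
        case False
        then show ?thesis using S_0[of x] by (auto simp: indicator_def)
      qed
    qed
  qed
  have small: "\<bar>LINT x:\<Omega>|lborel. S x\<bar> \<le> 2 * C * e" if e: "e > 0" for e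
  proof -
    \<comment> \<open>Where the flux density is at least \<open>e\<close>, the compact set \<open>B\<close> keeps a distance from the boundary, measured by \<open>\<psi> \<le> - d\<close>.\<close>
    define B where "B = {y \<in> closure \<Omega> \<inter> K. \<bar>D y \<bullet> F y\<bar> \<ge> e}"
    have "compact B"
    proof -
      have c: "continuous_on (closure \<Omega> \<inter> K) (\<lambda>y. \<bar>D y \<bullet> F y\<bar>)"
        by (intro continuous_intros continuous_on_subset[OF \<psi>(2)] continuous_on_subset[OF F(1)]) auto
      have "closedin (top_of_set (closure \<Omega> \<inter> K)) ((closure \<Omega> \<inter> K) \<inter> (\<lambda>y. \<bar>D y \<bullet> F y\<bar>) -` {e..})"
        by (rule continuous_closedin_preimage[OF c closed_atLeast])
      moreover have "(closure \<Omega> \<inter> K) \<inter> (\<lambda>y. \<bar>D y \<bullet> F y\<bar>) -` {e..} = B" by (auto simp: B_def)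
      moreover have "compact (closure \<Omega> \<inter> K)" using K by (simp add: closed_Int_compact)
      ultimately show ?thesis using closedin_compact by metis
    qed
    moreover have Bneg: "\<psi> y < 0" if "y \<in> B" for y
    proof -
      have "y \<notin> frontier \<Omega>" using flux[of y] KB that e by (auto simp: B_def inner_commute)
      then have "y \<in> \<Omega>" using that interior_open[OF \<Omega>] by (auto simp: B_def frontier_def)
      then show ?thesis using graph[of y] KB that by (auto simp: B_def)
    qed
    ultimately obtain d where d: "d > 0" "\<And>y. y \<in> B \<Longrightarrow> \<psi> y \<le> - d"
    proof (cases "B = {}")
      case False
      then obtain z where "z \<in> B" "\<And>y. y \<in> B \<Longrightarrow> \<psi> y \<le> \<psi> z"
        using continuous_attains_sup[OF \<open>compact B\<close> False c\<psi>] by blast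
      then show ?thesis using that[of "- \<psi> z"] Bneg by auto
    qed (use that[of 1] in auto)
    have bound: "\<bar>LINT x:\<Omega>|lborel. g \<delta> x\<bar> \<le> 2 * C * e" if \<delta>: "\<delta> > 0" "\<delta> \<le> d" for \<delta>
    proof -
      define A where "A = K \<inter> {x. -\<delta> < \<psi> x \<and> \<psi> x < 0}"
      have A: "A \<in> sets lborel" "emeasure lborel A < \<infinity>"
        using emeasure_bounded_finite[of A] compact_imp_bounded[OF K] by (auto simp: A_def intro: bounded_subset)
      have "\<bar>LINT x:\<Omega>|lborel. g \<delta> x\<bar> \<le> (LINT x|lborel. \<bar>indicat_real \<Omega> x *\<^sub>R g \<delta> x\<bar>)"
        unfolding set_lebesgue_integral_def by (rule integral_abs_bound)
      also have "\<dots> \<le> (LINT x|lborel. 2 / \<delta> * e * indicat_real A x)"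
      proof (rule integral_mono)
        show "integrable lborel (\<lambda>x. \<bar>indicat_real \<Omega> x *\<^sub>R g \<delta> x\<bar>)"
          using int_g[OF \<delta>(1)] unfolding set_integrable_def by (rule integrable_abs)
        show "integrable lborel (\<lambda>x. 2 / \<delta> * e * indicat_real A x)"
          using A by (intro integrable_mult_right integrable_real_indicator)
        fix x
        show "\<bar>indicat_real \<Omega> x *\<^sub>R g \<delta> x\<bar> \<le> 2 / \<delta> * e * indicat_real A x"
        proof (cases "x \<in> \<Omega> \<and> g \<delta> x \<noteq> 0")
          case True
          then have "x \<in> closure \<Omega>" using closure_subset[of \<Omega>] by auto
          moreover have "F x \<noteq> 0" using True by (auto simp: g_def)
          ultimately have "x \<in> K" using F(2)[of x] by blast
          with True have x: "x \<in> \<Omega>" "x \<in> K" "m \<delta> x \<noteq> 0"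
            by (auto simp: g_def)
          then have "-\<delta> < \<psi> x" using \<delta> by (auto simp: m_def max_def field_simps split: if_splits)
          moreover have "\<psi> x < 0" using graph[of x] x KB by auto
          ultimately have "x \<in> A" "x \<notin> B" using x d \<delta> by (fastforce simp: A_def)+
          then have "\<bar>D x \<bullet> F x\<bar> \<le> e" using x \<open>x \<in> closure \<Omega>\<close> by (auto simp: B_def)
          moreover have "\<bar>2 * m \<delta> x / \<delta>\<bar> \<le> 2 / \<delta>"
            using m_bound(1)[of \<delta> x] m_bound(2)[of x \<delta>] x \<delta> by (auto simp: abs_mult divide_right_mono)
          ultimately have "\<bar>g \<delta> x\<bar> \<le> 2 / \<delta> * e"
            unfolding g_def abs_mult[of "2 * m \<delta> x / \<delta>"] using \<delta> by (intro mult_mono) auto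
          then show ?thesis using \<open>x \<in> A\<close> x by simp
        qed (use e \<delta> in \<open>auto simp: indicator_def\<close>)
      qed
      also have "\<dots> = 2 / \<delta> * e * measure lborel A" using A by simp
      also have "\<dots> \<le> 2 / \<delta> * e * (C * \<delta>)"
        using C(2)[OF \<delta>(1)] e \<delta> by (intro mult_left_mono) (auto simp: A_def)
      also have "\<dots> = 2 * C * e" using \<delta> by simp
      finally show ?thesis .
    qed
    have "\<forall>\<^sub>F n in sequentially. inverse (real (Suc n)) < d"
      using LIMSEQ_inverse_real_of_nat d by (intro order_tendstoD(2)) auto
    then have "\<forall>\<^sub>F n in sequentially. \<bar>LINT x:\<Omega>|lborel. \<eta> (inverse (real (Suc n))) x * S x\<bar> \<le> 2 * C * e"
    proof eventually_elim
      case (elim n)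
      then show ?case using bound[of "inverse (real (Suc n))"] eq[of "inverse (real (Suc n))"] by simp
    qed
    then show ?thesis
      using tendsto_rabs[OF lim] by (intro tendsto_upperbound[OF tendsto_rabs[OF lim]]) auto
  qed
  have "\<bar>LINT x:\<Omega>|lborel. S x\<bar> \<le> 0 + e" if "e > 0" for e
  proof -
    have "2 * C * (e / (2 * C + 1)) \<le> e" using C that by (simp add: field_simps)
    then show ?thesis using small[of "e / (2 * C + 1)"] C that by simp
  qed
  then have "\<bar>LINT x:\<Omega>|lborel. S x\<bar> \<le> 0" by (rule field_le_epsilon)
  then show ?thesis by (simp add: S_def)
qed

text \<open>
  Every point of \<open>closure \<Omega>\<close> has a neighbourhood such that the claim holds for fields supported
  there: interior points by the case of fields vanishing on the frontier, boundary points by the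
  graph lemma. Finitely many such neighbourhoods cover the support, and splitting off one bump
  function at a time reduces a general field to these.
\<close>

theorem divergence_theorem_no_flux:
  fixes \<Omega> :: "'a::euclidean_space set"
  assumes \<Omega>: "open \<Omega>" and bd: "C1_boundary \<Omega>" and Q: "div_field \<Omega> K F Q"
    and flux: "\<And>x \<nu>. x \<in> frontier \<Omega> \<Longrightarrow> outer_unit_normal \<Omega> x \<nu> \<Longrightarrow> F x \<bullet> \<nu> = 0"
  shows "(LINT x:\<Omega>|lborel. \<Sum>b\<in>Basis. Q b x) = 0"
proof -
  define P where "P K F Q \<longleftrightarrow> div_field \<Omega> K F Q \<and>
     (\<forall>x\<in>frontier \<Omega>. \<forall>\<nu>. outer_unit_normal \<Omega> x \<nu> \<longrightarrow> F x \<bullet> \<nu> = 0)" for K F Q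
  have near_point: "\<exists>r>0. \<forall>K F Q. P K F Q \<longrightarrow> K \<subseteq> ball x r \<longrightarrow> (LINT x:\<Omega>|lborel. \<Sum>b\<in>Basis. Q b x) = 0"
    if x: "x \<in> closure \<Omega>" for x
  proof (cases "x \<in> \<Omega>")
    case True
    then obtain r where r: "r > 0" "ball x r \<subseteq> \<Omega>" using openE[OF \<Omega>] by blast
    have "(LINT x:\<Omega>|lborel. \<Sum>b\<in>Basis. Q b x) = 0" if "P K F Q" "K \<subseteq> ball x r" for K F Q
    proof (rule integral_div_eq_0_if_0_on_frontier[OF _ \<Omega>])
      show "div_field \<Omega> K F Q" using that by (simp add: P_def)
      show "F y = 0" if "y \<in> frontier \<Omega>" for y
        using that \<open>div_field \<Omega> K F Q\<close> \<open>K \<subseteq> ball x r\<close> r interior_open[OF \<Omega>]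
        by (auto simp: div_field_def frontier_def)
    qed
    then show ?thesis using r by blast
  next
    case False
    then have "x \<in> frontier \<Omega>" using x interior_open[OF \<Omega>] by (auto simp: frontier_def)
    then obtain \<nu> where "outer_unit_normal \<Omega> x \<nu>" using bd by (auto simp: C1_boundary_def)
    then obtain e \<gamma> r where e: "e \<in> Basis \<or> - e \<in> Basis" "C1 \<gamma>" "r > 0"
       and y: "\<And>y. y\<in>ball x r \<Longrightarrow> y \<in> \<Omega> \<longleftrightarrow> y \<bullet> e < \<gamma> (y - (y \<bullet> e) *\<^sub>R e)"
      unfolding outer_unit_normal_def by blast
    define \<psi> where "\<psi> y = y \<bullet> e - \<gamma> (y - (y \<bullet> e) *\<^sub>R e)" for y
    obtain D where D: "\<And>y. GDERIV \<psi> y :> D y" "continuous_on UNIV D" "\<And>y. D y \<bullet> e = 1"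
      using graph_function_GDERIV[OF e(1,2)] unfolding \<psi>_def by metis
    define b c where "b = (if e \<in> Basis then e else - e)" and "c = (if e \<in> Basis then 1 else -1::real)"
    have b: "b \<in> Basis" "\<bar>c\<bar> = 1" "e = c *\<^sub>R b" "c * c = 1" using e by (auto simp: b_def c_def)
    have shift: "\<psi> (z + s *\<^sub>R b) = \<psi> z + c * s" for z s
    proof -
      have be: "b \<bullet> e = c" using b by simp
      have "(z + s *\<^sub>R b) - ((z + s *\<^sub>R b) \<bullet> e) *\<^sub>R e = z - (z \<bullet> e) *\<^sub>R e + (s *\<^sub>R b - (s * c) *\<^sub>R e)"
        by (simp add: inner_add_left be algebra_simps)
      also have "(s * c) *\<^sub>R e = s *\<^sub>R b" using b(4) by (simp add: b(3) mult.assoc)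
      finally have proj: "(z + s *\<^sub>R b) - ((z + s *\<^sub>R b) \<bullet> e) *\<^sub>R e = z - (z \<bullet> e) *\<^sub>R e" by simp
      show ?thesis unfolding \<psi>_def proj by (simp add: inner_add_left be mult.commute)
    qed
    have "(LINT x:\<Omega>|lborel. \<Sum>b\<in>Basis. Q b x) = 0" if PK: "P K F Q" "K \<subseteq> ball x r" for K F Q
    proof (rule integral_div_eq_0_graph[OF _ \<Omega> PK(2) D(1,2) _ b(1,2) shift])
      show "div_field \<Omega> K F Q" using PK by (simp add: P_def)
      show "y \<in> \<Omega> \<longleftrightarrow> \<psi> y < 0" if "y \<in> ball x r" for y using y[OF that] by (simp add: \<psi>_def)
      fix z assume z: "z \<in> frontier \<Omega>" "z \<in> ball x r"
      obtain q where q: "q > 0" "ball z q \<subseteq> ball x r" using z(2) openE[OF open_ball] by blast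
      have "outer_unit_normal \<Omega> z (sgn (D z))"
        unfolding outer_unit_normal_def
        using e q y grad_eqI[OF D(1)[of z]] 
        by (intro exI[of _ e] exI[of _ \<gamma>] exI[of _ q]) (auto simp: \<psi>_def[abs_def])
      then have "F z \<bullet> sgn (D z) = 0" using PK z by (auto simp: P_def)
      moreover have "D z \<noteq> 0" using D(3)[of z] by auto
      ultimately show "F z \<bullet> D z = 0" by (simp add: sgn_div_norm)
    qed
    then show ?thesis using e(3) by blast
  qed
  then obtain \<rho> where \<rho>: "\<And>x. x \<in> closure \<Omega> \<Longrightarrow> \<rho> x > 0"
    "\<And>x K F Q. x \<in> closure \<Omega> \<Longrightarrow> P K F Q \<Longrightarrow> K \<subseteq> ball x (\<rho> x) \<Longrightarrow> (LINT x:\<Omega>|lborel. \<Sum>b\<in>Basis. Q b x) = 0"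
    by metis
  have cover: "(LINT x:\<Omega>|lborel. \<Sum>b\<in>Basis. Q b x) = 0"
    if "finite C" "C \<subseteq> closure \<Omega>" "P K F Q" "closure \<Omega> \<inter> K \<subseteq> (\<Union>x\<in>C. ball x (\<rho> x / 4))" for C K F Q
    using that
  proof (induction C arbitrary: K F Q)
    case empty
    then have "\<Omega> - K = \<Omega>" using closure_subset[of \<Omega>] by auto
    then have "Q b x = 0" if "b \<in> Basis" "x \<in> \<Omega>" for b x
      using empty that div_field_eq_0[of \<Omega> K F Q b x] \<Omega> by (auto simp: P_def)
    then show ?case unfolding set_lebesgue_integral_def
      by (intro integral_eq_zero_AE AE_I2) (auto simp: indicator_def)
  next
    case (insert c C)
    then have c: "c \<in> closure \<Omega>" "\<rho> c / 2 > 0" using \<rho>(1)[of c] by auto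
    have Q: "div_field \<Omega> K F Q" using insert.prems by (simp add: P_def)
    \<comment> \<open>\<open>\<theta> F\<close> is supported near \<open>c\<close>; \<open>(1 - \<theta>) F\<close> vanishes on the quarter ball around \<open>c\<close>, so the remaining balls cover its support.\<close>
    obtain \<theta> D where \<theta>: "\<And>x. GDERIV \<theta> x :> D x" "continuous_on UNIV D"
      "\<And>x. dist c x \<le> \<rho> c / 2 / 2 \<Longrightarrow> \<theta> x = 1" "\<And>x. dist c x \<ge> \<rho> c / 2 \<Longrightarrow> \<theta> x = (0::real)"
      using C1_bump[OF c(2), of c] by blast
    define Q1 where "Q1 b x = \<theta> x * Q b x + (D x \<bullet> b) * (F x \<bullet> b)" for b x
    define Q2 where "Q2 b x = (1 - \<theta> x) * Q b x + (- D x \<bullet> b) * (F x \<bullet> b)" for b x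
    have d1: "div_field \<Omega> (K \<inter> cball c (\<rho> c / 2)) (\<lambda>x. \<theta> x *\<^sub>R F x) Q1"
      unfolding Q1_def[abs_def] using \<theta> by (intro div_field_mult[OF Q]) auto
    have "GDERIV (\<lambda>x. 1 - \<theta> x) x :> - D x" for x
      using GDERIV_diff[OF GDERIV_const \<theta>(1)] by simp
    then have d2: "div_field \<Omega> (K \<inter> - ball c (\<rho> c / 4)) (\<lambda>x. (1 - \<theta> x) *\<^sub>R F x) Q2"
      unfolding Q2_def[abs_def] using \<theta> by (intro div_field_mult[OF Q]) (auto intro!: continuous_intros)
    have "P (K \<inter> cball c (\<rho> c / 2)) (\<lambda>x. \<theta> x *\<^sub>R F x) Q1" using d1 insert.prems(2) by (auto simp: P_def)
    then have i1: "(LINT x:\<Omega>|lborel. \<Sum>b\<in>Basis. Q1 b x) = 0" using c by (intro \<rho>(2)[OF c(1)]) auto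
    have i2: "(LINT x:\<Omega>|lborel. \<Sum>b\<in>Basis. Q2 b x) = 0"
    proof (rule insert.IH)
      show "P (K \<inter> - ball c (\<rho> c / 4)) (\<lambda>x. (1 - \<theta> x) *\<^sub>R F x) Q2" using d2 insert.prems(2) by (auto simp: P_def)
    qed (use insert.prems in auto)
    have "(\<Sum>b\<in>Basis. Q b x) = (\<Sum>b\<in>Basis. Q1 b x) + (\<Sum>b\<in>Basis. Q2 b x)" for x
      by (simp add: Q1_def Q2_def sum.distrib[symmetric] algebra_simps)
    then show ?case
      using i1 i2 set_integral_add(2)[OF div_field_integrable_sum[OF d1 \<Omega>] div_field_integrable_sum[OF d2 \<Omega>]]
      by simp
  qed
  have k1: "compact (closure \<Omega> \<inter> K)" using Q by (auto simp: div_field_def closed_Int_compact)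
  have k2: "closure \<Omega> \<inter> K \<subseteq> (\<Union>x\<in>closure \<Omega>. ball x (\<rho> x / 4))" using \<rho>(1) by auto
  obtain C where C: "C \<subseteq> closure \<Omega>" "finite C" "closure \<Omega> \<inter> K \<subseteq> (\<Union>x\<in>C. ball x (\<rho> x / 4))"
    by (rule compactE_image[OF k1 open_ball k2])
  show ?thesis by (rule cover[OF C(2,1) _ C(3)]) (use Q flux in \<open>auto simp: P_def\<close>)
qed

section \<open>Derivatives up to the boundary\<close>

lemma GDERIV_along_line:
  assumes "GDERIV U (y + s *\<^sub>R w) :> D"
  shows "((\<lambda>s. U (y + s *\<^sub>R w)) has_real_derivative D \<bullet> w) (at s within T)"
  using has_real_derivative_along_line[where F = U, OF GDERIV_directional[OF assms, of w]]
  by (rule has_field_derivative_at_within)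

text \<open>
  The mean value theorem on the segments \<open>[y n, y n + h w]\<close> inside \<open>G\<close> bounds the error of the
  difference quotient by the oscillation of \<open>D\<close> near \<open>z\<close>, uniformly in \<open>n\<close>; the bound passes to
  the limit. It is used for the one-sided time derivative at \<open>t = 0\<close>, for time derivatives at points
  of \<open>frontier \<Omega>\<close>, and for space derivatives at \<open>t = 0\<close>.
\<close>

lemma directional_deriv_extends_to_closure:
  fixes U :: "'b::euclidean_space \<Rightarrow> real"
  assumes U: "continuous_on (closure G) U" and D: "continuous_on (closure G) D"
    and der: "\<And>z. z \<in> G \<Longrightarrow> GDERIV U z :> D z"
    and z: "z \<in> closure G"
    and y: "y \<longlonglongrightarrow> z"
    and seg: "\<And>n h s. h \<in> T \<Longrightarrow> s \<in> closed_segment 0 h \<Longrightarrow> y n + s *\<^sub>R w \<in> G"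
  shows "((\<lambda>h. U (z + h *\<^sub>R w)) has_real_derivative D z \<bullet> w) (at 0 within T)"
  unfolding has_field_derivative_def has_derivative_within_alt
proof (intro conjI allI impI)
  show "bounded_linear ((*) (D z \<bullet> w))" by (rule bounded_linear_mult_right)
  fix e :: real assume e: "e > 0"
  have w1: "norm w + 1 > 0" by (simp add: add_nonneg_pos)
  define e' where "e' = e / (norm w + 1)"
  have "e' > 0" using e by (simp add: e'_def add_nonneg_pos)
  then obtain \<delta> where \<delta>: "\<delta> > 0" "\<And>x. x \<in> closure G \<Longrightarrow> dist x z < \<delta> \<Longrightarrow> dist (D x) (D z) < e'"
    using D z unfolding continuous_on_iff by metis
  define d where "d = (\<delta> / 2) / (norm w + 1)"
  have "d > 0" using \<delta> by (simp add: d_def add_nonneg_pos)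
  moreover have "norm (U (z + h *\<^sub>R w) - U (z + 0 *\<^sub>R w) - D z \<bullet> w * (h - 0)) \<le> e * norm (h - 0)"
    if h: "h \<in> T" "norm (h - 0) < d" for h
  proof -
    have hw: "\<bar>s\<bar> * norm w < \<delta> / 2" if "s \<in> closed_segment 0 h" for s
    proof -
      have "\<bar>s\<bar> \<le> \<bar>h\<bar>" using that by (auto simp: closed_segment_eq_real_ivl split: if_splits)
      then have "\<bar>s\<bar> * norm w \<le> \<bar>h\<bar> * (norm w + 1)" by (intro mult_mono) auto
      also have "\<dots> < d * (norm w + 1)" using h by (intro mult_strict_right_mono) (auto simp: add_nonneg_pos)
      also have "\<dots> = \<delta> / 2"
        using w1 by (metis d_def less_irrefl nonzero_divide_eq_eq)
      finally show ?thesis .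
    qed
    have "\<forall>\<^sub>F n in sequentially. dist (y n) z < \<delta> / 2"
      using y \<delta> by (intro tendstoD) auto
    then have ev: "\<forall>\<^sub>F n in sequentially. \<bar>(U (y n + h *\<^sub>R w) - h * (D z \<bullet> w)) - U (y n)\<bar> \<le> e * \<bar>h\<bar>"
    proof eventually_elim
      case (elim n)
      define \<phi> where "\<phi> s = U (y n + s *\<^sub>R w) - s * (D z \<bullet> w)" for s
      have "norm (\<phi> h - \<phi> 0) \<le> e * norm (h - 0)"
      proof (rule field_differentiable_bound[where S = "closed_segment 0 h" and f' = "\<lambda>s. D (y n + s *\<^sub>R w) \<bullet> w - D z \<bullet> w"])
        fix s assume s: "s \<in> closed_segment 0 h"
        have G: "y n + s *\<^sub>R w \<in> G" using seg[OF h(1) s] .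
        have "((\<lambda>s. U (y n + s *\<^sub>R w)) has_real_derivative D (y n + s *\<^sub>R w) \<bullet> w) (at s within closed_segment 0 h)"
          by (rule GDERIV_along_line[OF der[OF G]])
        moreover have "((\<lambda>s. s * (D z \<bullet> w)) has_real_derivative D z \<bullet> w) (at s within closed_segment 0 h)"
          by (auto intro!: derivative_eq_intros)
        ultimately show "(\<phi> has_real_derivative D (y n + s *\<^sub>R w) \<bullet> w - D z \<bullet> w) (at s within closed_segment 0 h)"
          unfolding \<phi>_def by (rule DERIV_diff)
        have "dist (y n + s *\<^sub>R w) z \<le> dist (y n) z + \<bar>s\<bar> * norm w"
          by (metis dist_add_cancel2 dist_commute dist_norm dist_triangle add_diff_cancel_left' norm_scaleR real_norm_def add.commute)
        then have "dist (y n + s *\<^sub>R w) z < \<delta>" using hw[OF s] elim by simp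
        then have "norm (D (y n + s *\<^sub>R w) - D z) \<le> e'"
          using \<delta>(2) G closure_subset[of G] by (fastforce simp: dist_norm)
        moreover have "norm ((D (y n + s *\<^sub>R w) - D z) \<bullet> w) \<le> norm (D (y n + s *\<^sub>R w) - D z) * norm w"
          using Cauchy_Schwarz_ineq2 by simp
        ultimately have "norm ((D (y n + s *\<^sub>R w) - D z) \<bullet> w) \<le> e' * (norm w + 1)"
          using \<open>e' > 0\<close> by (smt (verit) mult_mono norm_ge_zero)
        also have "\<dots> = e" using w1 by (metis e'_def less_irrefl nonzero_divide_eq_eq)
        finally show "norm (D (y n + s *\<^sub>R w) \<bullet> w - D z \<bullet> w) \<le> e" by (simp add: inner_diff_left)
      qed auto
      then show ?case by (simp add: \<phi>_def)
    qed
    have yG: "y n \<in> closure G" "y n + h *\<^sub>R w \<in> closure G" for n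
      using seg[OF h(1), of 0 n] seg[OF h(1), of h n] closure_subset[of G] by auto
    have yh: "(\<lambda>n. y n + h *\<^sub>R w) \<longlonglongrightarrow> z + h *\<^sub>R w" by (intro tendsto_intros y)
    have zh: "z + h *\<^sub>R w \<in> closure G"
      using closed_sequentially[OF closed_closure _ yh] yG by blast
    have "(\<lambda>n. U (y n)) \<longlonglongrightarrow> U z" "(\<lambda>n. U (y n + h *\<^sub>R w)) \<longlonglongrightarrow> U (z + h *\<^sub>R w)"
      using continuous_on_tendsto_compose[OF U y z] continuous_on_tendsto_compose[OF U yh zh] yG by auto
    then have "(\<lambda>n. \<bar>(U (y n + h *\<^sub>R w) - h * (D z \<bullet> w)) - U (y n)\<bar>) \<longlonglongrightarrow> \<bar>(U (z + h *\<^sub>R w) - h * (D z \<bullet> w)) - U z\<bar>"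
      by (intro tendsto_intros)
    then have "\<bar>(U (z + h *\<^sub>R w) - h * (D z \<bullet> w)) - U z\<bar> \<le> e * \<bar>h\<bar>"
      by (rule tendsto_upperbound[OF _ ev]) simp
    then show ?thesis by (simp add: algebra_simps)
  qed
  ultimately show "\<exists>d>0. \<forall>h\<in>T. norm (h - 0) < d \<longrightarrow>
      norm (U (z + h *\<^sub>R w) - U (z + 0 *\<^sub>R w) - D z \<bullet> w * (h - 0)) \<le> e * norm (h - 0)" by blast
qed

text \<open>
  Two applications of the mean value inequality: first in direction \<open>b\<close> to \<open>D \<bullet> a\<close>, then in
  direction \<open>a\<close> to the difference of \<open>U\<close>.
\<close>

lemma second_difference_bound:
  fixes U :: "'b::euclidean_space \<Rightarrow> real" and D :: "'b \<Rightarrow> 'b" and H :: "'b \<Rightarrow> 'b \<Rightarrow>\<^sub>L 'b"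
  assumes U: "\<And>y. y \<in> ball z r \<Longrightarrow> GDERIV U y :> D y"
    and D: "\<And>y. y \<in> ball z r \<Longrightarrow> (D has_derivative blinfun_apply (H y)) (at y)"
    and H: "\<And>y. y \<in> ball z r \<Longrightarrow> norm (H y - H z) * norm b * norm a \<le> e"
    and h: "h \<ge> 0" "h * (norm a + norm b) < r" 
  shows "\<bar>(U (z + h *\<^sub>R a + h *\<^sub>R b) - U (z + h *\<^sub>R a)) - (U (z + h *\<^sub>R b) - U z) - h * h * (H z b \<bullet> a)\<bar> \<le> e * h * h"
proof -
  have in_ball: "z + s *\<^sub>R a + t *\<^sub>R b \<in> ball z r" if "s \<in> {0..h}" "t \<in> {0..h}" for s t
  proof -
    have "dist z (z + s *\<^sub>R a + t *\<^sub>R b) = norm (s *\<^sub>R a + t *\<^sub>R b)"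
    proof -
      have eq: "z - (z + s *\<^sub>R a + t *\<^sub>R b) = - (s *\<^sub>R a + t *\<^sub>R b)" by simp
      show ?thesis unfolding dist_norm eq norm_minus_cancel ..
    qed
    then have "dist z (z + s *\<^sub>R a + t *\<^sub>R b) \<le> s * norm a + t * norm b"
      using norm_triangle_ineq[of "s *\<^sub>R a" "t *\<^sub>R b"] that by simp
    also have "\<dots> \<le> h * norm a + h * norm b" using that by (intro add_mono mult_right_mono) auto
    finally show ?thesis using h by (simp add: algebra_simps)
  qed
  have inner_bound: "\<bar>(D (z + s *\<^sub>R a + h *\<^sub>R b) \<bullet> a - h * (H z b \<bullet> a)) - D (z + s *\<^sub>R a) \<bullet> a\<bar> \<le> e * h"
    if s: "s \<in> {0..h}" for s
  proof -
    define k where "k t = D (z + s *\<^sub>R a + t *\<^sub>R b) \<bullet> a - t * (H z b \<bullet> a)" for t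
    have "norm (k h - k 0) \<le> e * norm (h - 0)"
    proof (rule field_differentiable_bound[where S = "{0..h}" and f' = "\<lambda>t. H (z + s *\<^sub>R a + t *\<^sub>R b) b \<bullet> a - H z b \<bullet> a"])
      fix t assume t: "t \<in> {0..h}"
      let ?y = "z + s *\<^sub>R a + t *\<^sub>R b"
      have "((\<lambda>t. z + s *\<^sub>R a + t *\<^sub>R b) has_derivative (\<lambda>t. t *\<^sub>R b)) (at t within {0..h})"
        by (auto intro!: derivative_eq_intros)
      from has_derivative_compose[OF this D[OF in_ball[OF s t]]]
      have "((\<lambda>t. D (z + s *\<^sub>R a + t *\<^sub>R b) \<bullet> a) has_derivative (\<lambda>t. H ?y (t *\<^sub>R b) \<bullet> a)) (at t within {0..h})"
        by (rule has_derivative_inner_left)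
      then have "((\<lambda>t. D (z + s *\<^sub>R a + t *\<^sub>R b) \<bullet> a) has_real_derivative H ?y b \<bullet> a) (at t within {0..h})"
        by (simp add: has_field_derivative_def blinfun.scaleR_right mult_commute_abs)
      moreover have "((\<lambda>t. t * (H z b \<bullet> a)) has_real_derivative H z b \<bullet> a) (at t within {0..h})"
        by (auto intro!: derivative_eq_intros)
      ultimately show "(k has_real_derivative H ?y b \<bullet> a - H z b \<bullet> a) (at t within {0..h})"
        unfolding k_def by (rule DERIV_diff)
      have "\<bar>(H ?y - H z) b \<bullet> a\<bar> \<le> norm ((H ?y - H z) b) * norm a" by (rule Cauchy_Schwarz_ineq2)
      also have "\<dots> \<le> norm (H ?y - H z) * norm b * norm a" by (intro mult_right_mono norm_blinfun) auto
      also have "\<dots> \<le> e" using H[OF in_ball[OF s t]] .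
      finally show "norm (H ?y b \<bullet> a - H z b \<bullet> a) \<le> e" by (simp add: blinfun.diff_left inner_diff_left)
    qed (use h in auto)
    then show ?thesis using h by (simp add: k_def)
  qed
  define f where "f s = U (z + h *\<^sub>R b + s *\<^sub>R a) - U (z + s *\<^sub>R a) - s * (h * (H z b \<bullet> a))" for s
  have "norm (f h - f 0) \<le> (e * h) * norm (h - 0)"
  proof (rule field_differentiable_bound[where S = "{0..h}" and
        f' = "\<lambda>s. D (z + h *\<^sub>R b + s *\<^sub>R a) \<bullet> a - D (z + s *\<^sub>R a) \<bullet> a - h * (H z b \<bullet> a)"])
    fix s assume s: "s \<in> {0..h}"
    have i: "z + h *\<^sub>R b + s *\<^sub>R a \<in> ball z r" "z + s *\<^sub>R a \<in> ball z r"
      using in_ball[OF s, of h] in_ball[OF s, of 0] h by (simp_all add: add_ac)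
    show "(f has_real_derivative D (z + h *\<^sub>R b + s *\<^sub>R a) \<bullet> a - D (z + s *\<^sub>R a) \<bullet> a - h * (H z b \<bullet> a)) (at s within {0..h})"
      unfolding f_def
      by (intro DERIV_diff GDERIV_along_line U i) (auto intro!: derivative_eq_intros)
    show "norm (D (z + h *\<^sub>R b + s *\<^sub>R a) \<bullet> a - D (z + s *\<^sub>R a) \<bullet> a - h * (H z b \<bullet> a)) \<le> e * h"
      using inner_bound[OF s] by (simp add: algebra_simps)
  qed (use h in auto)
  then show ?thesis using h by (simp add: f_def algebra_simps)
qed

text \<open>
  Schwarz's theorem: the second difference of \<open>U\<close> is symmetric in \<open>a\<close> and \<open>b\<close>, and after
  division by \<open>h\<^sup>2\<close> it is close to either of the two values.
\<close>

lemma second_deriv_symmetric: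
  fixes U :: "'b::euclidean_space \<Rightarrow> real" and D :: "'b \<Rightarrow> 'b" and H :: "'b \<Rightarrow> 'b \<Rightarrow>\<^sub>L 'b"
  assumes G: "open G" "z \<in> G"
    and U: "\<And>y. y \<in> G \<Longrightarrow> GDERIV U y :> D y"
    and D: "\<And>y. y \<in> G \<Longrightarrow> (D has_derivative blinfun_apply (H y)) (at y)"
    and H: "continuous_on G H"
  shows "H z a \<bullet> b = H z b \<bullet> a"
proof -
  have "\<bar>H z a \<bullet> b - H z b \<bullet> a\<bar> \<le> 0 + e" if e: "e > 0" for e
  proof -
    define M where "M = norm b * norm a + 1"
    have M: "M > 0" by (simp add: M_def add_nonneg_pos)
    have "continuous (at z) H" using H G by (simp add: continuous_on_eq_continuous_at)
    then obtain d where d: "d > 0" "\<And>y. dist y z < d \<Longrightarrow> dist (H y) (H z) < e / 2 / M"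
      using e M unfolding continuous_at_eps_delta by (metis divide_pos_pos zero_less_numeral)
    obtain d' where d': "d' > 0" "ball z d' \<subseteq> G" using openE[OF G] by blast
    define r where "r = min d d'"
    have r: "r > 0" "ball z r \<subseteq> G" using d d' by (auto simp: r_def)
    have HB: "norm (H y - H z) * norm b * norm a \<le> e / 2" if "y \<in> ball z r" for y
    proof -
      have "norm (H y - H z) \<le> e / 2 / M" using d(2)[of y] that by (simp add: r_def dist_norm dist_commute[of z] norm_minus_commute)
      then have "norm (H y - H z) * (norm b * norm a) \<le> e / 2 / M * M" using M e by (intro mult_mono) (auto simp: M_def)
      then show ?thesis using M by (simp add: mult.assoc)
    qed
    have ab: "norm a + norm b + 1 \<noteq> 0" using norm_ge_zero[of a] norm_ge_zero[of b] by linarith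
    define h where "h = (r / 2) / (norm a + norm b + 1)"
    have h: "h > 0" "h * (norm a + norm b) < r"
    proof -
      show "h > 0" using r by (simp add: h_def add_nonneg_pos)
      have "h * (norm a + norm b) \<le> h * (norm a + norm b + 1)" using \<open>h > 0\<close> by simp
      also have "\<dots> = r / 2" using ab by (metis h_def nonzero_divide_eq_eq)
      finally show "h * (norm a + norm b) < r" using r by simp
    qed
    note Ub = U[OF subsetD[OF r(2)]] and Db = D[OF subsetD[OF r(2)]]
    have 1: "\<bar>(U (z + h *\<^sub>R a + h *\<^sub>R b) - U (z + h *\<^sub>R a)) - (U (z + h *\<^sub>R b) - U z) - h * h * (H z b \<bullet> a)\<bar> \<le> e / 2 * h * h"
      by (rule second_difference_bound[OF Ub Db HB]) (use h in auto)
    have 2: "\<bar>(U (z + h *\<^sub>R b + h *\<^sub>R a) - U (z + h *\<^sub>R b)) - (U (z + h *\<^sub>R a) - U z) - h * h * (H z a \<bullet> b)\<bar> \<le> e / 2 * h * h"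
      by (rule second_difference_bound[OF Ub Db]) (use h HB in \<open>auto simp: mult_ac add_ac\<close>)
    have comm: "z + h *\<^sub>R b + h *\<^sub>R a = z + h *\<^sub>R a + h *\<^sub>R b" by (simp add: add_ac)
    have "\<bar>h * h * (H z a \<bullet> b) - h * h * (H z b \<bullet> a)\<bar> \<le> e * h * h"
      using 1 2 unfolding comm by linarith
    then have "(h * h) * \<bar>H z a \<bullet> b - H z b \<bullet> a\<bar> \<le> (h * h) * e"
      by (simp add: right_diff_distrib[symmetric] abs_mult mult_ac)
    then show ?thesis using h by simp
  qed
  then have "\<bar>H z a \<bullet> b - H z b \<bullet> a\<bar> \<le> 0" by (rule field_le_epsilon)
  then show ?thesis by simp
qed

text \<open>
  The derivatives of \<open>u\<close> that the energy argument needs, each continuous on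
  \<open>[0,\<infinity>) \<times> closure \<Omega>\<close>: \<open>v = \<partial>\<^sub>t u\<close>, \<open>a = \<partial>\<^sub>t\<^sub>t u\<close>, \<open>p = \<nabla>u\<close>,
  \<open>q = \<nabla>\<partial>\<^sub>t u = \<partial>\<^sub>t\<nabla>u\<close> and \<open>S b = \<partial>\<^sub>b\<^sub>b u\<close>. First derivatives of \<open>u\<close> are
  identified up to \<open>t = 0\<close>, those of \<open>v\<close> and \<open>p\<close> for \<open>t > 0\<close> only.
\<close>

locale C2_data =
  fixes \<Omega> :: "'a::euclidean_space set" and u v a :: "real \<Rightarrow> 'a \<Rightarrow> real" and p q :: "real \<Rightarrow> 'a \<Rightarrow> 'a"
    and S :: "'a \<Rightarrow> real \<Rightarrow> 'a \<Rightarrow> real"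
  assumes \<Omega>: "open \<Omega>"
    and cont_u: "continuous_on ({0..} \<times> closure \<Omega>) (\<lambda>(t, x). u t x)"
    and cont_v: "continuous_on ({0..} \<times> closure \<Omega>) (\<lambda>(t, x). v t x)"
    and cont_p: "continuous_on ({0..} \<times> closure \<Omega>) (\<lambda>(t, x). p t x)"
    and cont_a: "continuous_on ({0..} \<times> closure \<Omega>) (\<lambda>(t, x). a t x)"
    and cont_q: "continuous_on ({0..} \<times> closure \<Omega>) (\<lambda>(t, x). q t x)"
    and cont_S: "b \<in> Basis \<Longrightarrow> continuous_on ({0..} \<times> closure \<Omega>) (\<lambda>(t, x). S b t x)"
    and u_t: "t \<ge> 0 \<Longrightarrow> x \<in> closure \<Omega> \<Longrightarrow> ((\<lambda>s. u s x) has_real_derivative v t x) (at t within {0..})"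
    and u_x: "t \<ge> 0 \<Longrightarrow> x \<in> \<Omega> \<Longrightarrow> b \<in> Basis \<Longrightarrow> ((\<lambda>s. u t (x + s *\<^sub>R b)) has_real_derivative p t x \<bullet> b) (at 0)"
    and v_t: "t > 0 \<Longrightarrow> x \<in> \<Omega> \<Longrightarrow> ((\<lambda>s. v s x) has_real_derivative a t x) (at t)"
    and v_x: "t > 0 \<Longrightarrow> x \<in> \<Omega> \<Longrightarrow> b \<in> Basis \<Longrightarrow> ((\<lambda>s. v t (x + s *\<^sub>R b)) has_real_derivative q t x \<bullet> b) (at 0)"
    and p_t: "t > 0 \<Longrightarrow> x \<in> \<Omega> \<Longrightarrow> ((\<lambda>s. p s x) has_vector_derivative q t x) (at t)"
    and p_x: "t > 0 \<Longrightarrow> x \<in> \<Omega> \<Longrightarrow> b \<in> Basis \<Longrightarrow> ((\<lambda>s. p t (x + s *\<^sub>R b) \<bullet> b) has_real_derivative S b t x) (at 0)"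
    and grad_u: "t > 0 \<Longrightarrow> x \<in> \<Omega> \<Longrightarrow> grad (u t) x = p t x"
    and laplacian_u: "t > 0 \<Longrightarrow> x \<in> \<Omega> \<Longrightarrow> laplacian (u t) x = (\<Sum>b\<in>Basis. S b t x)"

lemma GDERIV_transform_open:
  assumes "GDERIV f x :> D" "open U" "x \<in> U" "\<And>y. y \<in> U \<Longrightarrow> f y = g y"
  shows "GDERIV g x :> D"
  using assms has_derivative_transform_within_open unfolding gderiv_def by blast

lemma C2_closure_imp_C2_data:
  fixes \<Omega> :: "'a::euclidean_space set"
  assumes \<Omega>: "open \<Omega>" and C2: "C2_closure ({0<..} \<times> \<Omega>) (\<lambda>(t, x). u t x)"
  obtains v a p q S where "C2_data \<Omega> u v a p q S"
proof -
  define G where "G = {0::real<..} \<times> \<Omega>"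
  define U where "U = (\<lambda>(t, x). u t x)"
  have clG: "closure G = {0..} \<times> closure \<Omega>" by (simp add: G_def closure_Times)
  have "open G" using \<Omega> by (simp add: G_def open_Times)
  obtain D H where U: "continuous_on (closure G) U" and D: "continuous_on (closure G) D"
    and H: "continuous_on (closure G) (H :: real \<times> 'a \<Rightarrow> _ \<Rightarrow>\<^sub>L _)"
    and dU: "\<And>z. z \<in> G \<Longrightarrow> GDERIV U z :> D z"
    and dD: "\<And>z. z \<in> G \<Longrightarrow> (D has_derivative blinfun_apply (H z)) (at z)"
    using C2 unfolding C2_closure_def G_def[symmetric] U_def[symmetric] by blast
  have HG: "continuous_on G H" using continuous_on_subset[OF H closure_subset] .
  have sym: "H z c \<bullet> d = H z d \<bullet> c" if "z \<in> G" for z c d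
    by (rule second_deriv_symmetric[OF \<open>open G\<close> that dU dD HG])
  define v where "v t x = fst (D (t, x))" for t x
  define p where "p t x = snd (D (t, x))" for t x
  define a where "a t x = fst (H (t, x) (1, 0))" for t x
  define q where "q t x = snd (H (t, x) (1, 0))" for t x
  define S where "S b t x = snd (H (t, x) (0, b)) \<bullet> b" for b t x
  have inG: "(t, x) \<in> G" if "t > 0" "x \<in> \<Omega>" for t x using that by (simp add: G_def)
  have D_line: "((\<lambda>s. D ((t, x) + s *\<^sub>R w)) has_vector_derivative H (t, x) w) (at 0)" if "t > 0" "x \<in> \<Omega>" for t x w
  proof -
    have "((\<lambda>s. (t, x) + s *\<^sub>R w) has_derivative (\<lambda>s. s *\<^sub>R w)) (at 0)"
      by (auto intro!: derivative_eq_intros)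
    moreover have "(D has_derivative H (t, x)) (at ((t, x) + 0 *\<^sub>R w))" using dD[OF inG[OF that]] by simp
    ultimately have "((\<lambda>s. D ((t, x) + s *\<^sub>R w)) has_derivative (\<lambda>s. H (t, x) (s *\<^sub>R w))) (at 0)"
      by (rule has_derivative_compose[where g = D])
    then show ?thesis by (simp add: has_vector_derivative_def blinfun.scaleR_right)
  qed
  have GD: "GDERIV (u t) x :> p t x" if "t > 0" "x \<in> \<Omega>" for t x
  proof -
    have "((\<lambda>y. (t, y)) has_derivative (\<lambda>h. (0, h))) (at x)" by (auto intro!: derivative_eq_intros)
    from has_derivative_compose[OF this dU[OF inG[OF that], unfolded gderiv_def]]
    show ?thesis by (simp add: gderiv_def U_def p_def inner_prod_def)
  qed
  have gr: "grad (u t) x = p t x" if "t > 0" "x \<in> \<Omega>" for t x using GD[OF that] by (rule grad_eqI)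
  have "C2_data \<Omega> u v a p q S"
  proof
    show "open \<Omega>" by fact
    show "continuous_on ({0..} \<times> closure \<Omega>) (\<lambda>(t, x). u t x)" using U by (simp add: clG U_def)
    show "continuous_on ({0..} \<times> closure \<Omega>) (\<lambda>(t, x). v t x)"
      using continuous_on_fst[OF D] by (simp add: clG v_def case_prod_beta)
    show "continuous_on ({0..} \<times> closure \<Omega>) (\<lambda>(t, x). p t x)"
      using continuous_on_snd[OF D] by (simp add: clG p_def case_prod_beta)
    have cH: "continuous_on ({0..} \<times> closure \<Omega>) (\<lambda>z. H z w)" for w
      using H unfolding clG by (intro continuous_intros)
    show "continuous_on ({0..} \<times> closure \<Omega>) (\<lambda>(t, x). a t x)"
      using continuous_on_fst[OF cH] by (simp add: a_def case_prod_beta)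
    show "continuous_on ({0..} \<times> closure \<Omega>) (\<lambda>(t, x). q t x)"
      using continuous_on_snd[OF cH] by (simp add: q_def case_prod_beta)
    show "continuous_on ({0..} \<times> closure \<Omega>) (\<lambda>(t, x). S b t x)" for b
      using continuous_on_inner[OF continuous_on_snd[OF cH[of "(0, b)"]] continuous_on_const[of _ b]] by (simp add: S_def case_prod_beta)
  next
    fix t :: real and x assume t: "t \<ge> 0" and x: "x \<in> closure \<Omega>"
    obtain X where X: "\<And>n. X n \<in> \<Omega>" "X \<longlonglongrightarrow> x" using x closure_sequential by blast
    \<comment> \<open>Approach \<open>(t, x)\<close> from positive times and from points of \<open>\<Omega>\<close>, so that all segments stay inside.\<close>
    have "((\<lambda>h. U ((t, x) + h *\<^sub>R (1, 0))) has_real_derivative D (t, x) \<bullet> (1, 0)) (at 0 within {-t..})"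
    proof (rule directional_deriv_extends_to_closure[OF U D dU, where y = "\<lambda>n. (t + inverse (real (Suc n)), X n)"])
      show "(t, x) \<in> closure G" using t x by (simp add: clG)
      have "(\<lambda>n. (t + inverse (real (Suc n)), X n)) \<longlonglongrightarrow> (t + 0, x)"
        by (intro tendsto_intros LIMSEQ_inverse_real_of_nat X)
      then show "(\<lambda>n. (t + inverse (real (Suc n)), X n)) \<longlonglongrightarrow> (t, x)" by simp
      fix n h s assume "h \<in> {-t..}" "s \<in> closed_segment 0 h"
      then have "s \<ge> -t" using t by (auto simp: closed_segment_eq_real_ivl split: if_splits)
      moreover have "inverse (real (Suc n)) > 0" by simp
      ultimately have "t + inverse (real (Suc n)) + s > 0" by linarith
      then show "(t + inverse (real (Suc n)), X n) + s *\<^sub>R (1, 0) \<in> G" using X by (simp add: G_def)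
    qed
    then have "((\<lambda>h. u (t + h) x) has_real_derivative v t x) (at 0 within {-t..})"
      by (simp add: U_def v_def inner_prod_def)
    then have "((\<lambda>s. u s x) has_real_derivative v t x) (at (t + 0) within (+) t ` {-t..})"
      by (subst DERIV_at_within_shift)
    moreover have "(+) t ` {-t..} = {0..}"
    proof
      show "{0..} \<subseteq> (+) t ` {-t..}" by (auto intro!: image_eqI[where x = "_ - t"])
    qed auto
    ultimately show "((\<lambda>s. u s x) has_real_derivative v t x) (at t within {0..})" by simp
  next
    fix t :: real and x b :: 'a assume t: "t \<ge> 0" and x: "x \<in> \<Omega>" and b: "b \<in> Basis"
    obtain r where r: "r > 0" "ball x r \<subseteq> \<Omega>" using openE[OF \<Omega> x] by blast
    have "((\<lambda>h. U ((t, x) + h *\<^sub>R (0, b))) has_real_derivative D (t, x) \<bullet> (0, b)) (at 0 within {-r<..<r})"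
    proof (rule directional_deriv_extends_to_closure[OF U D dU, where y = "\<lambda>n. (t + inverse (real (Suc n)), x)"])
      show "(t, x) \<in> closure G" using t x closure_subset[of \<Omega>] by (auto simp: clG)
      have "(\<lambda>n. (t + inverse (real (Suc n)), x)) \<longlonglongrightarrow> (t + 0, x)"
        by (intro tendsto_intros LIMSEQ_inverse_real_of_nat)
      then show "(\<lambda>n. (t + inverse (real (Suc n)), x)) \<longlonglongrightarrow> (t, x)" by simp
      fix n h s assume "h \<in> {-r<..<r}" "s \<in> closed_segment 0 h"
      then have "\<bar>s\<bar> < r" by (auto simp: closed_segment_eq_real_ivl split: if_splits)
      then have "x + s *\<^sub>R b \<in> \<Omega>" using r b by (auto simp: subset_eq dist_norm)
      moreover have "inverse (real (Suc n)) > 0" by simp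
      then have "t + inverse (real (Suc n)) > 0" using t by linarith
      ultimately show "(t + inverse (real (Suc n)), x) + s *\<^sub>R (0, b) \<in> G" by (simp add: G_def)
    qed
    then show "((\<lambda>s. u t (x + s *\<^sub>R b)) has_real_derivative p t x \<bullet> b) (at 0)"
      using r at_within_open[of 0 "{-r<..<r}"] by (simp add: U_def p_def inner_prod_def)
  next
    fix t :: real and x assume tx: "t > 0" "x \<in> \<Omega>"
    have sh: "(\<lambda>s. f (t + s) x) = (\<lambda>s. f (s + t) x)" for f :: "real \<Rightarrow> 'a \<Rightarrow> 'c" by (simp add: add.commute)
    have *: "((\<lambda>s. v (t + s) x) has_vector_derivative a t x) (at 0)" "((\<lambda>s. p (t + s) x) has_vector_derivative q t x) (at 0)"
      using bounded_linear.has_vector_derivative[OF bounded_linear_fst D_line[OF tx, of "(1, 0)"]]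
        bounded_linear.has_vector_derivative[OF bounded_linear_snd D_line[OF tx, of "(1, 0)"]]
      by (simp_all add: v_def a_def p_def q_def)
    show "((\<lambda>s. v s x) has_real_derivative a t x) (at t)"
      using *(1) DERIV_shift[of "\<lambda>s. v s x" "a t x" 0 t] by (simp add: sh has_real_derivative_iff_has_vector_derivative)
    have "((\<lambda>s. p (t + (s - t)) x) has_vector_derivative q t x) (at t)"
    proof -
      have "((\<lambda>s. s - t) has_vector_derivative 1) (at t)" by (auto intro!: derivative_eq_intros)
      from vector_diff_chain_at[OF this, of "\<lambda>s. p (t + s) x" "q t x"] *(2) show ?thesis by (simp add: o_def)
    qed
    then show "((\<lambda>s. p s x) has_vector_derivative q t x) (at t)" by simp
    show "grad (u t) x = p t x" by (rule gr[OF tx])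
    have GDp: "GDERIV (\<lambda>y. p t y \<bullet> b) x :> (\<Sum>i\<in>Basis. (snd (H (t, x) (0, i)) \<bullet> b) *\<^sub>R i)" for b
    proof -
      have "((\<lambda>y. (t, y)) has_derivative (\<lambda>h. (0, h))) (at x)" by (auto intro!: derivative_eq_intros)
      from has_derivative_compose[OF this dD[OF inG[OF tx]]]
      have d1: "((\<lambda>y. p t y \<bullet> b) has_derivative (\<lambda>h. snd (H (t, x) (0, h)) \<bullet> b)) (at x)"
        unfolding p_def by (intro has_derivative_inner_left has_derivative_snd)
      have d2: "snd (H (t, x) (0, h)) \<bullet> b = h \<bullet> (\<Sum>i\<in>Basis. (snd (H (t, x) (0, i)) \<bullet> b) *\<^sub>R i)" for h
      proof -
        have lin: "linear (\<lambda>h. snd (H (t, x) (0, h)) \<bullet> b)"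
        proof
          show "snd (H (t, x) (0, c + d)) \<bullet> b = snd (H (t, x) (0, c)) \<bullet> b + snd (H (t, x) (0, d)) \<bullet> b" for c d
            using blinfun.add_right[of "H (t, x)" "(0, c)" "(0, d)"] by (simp add: inner_add_left)
          show "snd (H (t, x) (0, r *\<^sub>R c)) \<bullet> b = r *\<^sub>R (snd (H (t, x) (0, c)) \<bullet> b)" for r c
            using blinfun.scaleR_right[of "H (t, x)" r "(0, c)"] by simp
        qed
        have "snd (H (t, x) (0, \<Sum>i\<in>Basis. (h \<bullet> i) *\<^sub>R i)) \<bullet> b = (\<Sum>i\<in>Basis. (h \<bullet> i) *\<^sub>R (snd (H (t, x) (0, i)) \<bullet> b))"
        proof -
          have "snd (H (t, x) (0, \<Sum>i\<in>Basis. (h \<bullet> i) *\<^sub>R i)) \<bullet> b = (\<Sum>i\<in>Basis. snd (H (t, x) (0, (h \<bullet> i) *\<^sub>R i)) \<bullet> b)"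
            using linear_sum[OF lin, of "\<lambda>i. (h \<bullet> i) *\<^sub>R i" Basis] .
          also have "\<dots> = (\<Sum>i\<in>Basis. (h \<bullet> i) *\<^sub>R (snd (H (t, x) (0, i)) \<bullet> b))"
            by (rule sum.cong[OF refl]) (rule linear_scale[OF lin])
          finally show ?thesis .
        qed
        then show ?thesis by (simp add: euclidean_representation inner_sum_right mult.commute)
      qed
      have "(\<lambda>h. snd (H (t, x) (0, h)) \<bullet> b) = (\<lambda>h. h \<bullet> (\<Sum>i\<in>Basis. (snd (H (t, x) (0, i)) \<bullet> b) *\<^sub>R i))"
        using d2 by (rule ext)
      then show ?thesis unfolding gderiv_def by (rule has_derivative_eq_rhs[OF d1])
    qed
    have "laplacian (u t) x = (\<Sum>b\<in>Basis. grad (\<lambda>y. p t y \<bullet> b) x \<bullet> b)"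
      unfolding laplacian_def
    proof (rule sum.cong[OF refl])
      fix b :: 'a
      have "GDERIV (\<lambda>y. grad (u t) y \<bullet> b) x :> (\<Sum>i\<in>Basis. (snd (H (t, x) (0, i)) \<bullet> b) *\<^sub>R i)"
        by (rule GDERIV_transform_open[OF GDp \<Omega> tx(2)]) (simp add: gr tx)
      then show "grad (\<lambda>y. grad (u t) y \<bullet> b) x \<bullet> b = grad (\<lambda>y. p t y \<bullet> b) x \<bullet> b"
        using grad_eqI[OF GDp] by (simp add: grad_eqI)
    qed
    also have "\<dots> = (\<Sum>b\<in>Basis. S b t x)"
      by (rule sum.cong[OF refl])
        (simp add: grad_eqI[OF GDp] S_def inner_sum_left inner_Basis if_distrib cong: if_cong)
    finally show "laplacian (u t) x = (\<Sum>b\<in>Basis. S b t x)" .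
    fix b :: 'a assume b: "b \<in> Basis"
    have "((\<lambda>s. v t (x + s *\<^sub>R b)) has_real_derivative fst (H (t, x) (0, b))) (at 0)"
      using bounded_linear.has_vector_derivative[OF bounded_linear_fst D_line[OF tx, of "(0, b)"]]
      by (simp add: v_def has_real_derivative_iff_has_vector_derivative)
    moreover have "fst (H (t, x) (0, b)) = q t x \<bullet> b"
      using sym[OF inG[OF tx], of "(0, b)" "(1, 0)"] by (simp add: q_def inner_prod_def)
    ultimately show "((\<lambda>s. v t (x + s *\<^sub>R b)) has_real_derivative q t x \<bullet> b) (at 0)" by simp
    have "((\<lambda>s. D ((t, x) + s *\<^sub>R (0, b))) has_derivative (\<lambda>s. s *\<^sub>R H (t, x) (0, b))) (at 0)"
      using D_line[OF tx, of "(0, b)"] by (simp add: has_vector_derivative_def)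
    then have "((\<lambda>s. snd (D ((t, x) + s *\<^sub>R (0, b))) \<bullet> b) has_derivative (\<lambda>s. snd (s *\<^sub>R H (t, x) (0, b)) \<bullet> b)) (at 0)"
      by (intro has_derivative_inner_left has_derivative_snd)
    then show "((\<lambda>s. p t (x + s *\<^sub>R b) \<bullet> b) has_real_derivative S b t x) (at 0)"
      by (simp add: p_def S_def has_field_derivative_def mult_commute_abs)
  qed
  then show ?thesis using that by blast
qed

context C2_data
begin

lemma at_within_atLeast_neq_bot:
  assumes "t \<ge> (0::real)"
  shows "at t within {0..} \<noteq> bot"
proof -
  have "{t<..<t + 1} \<subseteq> {0..}" using assms by auto
  then have "t islimpt {0..}"
    using islimpt_subset[OF islimpt_greaterThanLessThan1[of t "t + 1"]] by auto
  then show ?thesis by (simp add: trivial_limit_within)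
qed

lemma dt_u: "t \<ge> 0 \<Longrightarrow> x \<in> closure \<Omega> \<Longrightarrow> dt u t x = v t x"
  unfolding dt_def
proof (rule vector_derivative_within)
  show "t \<ge> 0 \<Longrightarrow> at t within {0..} \<noteq> bot" by (rule at_within_atLeast_neq_bot)
qed (use u_t in \<open>simp add: has_real_derivative_iff_has_vector_derivative\<close>)

lemma dt_dt_u:
  assumes "t > 0" "x \<in> \<Omega>"
  shows "dt (dt u) t x = a t x"
proof -
  have "((\<lambda>s. dt u s x) has_real_derivative a t x) (at t)"
    using has_field_derivative_transform_within_open[OF v_t[OF assms], of "{0<..}"] assms dt_u closure_subset[of \<Omega>]
    by (simp add: subset_eq)
  then have "((\<lambda>s. dt u s x) has_vector_derivative a t x) (at t within {0..})"
    by (simp add: has_real_derivative_iff_has_vector_derivative has_vector_derivative_at_within)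
  moreover have "at t within {0..} = at t" using assms by (intro at_within_interior) auto
  ultimately show ?thesis unfolding dt_def by (simp add: vector_derivative_at)
qed

end

section \<open>The local energy inequality\<close>

lemma set_integrable_compact_support:
  fixes f :: "'a::euclidean_space \<Rightarrow> 'b::{banach, second_countable_topology}"
  assumes "A \<in> sets borel" "A \<subseteq> B" "closed B" "compact K" "continuous_on B f"
    and 0: "\<And>x. x \<in> A - K \<Longrightarrow> f x = 0"
  shows "set_integrable lborel A f"
proof -
  have "compact (B \<inter> K)" using assms by (simp add: closed_Int_compact)
  moreover have "continuous_on (B \<inter> K) f" using assms(5) continuous_on_subset by blast
  ultimately have "set_integrable lborel (B \<inter> K) f"
    by (intro continuous_bounded_set_integrable)
      (auto intro: compact_imp_bounded compact_continuous_image borel_compact)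
  then have "set_integrable lborel (A \<inter> K) f"
    by (rule set_integrable_subset) (use assms in \<open>auto intro: borel_compact\<close>)
  moreover have "(\<lambda>x. indicat_real (A \<inter> K) x *\<^sub>R f x) = (\<lambda>x. indicat_real A x *\<^sub>R f x)"
    using 0 by (auto simp: indicator_def fun_eq_iff)
  ultimately show ?thesis unfolding set_integrable_def by (simp only:)
qed

text \<open>
  The increment of \<open>\<phi>\<close> is the time integral of \<open>f\<close>; after exchanging the integrals the inner
  one is nonpositive by assumption.
\<close>

lemma integral_increment_nonpos:
  fixes \<phi> f :: "real \<Rightarrow> 'a::euclidean_space \<Rightarrow> real"
  assumes C: "C \<in> sets borel" "C \<subseteq> B" "closed B" and K: "compact K" and st: "s \<le> t"
    and f: "continuous_on ({s..t} \<times> B) (\<lambda>(\<tau>, x). f \<tau> x)"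
    and f0: "\<And>\<tau> x. \<tau> \<in> {s..t} \<Longrightarrow> x \<in> C - K \<Longrightarrow> f \<tau> x = 0"
    and \<phi>: "\<And>x. x \<in> C \<Longrightarrow> continuous_on {s..t} (\<lambda>\<tau>. \<phi> \<tau> x)"
    and der: "\<And>\<tau> x. \<tau> \<in> {s<..<t} \<Longrightarrow> x \<in> C \<Longrightarrow> ((\<lambda>\<tau>. \<phi> \<tau> x) has_real_derivative f \<tau> x) (at \<tau>)"
    and neg: "\<And>\<tau>. \<tau> \<in> {s<..<t} \<Longrightarrow> (LINT x:C|lborel. f \<tau> x) \<le> 0"
  shows "(LINT x:C|lborel. \<phi> t x - \<phi> s x) \<le> 0"
proof -
  interpret lborel_pair: pair_sigma_finite "lborel :: real measure" "lborel :: 'a measure" ..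
  define g where "g \<tau> x = indicat_real {s..t} \<tau> * (indicat_real C x * f \<tau> x)" for \<tau> x
  have "set_integrable lborel ({s..t} \<times> C) (\<lambda>(\<tau>, x). f \<tau> x)"
  proof (rule set_integrable_compact_support)
    show "{s..t} \<times> C \<in> sets borel" using C by (intro borel_Times) auto
    show "closed ({s..t} \<times> B)" using C by (intro closed_Times) auto
    show "compact ({s..t} \<times> K)" using K by (intro compact_Times) auto
    show "(case z of (\<tau>, x) \<Rightarrow> f \<tau> x) = 0" if "z \<in> {s..t} \<times> C - {s..t} \<times> K" for z
      using f0 that by (cases z) auto
  qed (use C f in auto)
  moreover have "indicat_real ({s..t} \<times> C) z *\<^sub>R (case z of (\<tau>, x) \<Rightarrow> f \<tau> x) = (case z of (\<tau>, x) \<Rightarrow> g \<tau> x)" for z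
    by (cases z) (auto simp: g_def indicator_def)
  ultimately have int: "integrable (lborel \<Otimes>\<^sub>M lborel) (\<lambda>(\<tau>, x). g \<tau> x)"
    by (simp add: set_integrable_def lborel_prod)
  have "(LINT x:C|lborel. \<phi> t x - \<phi> s x) = (LINT x|lborel. LINT \<tau>|lborel. g \<tau> x)"
    unfolding set_lebesgue_integral_def
  proof (rule Bochner_Integration.integral_cong[OF refl])
    fix x
    show "indicat_real C x *\<^sub>R (\<phi> t x - \<phi> s x) = (LINT \<tau>|lborel. g \<tau> x)"
    proof (cases "x \<in> C")
      case True
      then have sub: "(\<lambda>\<tau>. (\<tau>, x)) ` {s..t} \<subseteq> {s..t} \<times> B" using C by auto
      have "continuous_on {s..t} (\<lambda>\<tau>. (\<tau>, x))" by (intro continuous_intros)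
      from continuous_on_compose2[OF f this sub]
      have cf: "continuous_on {s..t} (\<lambda>\<tau>. f \<tau> x)" by simp
      have "((\<lambda>\<tau>. f \<tau> x) has_integral \<phi> t x - \<phi> s x) {s..t}"
        using st \<phi>[OF True] der[OF _ True]
        by (intro fundamental_theorem_of_calculus_interior) (auto simp flip: has_real_derivative_iff_has_vector_derivative)
      moreover have "set_integrable lborel {s..t} (\<lambda>\<tau>. f \<tau> x)"
        using cf by (rule borel_integrable_atLeastAtMost')
      ultimately have "(LINT \<tau>:{s..t}|lborel. f \<tau> x) = \<phi> t x - \<phi> s x"
        using set_borel_integral_eq_integral(2) integral_unique by metis
      then show ?thesis using True by (simp add: g_def set_lebesgue_integral_def)
    qed (simp add: g_def)
  qed
  also have "\<dots> = (LINT \<tau>|lborel. LINT x|lborel. g \<tau> x)"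
    by (rule lborel_pair.Fubini_integral[OF int])
  also have "\<dots> \<le> 0"
  proof -
    have "AE \<tau> in lborel. 0 \<le> - (LINT x|lborel. g \<tau> x)"
      using AE_lborel_singleton[of s] AE_lborel_singleton[of t]
    proof eventually_elim
      case (elim \<tau>)
      show ?case
      proof (cases "\<tau> \<in> {s..t}")
        case True
        then show ?thesis using neg[of \<tau>] elim by (simp add: g_def set_lebesgue_integral_def)
      qed (simp add: g_def)
    qed
    then have "0 \<le> (LINT \<tau>|lborel. - (LINT x|lborel. g \<tau> x))" by (rule integral_nonneg_AE)
    then show ?thesis by simp
  qed
  finally show ?thesis .
qed

context C2_data
begin

lemma cont_x:
  fixes f :: "real \<Rightarrow> 'a \<Rightarrow> 'c::topological_space"
  assumes "continuous_on ({0..} \<times> closure \<Omega>) (\<lambda>(t, x). f t x)" "t \<ge> 0"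
  shows "continuous_on (closure \<Omega>) (f t)"
proof -
  have "continuous_on (closure \<Omega>) (\<lambda>x. (t, x))" by (intro continuous_intros)
  from continuous_on_compose2[OF assms(1) this] assms(2) show ?thesis by auto
qed

lemma cont_t:
  fixes f :: "real \<Rightarrow> 'a \<Rightarrow> 'c::topological_space"
  assumes "continuous_on ({0..} \<times> closure \<Omega>) (\<lambda>(t, x). f t x)" "x \<in> closure \<Omega>"
  shows "continuous_on {0..} (\<lambda>t. f t x)"
proof -
  have "continuous_on {0..} (\<lambda>t::real. (t, x))" by (intro continuous_intros)
  from continuous_on_compose2[OF assms(1) this] assms(2) show ?thesis by auto
qed

lemma cont_x_u: "t \<ge> 0 \<Longrightarrow> continuous_on (closure \<Omega>) (u t)"
  and cont_x_v: "t \<ge> 0 \<Longrightarrow> continuous_on (closure \<Omega>) (v t)"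
  and cont_x_p: "t \<ge> 0 \<Longrightarrow> continuous_on (closure \<Omega>) (p t)"
  using cont_x[OF cont_u] cont_x[OF cont_v] cont_x[OF cont_p] by auto

end

locale damped_wave = C2_data \<Omega> u v a p q S
  for \<Omega> :: "'a::euclidean_space set" and u v a p q S +
  fixes \<alpha> \<epsilon> :: real and W W' :: "real \<Rightarrow> real"
  assumes \<alpha>: "\<alpha> > 0" and \<epsilon>: "\<epsilon> > 0"
    and W_deriv: "\<And>z. (W has_real_derivative W' z) (at z)" and W'_cont: "continuous_on UNIV W'"
    and W_nonneg: "\<And>z. W z \<ge> 0"
    and pde: "\<And>t x. t > 0 \<Longrightarrow> x \<in> \<Omega> \<Longrightarrow> a t x + \<alpha> * v t x = (\<Sum>b\<in>Basis. S b t x) - 1 / \<epsilon>\<^sup>2 * W' (u t x)"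
begin

definition energy_density :: "real \<Rightarrow> 'a \<Rightarrow> real" where
  "energy_density t x = \<epsilon> / 2 * (norm (p t x))\<^sup>2 + W (u t x) / \<epsilon> + \<epsilon> / 2 * (v t x)\<^sup>2"

lemma energy_density_nonneg: "energy_density t x \<ge> 0"
  using \<epsilon> W_nonneg by (simp add: energy_density_def)

lemma W_cont: "continuous_on A W"
  using W_deriv DERIV_isCont continuous_at_imp_continuous_on by blast

lemmas conts = cont_u[unfolded case_prod_beta] cont_v[unfolded case_prod_beta] cont_p[unfolded case_prod_beta]
  cont_a[unfolded case_prod_beta] cont_q[unfolded case_prod_beta] cont_S[unfolded case_prod_beta]

lemma cont_energy_density: "continuous_on ({0..} \<times> closure \<Omega>) (\<lambda>(t, x). energy_density t x)"
  unfolding energy_density_def case_prod_beta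
  using \<epsilon> by (intro continuous_intros conts continuous_on_compose2[OF W_cont[of UNIV]]) auto

lemma energy_density_deriv:
  assumes "t > 0" "x \<in> \<Omega>"
  shows "((\<lambda>s. energy_density s x) has_real_derivative
    \<epsilon> * (p t x \<bullet> q t x) + W' (u t x) * v t x / \<epsilon> + \<epsilon> * (v t x * a t x)) (at t)"
proof -
  have "((\<lambda>s. p s x \<bullet> p s x) has_real_derivative 2 * (p t x \<bullet> q t x)) (at t)"
    unfolding has_field_derivative_def
    by (rule has_derivative_eq_rhs[OF has_derivative_inner[OF p_t[OF assms, unfolded has_vector_derivative_def]
        p_t[OF assms, unfolded has_vector_derivative_def]]])
      (simp add: fun_eq_iff inner_commute[of "q t x"])
  moreover have "((\<lambda>s. u s x) has_real_derivative v t x) (at t)"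
  proof -
    have "at t within {0..} = at t" using assms by (intro at_within_interior) auto
    then show ?thesis using u_t[of t x] assms closure_subset[of \<Omega>] by (auto simp: subset_eq)
  qed
  ultimately show ?thesis
    unfolding energy_density_def power2_norm_eq_inner using \<epsilon>
    by (auto intro!: derivative_eq_intros DERIV_chain2[OF W_deriv] v_t[OF assms] simp: field_simps)
qed

text \<open>
  The heart of the proof. With the equation, the time derivative of \<open>w\<close> times the energy density
  is \<open>\<epsilon> div (w v \<nabla>u) - \<epsilon> \<alpha> w v\<^sup>2\<close> plus the terms in which the weight is differentiated,
  \<open>wt\<close> times the energy density minus \<open>\<epsilon> v wx \<bullet> \<nabla>u\<close>. Since
  \<open>\<bar>v\<bar> \<bar>\<nabla>u\<bar> \<le> (v\<^sup>2 + \<bar>\<nabla>u\<bar>\<^sup>2) / 2\<close>, the condition \<open>\<bar>wx\<bar> \<le> - wt\<close> makes these nonpositive: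
  energy travels with speed at most one. The divergence integrates to zero by the assumption
  \<open>ibp\<close>, whose integrand is \<open>div (w v \<nabla>u)\<close> written out.
\<close>

lemma weighted_energy_antimono:
  fixes w wt :: "real \<Rightarrow> 'a \<Rightarrow> real" and wx :: "real \<Rightarrow> 'a \<Rightarrow> 'a"
  assumes C: "C \<in> sets borel" "C \<subseteq> \<Omega>" and K: "compact K"
    and cw: "continuous_on UNIV (\<lambda>(t, x). w t x)" "continuous_on UNIV (\<lambda>(t, x). wt t x)" "continuous_on UNIV (\<lambda>(t, x). wx t x)"
    and w: "\<And>t x. w t x \<ge> 0" "\<And>t x. ((\<lambda>s. w s x) has_real_derivative wt t x) (at t)"
      "\<And>t x. norm (wx t x) \<le> - wt t x"
    and w0: "\<And>t x. t \<ge> 0 \<Longrightarrow> x \<in> C - K \<Longrightarrow> w t x = 0 \<and> wt t x = 0"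
    and ibp: "\<And>t. t > 0 \<Longrightarrow>
      (LINT x:C|lborel. w t x * (v t x * (\<Sum>b\<in>Basis. S b t x) + q t x \<bullet> p t x) + v t x * (wx t x \<bullet> p t x)) = 0"
    and st: "0 \<le> s" "s \<le> t"
  shows "(LINT x:C|lborel. w t x * energy_density t x) \<le> (LINT x:C|lborel. w s x * energy_density s x)"
proof -
  define f where "f \<tau> x = wt \<tau> x * energy_density \<tau> x + w \<tau> x *
    (\<epsilon> * (p \<tau> x \<bullet> q \<tau> x) + W' (u \<tau> x) * v \<tau> x / \<epsilon> + \<epsilon> * (v \<tau> x * a \<tau> x))" for \<tau> x
  define N where "N \<tau> x = w \<tau> x * (v \<tau> x * (\<Sum>b\<in>Basis. S b \<tau> x) + q \<tau> x \<bullet> p \<tau> x) + v \<tau> x * (wx \<tau> x \<bullet> p \<tau> x)" for \<tau> x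
  have C': "C \<subseteq> closure \<Omega>" using C(2) closure_subset[of \<Omega>] by auto
  have wx0: "wx \<tau> x = 0" if "\<tau> \<ge> 0" "x \<in> C - K" for \<tau> x using w(3)[of \<tau> x] w0[OF that] by simp
  have cw': "continuous_on A (\<lambda>z. w (fst z) (snd z))" "continuous_on A (\<lambda>z. wt (fst z) (snd z))"
    "continuous_on A (\<lambda>z. wx (fst z) (snd z))" for A
    using cw continuous_on_subset unfolding case_prod_beta by blast+
  have cf: "continuous_on ({0..} \<times> closure \<Omega>) (\<lambda>(t, x). f t x)"
    unfolding f_def case_prod_beta
    using \<epsilon> by (intro continuous_intros conts cw' cont_energy_density[unfolded case_prod_beta] continuous_on_compose2[OF W'_cont]) auto
  have cN: "continuous_on ({0..} \<times> closure \<Omega>) (\<lambda>(t, x). N t x)"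
    unfolding N_def case_prod_beta
    by (intro continuous_intros conts cw') auto
  have cwe: "continuous_on ({0..} \<times> closure \<Omega>) (\<lambda>(t, x). w t x * energy_density t x)"
    unfolding case_prod_beta by (intro continuous_intros cw' cont_energy_density[unfolded case_prod_beta])
  have iwe: "set_integrable lborel C (\<lambda>x. w \<tau> x * energy_density \<tau> x)" if "\<tau> \<ge> 0" for \<tau>
    by (rule set_integrable_compact_support[OF C(1) C' closed_closure K cont_x[OF cwe that]]) (simp add: w0 that)
  have "(LINT x:C|lborel. w t x * energy_density t x - w s x * energy_density s x) \<le> 0"
  proof (rule integral_increment_nonpos[where f = f, OF C(1) C' closed_closure K st(2)])
    show "continuous_on ({s..t} \<times> closure \<Omega>) (\<lambda>(\<tau>, x). f \<tau> x)"
      by (rule continuous_on_subset[OF cf]) (use st in auto)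
    show "f \<tau> x = 0" if "\<tau> \<in> {s..t}" "x \<in> C - K" for \<tau> x
      using w0[of \<tau> x] that st by (simp add: f_def)
    show "continuous_on {s..t} (\<lambda>\<tau>. w \<tau> x * energy_density \<tau> x)" if "x \<in> C" for x
      by (rule continuous_on_subset[OF cont_t[OF cwe]]) (use that C' st in auto)
    fix \<tau> assume "\<tau> \<in> {s<..<t}"
    then have \<tau>: "\<tau> > 0" using st by auto
    show "((\<lambda>\<tau>. w \<tau> x * energy_density \<tau> x) has_real_derivative f \<tau> x) (at \<tau>)" if "x \<in> C" for x
      unfolding f_def using DERIV_mult[OF w(2) energy_density_deriv[OF \<tau>]] that C by (auto simp: algebra_simps)
    have le: "f \<tau> x \<le> \<epsilon> * N \<tau> x" if x: "x \<in> C" for x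
    proof -
      have x': "x \<in> \<Omega>" using x C by auto
      have aeq: "a \<tau> x = (\<Sum>b\<in>Basis. S b \<tau> x) - 1 / \<epsilon>\<^sup>2 * W' (u \<tau> x) - \<alpha> * v \<tau> x" using pde[OF \<tau> x'] by simp
      have "\<epsilon> * (v \<tau> x * a \<tau> x) = \<epsilon> * v \<tau> x * (\<Sum>b\<in>Basis. S b \<tau> x) - W' (u \<tau> x) * v \<tau> x / \<epsilon> - \<epsilon> * \<alpha> * (v \<tau> x)\<^sup>2"
        unfolding aeq using \<epsilon> by (simp add: field_simps power2_eq_square)
      then have "f \<tau> x = wt \<tau> x * energy_density \<tau> x + w \<tau> x * (\<epsilon> * (q \<tau> x \<bullet> p \<tau> x) + \<epsilon> * v \<tau> x * (\<Sum>b\<in>Basis. S b \<tau> x) - \<epsilon> * \<alpha> * (v \<tau> x)\<^sup>2)"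
        unfolding f_def by (simp add: inner_commute)
      also have "\<dots> = \<epsilon> * N \<tau> x + (wt \<tau> x * energy_density \<tau> x - \<epsilon> * (v \<tau> x * (wx \<tau> x \<bullet> p \<tau> x))) - w \<tau> x * \<epsilon> * \<alpha> * (v \<tau> x)\<^sup>2"
        by (simp add: N_def algebra_simps)
      also have "\<dots> \<le> \<epsilon> * N \<tau> x"
      proof -
        have "0 \<le> w \<tau> x * \<epsilon> * \<alpha> * (v \<tau> x)\<^sup>2" using w(1) \<epsilon> \<alpha> by simp
        moreover have "- \<epsilon> * (v \<tau> x * (wx \<tau> x \<bullet> p \<tau> x)) \<le> - wt \<tau> x * energy_density \<tau> x"
        proof -
          have "- (v \<tau> x * (wx \<tau> x \<bullet> p \<tau> x)) \<le> \<bar>v \<tau> x\<bar> * \<bar>wx \<tau> x \<bullet> p \<tau> x\<bar>" by (metis abs_ge_minus_self abs_mult)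
          also have "\<dots> \<le> \<bar>v \<tau> x\<bar> * (- wt \<tau> x * norm (p \<tau> x))"
            using Cauchy_Schwarz_ineq2[of "wx \<tau> x" "p \<tau> x"] mult_right_mono[OF w(3)[of \<tau> x] norm_ge_zero[of "p \<tau> x"]]
            by (intro mult_left_mono) auto
          also have "\<dots> = - wt \<tau> x * (\<bar>v \<tau> x\<bar> * norm (p \<tau> x))" by simp
          also have "\<dots> \<le> - wt \<tau> x * ((norm (p \<tau> x))\<^sup>2 / 2 + (v \<tau> x)\<^sup>2 / 2)"
          proof (rule mult_left_mono)
            show "\<bar>v \<tau> x\<bar> * norm (p \<tau> x) \<le> (norm (p \<tau> x))\<^sup>2 / 2 + (v \<tau> x)\<^sup>2 / 2"
              using sum_squares_bound[of "\<bar>v \<tau> x\<bar>" "norm (p \<tau> x)"] by simp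
            show "0 \<le> - wt \<tau> x" using w(3)[of \<tau> x] norm_ge_zero[of "wx \<tau> x"] by linarith
          qed
          finally have "\<epsilon> * - (v \<tau> x * (wx \<tau> x \<bullet> p \<tau> x)) \<le> \<epsilon> * (- wt \<tau> x * ((norm (p \<tau> x))\<^sup>2 / 2 + (v \<tau> x)\<^sup>2 / 2))"
            using \<epsilon> by (intro mult_left_mono) auto
          also have "\<dots> = - wt \<tau> x * (\<epsilon> / 2 * (norm (p \<tau> x))\<^sup>2 + \<epsilon> / 2 * (v \<tau> x)\<^sup>2)" by (simp add: algebra_simps)
          also have "\<dots> \<le> - wt \<tau> x * energy_density \<tau> x"
          proof (rule mult_left_mono)
            show "\<epsilon> / 2 * (norm (p \<tau> x))\<^sup>2 + \<epsilon> / 2 * (v \<tau> x)\<^sup>2 \<le> energy_density \<tau> x" using W_nonneg \<epsilon> by (simp add: energy_density_def)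
            show "0 \<le> - wt \<tau> x" using w(3)[of \<tau> x] norm_ge_zero[of "wx \<tau> x"] by linarith
          qed
          finally show ?thesis by simp
        qed
        ultimately show ?thesis by simp
      qed
      finally show ?thesis .
    qed
    have "(LINT x:C|lborel. f \<tau> x) \<le> (LINT x:C|lborel. \<epsilon> * N \<tau> x)"
    proof (rule set_integral_mono[OF _ _ le])
      show "set_integrable lborel C (f \<tau>)"
        by (rule set_integrable_compact_support[OF C(1) C' closed_closure K cont_x[OF cf]]) (use \<tau> w0[of \<tau>] in \<open>auto simp: f_def\<close>)
      have "set_integrable lborel C (N \<tau>)"
        by (rule set_integrable_compact_support[OF C(1) C' closed_closure K cont_x[OF cN]]) (use \<tau> w0[of \<tau>] wx0[of \<tau>] in \<open>auto simp: N_def\<close>)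
      then show "set_integrable lborel C (\<lambda>x. \<epsilon> * N \<tau> x)" by simp
    qed
    also have "\<dots> = 0" using ibp[OF \<tau>] by (simp add: N_def[symmetric])
    finally show "(LINT x:C|lborel. f \<tau> x) \<le> 0" .
  qed
  then show ?thesis using set_integral_diff(2)[OF iwe iwe, of t s] st by simp
qed

end

text \<open>
  A weight supported in a backward cone of slope one; its square is \<open>C\<^sup>1\<close>. The smoothed norm
  \<open>sqrt (1 + x \<bullet> x)\<close> avoids the singularity of \<open>norm x\<close> at the origin. For fixed
  \<open>t \<ge> 0\<close> and \<open>x\<close> the weight increases to \<open>1\<close> as \<open>R \<rightarrow> \<infinity>\<close>.
\<close>

definition cone_cutoff :: "real \<Rightarrow> real \<Rightarrow> 'a::euclidean_space \<Rightarrow> real" where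
  "cone_cutoff R t x = max 0 (1 - (t + sqrt (1 + x \<bullet> x)) / R)"

definition cone_grad :: "real \<Rightarrow> real \<Rightarrow> 'a::euclidean_space \<Rightarrow> 'a" where
  "cone_grad R t x = (- (2 * cone_cutoff R t x / R) / sqrt (1 + x \<bullet> x)) *\<^sub>R x"

lemma cone_cutoff_props:
  fixes x :: "'a::euclidean_space"
  assumes R: "R > 0"
  shows "((\<lambda>s. (cone_cutoff R s x)\<^sup>2) has_real_derivative - (2 * cone_cutoff R t x / R)) (at t)"
    and "GDERIV (\<lambda>x. (cone_cutoff R t x)\<^sup>2) x :> cone_grad R t x"
    and "norm (cone_grad R t x) \<le> 2 * cone_cutoff R t x / R"
    and "t \<ge> 0 \<Longrightarrow> x \<notin> cball 0 R \<Longrightarrow> cone_cutoff R t x = 0"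
    and "0 \<le> cone_cutoff R t x" and "t \<ge> 0 \<Longrightarrow> cone_cutoff R t x \<le> 1"
proof -
  have pos: "1 + x \<bullet> x > 0" by (simp add: add_pos_nonneg)
  have "((\<lambda>s. 1 - (s + sqrt (1 + x \<bullet> x)) / R) has_real_derivative - (1 / R)) (at t)"
    using R by (auto intro!: derivative_eq_intros simp: field_simps)
  from DERIV_chain2[OF has_real_derivative_max_0_power2 this]
  show "((\<lambda>s. (cone_cutoff R s x)\<^sup>2) has_real_derivative - (2 * cone_cutoff R t x / R)) (at t)" by (simp add: cone_cutoff_def)
  have g: "GDERIV (\<lambda>x::'a. 1 + x \<bullet> x) x :> 2 *\<^sub>R x"
    unfolding gderiv_def by (auto intro!: derivative_eq_intros simp: inner_commute fun_eq_iff)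
  have "((\<lambda>z. 1 - (t + sqrt z) / R) has_real_derivative - (1 / (2 * sqrt (1 + x \<bullet> x)) / R)) (at (1 + x \<bullet> x))"
    using pos R by (auto intro!: derivative_eq_intros simp: field_simps)
  from GDERIV_compose[OF g DERIV_chain2[OF has_real_derivative_max_0_power2 this]]
  show "GDERIV (\<lambda>x. (cone_cutoff R t x)\<^sup>2) x :> cone_grad R t x"
    using pos by (simp add: cone_cutoff_def cone_grad_def mult_ac)
  have n: "norm x \<le> sqrt (1 + x \<bullet> x)" unfolding norm_eq_sqrt_inner by simp
  have m: "0 \<le> 2 * cone_cutoff R t x / R" using R by (simp add: cone_cutoff_def)
  have "norm (cone_grad R t x) = (2 * cone_cutoff R t x / R) * (norm x / sqrt (1 + x \<bullet> x))"
    using R pos by (simp add: cone_cutoff_def cone_grad_def abs_mult)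
  also have "\<dots> \<le> (2 * cone_cutoff R t x / R) * 1" using n pos m by (intro mult_left_mono) auto
  finally show "norm (cone_grad R t x) \<le> 2 * cone_cutoff R t x / R" by simp
  show "0 \<le> cone_cutoff R t x" by (simp add: cone_cutoff_def)
  show "cone_cutoff R t x = 0" if "t \<ge> 0" "x \<notin> cball 0 R"
  proof -
    have "R \<le> t + sqrt (1 + x \<bullet> x)" using that n by simp
    then show ?thesis using R by (simp add: cone_cutoff_def)
  qed
  show "cone_cutoff R t x \<le> 1" if "t \<ge> 0" using that R pos by (simp add: cone_cutoff_def)
qed

section \<open>Monotonicity of the classical energy\<close>

lemma nn_integral_eq_set_integral:
  assumes "set_integrable lborel C g" "\<And>x. x \<in> C \<Longrightarrow> g x \<ge> (0::real)"
  shows "(\<integral>\<^sup>+x. ennreal (g x) * indicator C x \<partial>lborel) = ennreal (LINT x:C|lborel. g x)"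
proof -
  have "(\<integral>\<^sup>+x. ennreal (indicator C x *\<^sub>R g x) \<partial>lborel) = ennreal (LINT x|lborel. indicator C x *\<^sub>R g x)"
    using assms by (intro nn_integral_eq_integral) (auto simp: set_integrable_def indicator_def)
  moreover have "ennreal (indicator C x *\<^sub>R g x) = ennreal (g x) * indicator C x" for x
    by (simp add: indicator_def)
  ultimately show ?thesis by (simp add: set_lebesgue_integral_def)
qed

lemma borel_measurable_continuous_times_indicator:
  fixes f :: "'a::topological_space \<Rightarrow> real"
  assumes "C \<in> sets borel" "C \<subseteq> B" "continuous_on B f" 
  shows "(\<lambda>x. ennreal (f x) * indicator C x) \<in> borel_measurable borel"
proof -
  have "(\<lambda>x. indicator C x *\<^sub>R f x) \<in> borel_measurable borel"
    using assms continuous_on_subset by (intro borel_measurable_continuous_on_indicator) auto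
  then have "(\<lambda>x. ennreal (indicator C x *\<^sub>R f x)) \<in> borel_measurable borel" by measurable
  moreover have "ennreal (indicator C x *\<^sub>R f x) = ennreal (f x) * indicator C x" for x
    by (simp add: indicator_def)
  ultimately show ?thesis by simp
qed

text \<open>
  The Cauchy-Schwarz inequality for the increment of \<open>f\<close>, obtained by expanding
  \<open>\<integral> (g - m)\<^sup>2 \<ge> 0\<close> for the mean \<open>m\<close> of \<open>g\<close>.
\<close>

lemma mean_square_le:
  fixes f g :: "real \<Rightarrow> real"
  assumes st: "s < t" and g: "continuous_on {s..t} g"
    and f: "\<And>\<tau>. \<tau> \<in> {s..t} \<Longrightarrow> (f has_real_derivative g \<tau>) (at \<tau> within {s..t})"
  shows "(f t - f s)\<^sup>2 \<le> (t - s) * (LINT \<tau>:{s..t}|lborel. (g \<tau>)\<^sup>2)"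
proof -
  define m where "m = (f t - f s) / (t - s)"
  have g2: "(\<lambda>\<tau>. (g \<tau>)\<^sup>2) integrable_on {s..t}"
    by (intro integrable_continuous_interval continuous_intros g)
  have G: "(g has_integral f t - f s) {s..t}"
    using st f by (intro fundamental_theorem_of_calculus) (auto simp flip: has_real_derivative_iff_has_vector_derivative)
  have "((\<lambda>\<tau>. (g \<tau>)\<^sup>2 - 2 * m * g \<tau> + m\<^sup>2) has_integral
      integral {s..t} (\<lambda>\<tau>. (g \<tau>)\<^sup>2) - 2 * m * (f t - f s) + measure lborel {s..t} *\<^sub>R m\<^sup>2) {s..t}"
    by (intro has_integral_add has_integral_diff integrable_integral[OF g2] has_integral_mult_right[OF G] has_integral_const_real)
  moreover have "(g \<tau>)\<^sup>2 - 2 * m * g \<tau> + m\<^sup>2 \<ge> 0" for \<tau>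
    using zero_le_power2[of "g \<tau> - m"] by (simp add: power2_diff algebra_simps)
  ultimately have "0 \<le> integral {s..t} (\<lambda>\<tau>. (g \<tau>)\<^sup>2) - 2 * m * (f t - f s) + measure lborel {s..t} *\<^sub>R m\<^sup>2"
    by (rule has_integral_nonneg)
  moreover have "f t - f s = m * (t - s)" using st by (simp add: m_def)
  ultimately have "m\<^sup>2 * (t - s) \<le> integral {s..t} (\<lambda>\<tau>. (g \<tau>)\<^sup>2)"
    using st by (simp add: power2_eq_square algebra_simps)
  then have "(t - s) * (m\<^sup>2 * (t - s)) \<le> (t - s) * integral {s..t} (\<lambda>\<tau>. (g \<tau>)\<^sup>2)"
    using st by (intro mult_left_mono) auto
  moreover have "(f t - f s)\<^sup>2 = (t - s) * (m\<^sup>2 * (t - s))"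
    using \<open>f t - f s = m * (t - s)\<close> by (simp add: power2_eq_square)
  moreover have "integral {s..t} (\<lambda>\<tau>. (g \<tau>)\<^sup>2) = (LINT \<tau>:{s..t}|lborel. (g \<tau>)\<^sup>2)"
    by (rule set_borel_integral_eq_integral(2)[symmetric])
      (intro borel_integrable_atLeastAtMost' continuous_intros g)
  ultimately show ?thesis by simp
qed

context damped_wave
begin

definition classical_energy :: "'a set \<Rightarrow> real \<Rightarrow> ennreal" where
  "classical_energy C t = (\<integral>\<^sup>+x. ennreal (energy_density t x) * indicator C x \<partial>lborel)"

lemma cone_energy_le:
  assumes C: "C \<in> sets borel" "C \<subseteq> \<Omega>" and st: "0 \<le> s" "s \<le> t" and R: "R > 0"
    and ibp: "\<And>\<tau>. \<tau> > 0 \<Longrightarrow> (LINT x:C|lborel. (cone_cutoff R \<tau> x)\<^sup>2 * (v \<tau> x * (\<Sum>b\<in>Basis. S b \<tau> x) + q \<tau> x \<bullet> p \<tau> x)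
       + v \<tau> x * (cone_grad R \<tau> x \<bullet> p \<tau> x)) = 0"
  shows "(\<integral>\<^sup>+x. ennreal ((cone_cutoff R t x)\<^sup>2 * energy_density t x) * indicator C x \<partial>lborel) \<le> classical_energy C s"
proof -
  have pos: "1 + x \<bullet> x > 0" for x :: 'a by (simp add: add_pos_nonneg)
  have C': "C \<subseteq> closure \<Omega>" using C closure_subset[of \<Omega>] by auto
  have cw: "continuous_on A (\<lambda>z. cone_cutoff R (fst z) (snd z))" for A :: "(real \<times> 'a) set"
    unfolding cone_cutoff_def using R by (intro continuous_intros) auto
  have cwe: "continuous_on ({0..} \<times> closure \<Omega>) (\<lambda>(t, x). (cone_cutoff R t x)\<^sup>2 * energy_density t x)"
    unfolding case_prod_beta by (intro continuous_intros cw cont_energy_density[unfolded case_prod_beta])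
  have int: "set_integrable lborel C (\<lambda>x. (cone_cutoff R \<tau> x)\<^sup>2 * energy_density \<tau> x)" if "\<tau> \<ge> 0" for \<tau>
    by (rule set_integrable_compact_support[OF C(1) C' closed_closure compact_cball[of 0 R] cont_x[OF cwe that]])
      (use cone_cutoff_props(4)[OF R that] in auto)
  have "(LINT x:C|lborel. (cone_cutoff R t x)\<^sup>2 * energy_density t x) \<le> (LINT x:C|lborel. (cone_cutoff R s x)\<^sup>2 * energy_density s x)"
  proof (rule weighted_energy_antimono[OF C compact_cball[of 0 R] _ _ _ _ cone_cutoff_props(1)[OF R] _ _ ibp st])
    show "continuous_on UNIV (\<lambda>(t, x::'a). (cone_cutoff R t x)\<^sup>2)"
      unfolding case_prod_beta by (intro continuous_intros cw)
    show "continuous_on UNIV (\<lambda>(t, x::'a). - (2 * cone_cutoff R t x / R))"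
      unfolding case_prod_beta using R by (intro continuous_intros cw) auto
    show "continuous_on UNIV (\<lambda>(t, x::'a). cone_grad R t x)"
      unfolding case_prod_beta cone_grad_def using R pos by (intro continuous_intros cw) (auto simp: less_imp_neq[THEN not_sym])
    show "norm (cone_grad R t x) \<le> - (- (2 * cone_cutoff R t x / R))" for t and x :: 'a
      using cone_cutoff_props(3)[OF R] by simp
    show "(cone_cutoff R t x)\<^sup>2 = 0 \<and> - (2 * cone_cutoff R t x / R) = 0" if "t \<ge> 0" "x \<in> C - cball 0 R" for t x
      using cone_cutoff_props(4)[OF R that(1), of x] that(2) by simp
  qed auto
  then have "(\<integral>\<^sup>+x. ennreal ((cone_cutoff R t x)\<^sup>2 * energy_density t x) * indicator C x \<partial>lborel)
      \<le> (\<integral>\<^sup>+x. ennreal ((cone_cutoff R s x)\<^sup>2 * energy_density s x) * indicator C x \<partial>lborel)"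
    using st int[of s] int[of t] energy_density_nonneg by (simp add: nn_integral_eq_set_integral ennreal_leI)
  also have "\<dots> \<le> classical_energy C s"
    unfolding classical_energy_def
  proof (intro nn_integral_mono mult_right_mono ennreal_leI)
    fix x :: 'a
    have "(cone_cutoff R s x)\<^sup>2 \<le> 1" using cone_cutoff_props(5,6)[OF R, of s x] st by (simp add: power_le_one)
    then show "(cone_cutoff R s x)\<^sup>2 * energy_density s x \<le> energy_density s x" using energy_density_nonneg[of s x] by (simp add: mult_left_le_one_le)
  qed auto
  finally show ?thesis .
qed

text \<open>
  Monotone convergence as the cones exhaust the space. Passing through compactly supported weights
  avoids any decay assumption on \<open>u\<close> when \<open>C\<close> is unbounded.
\<close>

lemma energy_antimono_of_cones:
  assumes C: "C \<in> sets borel" "C \<subseteq> \<Omega>" and t: "0 \<le> t"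
    and cone: "\<And>R. R > 0 \<Longrightarrow> (\<integral>\<^sup>+x. ennreal ((cone_cutoff R t x)\<^sup>2 * energy_density t x) * indicator C x \<partial>lborel) \<le> E"
  shows "classical_energy C t \<le> E"
proof -
  have C': "C \<subseteq> closure \<Omega>" using C closure_subset[of \<Omega>] by auto
  define f where "f n x = ennreal ((cone_cutoff (real (Suc n)) t x)\<^sup>2 * energy_density t x) * indicator C x" for n x
  have "(\<lambda>n. \<integral>\<^sup>+x. f n x \<partial>lborel) \<longlonglongrightarrow> (\<integral>\<^sup>+x. ennreal (energy_density t x) * indicator C x \<partial>lborel)"
  proof (rule nn_integral_LIMSEQ)
    show "incseq f"
    proof (rule incseq_SucI, rule le_funI)
      fix n and x :: 'a
      have "(t + sqrt (1 + x \<bullet> x)) / real (Suc (Suc n)) \<le> (t + sqrt (1 + x \<bullet> x)) / real (Suc n)"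
        using t by (intro divide_left_mono) auto
      then have "cone_cutoff (real (Suc n)) t x \<le> cone_cutoff (real (Suc (Suc n))) t x" by (simp add: cone_cutoff_def)
      then have "(cone_cutoff (real (Suc n)) t x)\<^sup>2 * energy_density t x \<le> (cone_cutoff (real (Suc (Suc n))) t x)\<^sup>2 * energy_density t x"
        using energy_density_nonneg by (intro mult_right_mono power_mono) (auto simp: cone_cutoff_def)
      then show "f n x \<le> f (Suc n) x" unfolding f_def by (rule mult_right_mono[OF ennreal_leI]) simp
    qed
    show "f n \<in> borel_measurable lborel" for n
    proof -
      have "continuous_on (closure \<Omega>) (\<lambda>x. (cone_cutoff (real (Suc n)) t x)\<^sup>2 * energy_density t x)"
        unfolding cone_cutoff_def by (intro continuous_intros cont_x[OF cont_energy_density t]) auto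
      from borel_measurable_continuous_times_indicator[OF C(1) C' this] show ?thesis by (simp add: f_def[abs_def])
    qed
    show "(\<lambda>n. f n x) \<longlonglongrightarrow> ennreal (energy_density t x) * indicator C x" for x :: 'a
    proof -
      have "(\<lambda>n. (t + sqrt (1 + x \<bullet> x)) * inverse (real (Suc n))) \<longlonglongrightarrow> (t + sqrt (1 + x \<bullet> x)) * 0"
        by (intro tendsto_intros LIMSEQ_inverse_real_of_nat)
      then have "(\<lambda>n. cone_cutoff (real (Suc n)) t x) \<longlonglongrightarrow> max 0 (1 - 0)"
        unfolding cone_cutoff_def divide_inverse by (intro tendsto_intros) simp
      then have l: "(\<lambda>n. cone_cutoff (real (Suc n)) t x) \<longlonglongrightarrow> 1" by simp
      have "(\<lambda>n. (cone_cutoff (real (Suc n)) t x)\<^sup>2 * energy_density t x) \<longlonglongrightarrow> 1\<^sup>2 * energy_density t x"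
        by (intro tendsto_intros l)
      then show ?thesis unfolding f_def by (cases "x \<in> C") (auto intro: tendsto_ennrealI)
    qed
  qed
  moreover have "\<forall>n\<ge>0. (\<integral>\<^sup>+x. f n x \<partial>lborel) \<le> E"
    using cone[of "real (Suc n)" for n] by (simp add: f_def)
  ultimately show ?thesis unfolding classical_energy_def by (rule Lim_bounded)
qed

text \<open>
  The field \<open>w v \<nabla>u\<close> vanishes on the boundary if \<open>v\<close> does, and it has no normal component
  there if \<open>\<nabla>u\<close> has none. In either case its divergence integrates to zero.
\<close>

theorem classical_energy_antimono_euclidean:
  assumes bc: "(\<forall>t>0. \<forall>x\<in>frontier \<Omega>. v t x = 0) \<or>
      (C1_boundary \<Omega> \<and> (\<forall>t>0. \<forall>x\<in>frontier \<Omega>. \<forall>\<nu>. outer_unit_normal \<Omega> x \<nu> \<longrightarrow> p t x \<bullet> \<nu> = 0))"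
    and st: "0 \<le> s" "s \<le> t"
  shows "classical_energy \<Omega> t \<le> classical_energy \<Omega> s"
proof (rule energy_antimono_of_cones)
  show "\<Omega> \<in> sets borel" using \<Omega> by simp
  fix R :: real assume R: "R > 0"
  show "(\<integral>\<^sup>+x. ennreal ((cone_cutoff R t x)\<^sup>2 * energy_density t x) * indicator \<Omega> x \<partial>lborel) \<le> classical_energy \<Omega> s"
  proof (rule cone_energy_le[OF _ order.refl st R])
    show "\<Omega> \<in> sets borel" using \<Omega> by simp
    fix \<tau> :: real assume \<tau>: "\<tau> > 0"
    define w where "w x = (cone_cutoff R \<tau> x)\<^sup>2" for x :: 'a
    define wx where "wx x = cone_grad R \<tau> x" for x :: 'a
    define F where "F x = (w x * v \<tau> x) *\<^sub>R p \<tau> x" for x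
    define Q where "Q b x = w x * (v \<tau> x * S b \<tau> x + (q \<tau> x \<bullet> b) * (p \<tau> x \<bullet> b)) + v \<tau> x * ((wx x \<bullet> b) * (p \<tau> x \<bullet> b))" for b x
    have pos: "1 + x \<bullet> x > 0" for x :: 'a by (simp add: add_pos_nonneg)
    have cw: "continuous_on A w" "continuous_on A wx" for A
      unfolding w_def wx_def cone_grad_def cone_cutoff_def using R pos by (intro continuous_intros; auto simp: less_imp_neq[THEN not_sym])+
    have w: "GDERIV w x :> wx x" for x
      using cone_cutoff_props(2)[OF R] by (simp add: w_def[abs_def] wx_def)
    note cs = cont_x[OF cont_v less_imp_le[OF \<tau>]] cont_x[OF cont_p less_imp_le[OF \<tau>]]
      cont_x[OF cont_q less_imp_le[OF \<tau>]] cont_x[OF cont_S less_imp_le[OF \<tau>]]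
    have df: "div_field \<Omega> (cball 0 R) F Q"
      unfolding div_field_def
    proof (intro conjI ballI)
      show "compact (cball (0::'a) R)" by simp
      show "continuous_on (closure \<Omega>) F" unfolding F_def by (intro continuous_intros cw cs)
      show "F x = 0" if "x \<in> closure \<Omega> - cball 0 R" for x
        using cone_cutoff_props(4)[OF R less_imp_le[OF \<tau>], of x] that by (simp add: F_def w_def)
      fix b :: 'a assume b: "b \<in> Basis"
      show "((\<lambda>s. F (x + s *\<^sub>R b) \<bullet> b) has_real_derivative Q b x) (at 0)" if x: "x \<in> \<Omega>" for x
        using DERIV_mult[OF DERIV_mult[OF GDERIV_directional[OF w[of x], of b] v_x[OF \<tau> x b]] p_x[OF \<tau> x b]]
        by (simp add: F_def Q_def algebra_simps)
      have cQ: "continuous_on (closure \<Omega>) (Q b)"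
        unfolding Q_def by (intro continuous_intros cw cs b)
      then show "continuous_on \<Omega> (Q b)" using closure_subset continuous_on_subset by blast
      have "compact (closure \<Omega> \<inter> cball 0 R)" by (simp add: closed_Int_compact)
      then have "bounded (Q b ` (closure \<Omega> \<inter> cball 0 R))"
        using continuous_on_subset[OF cQ] by (intro compact_imp_bounded compact_continuous_image) auto
      then show "bounded (Q b ` (\<Omega> \<inter> cball 0 R))"
        by (rule bounded_subset) (use closure_subset[of \<Omega>] in auto)
    qed
    have "(LINT x:\<Omega>|lborel. \<Sum>b\<in>Basis. Q b x) = 0"
      using bc
    proof
      assume "\<forall>t>0. \<forall>x\<in>frontier \<Omega>. v t x = 0"
      then show ?thesis using \<tau> by (intro integral_div_eq_0_if_0_on_frontier[OF df \<Omega>]) (simp add: F_def)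
    next
      assume "C1_boundary \<Omega> \<and> (\<forall>t>0. \<forall>x\<in>frontier \<Omega>. \<forall>\<nu>. outer_unit_normal \<Omega> x \<nu> \<longrightarrow> p t x \<bullet> \<nu> = 0)"
      then show ?thesis using \<tau> by (intro divergence_theorem_no_flux[OF \<Omega> _ df]) (auto simp: F_def)
    qed
    moreover have "(\<Sum>b\<in>Basis. Q b x) = w x * (v \<tau> x * (\<Sum>b\<in>Basis. S b \<tau> x) + q \<tau> x \<bullet> p \<tau> x) + v \<tau> x * (wx x \<bullet> p \<tau> x)" for x
      unfolding Q_def euclidean_inner[of "q \<tau> x" "p \<tau> x"] euclidean_inner[of "wx x" "p \<tau> x"]
      by (simp add: sum.distrib sum_distrib_left distrib_left)
    ultimately show "(LINT x:\<Omega>|lborel. (cone_cutoff R \<tau> x)\<^sup>2 * (v \<tau> x * (\<Sum>b\<in>Basis. S b \<tau> x) + q \<tau> x \<bullet> p \<tau> x)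
       + v \<tau> x * (cone_grad R \<tau> x \<bullet> p \<tau> x)) = 0"
      unfolding w_def wx_def by (simp only:)
  qed
qed (use st in auto)

text \<open>
  On the torus the constant weight \<open>1\<close> serves, because \<open>v \<nabla>u\<close> is periodic.
\<close>

theorem classical_energy_antimono_torus:
  assumes L: "is_domain (Flat_Torus L)" and \<Omega>_UNIV: "\<Omega> = UNIV"
    and per: "\<And>t. t \<ge> 0 \<Longrightarrow> function_on (Flat_Torus L) (u t)"
    and st: "0 \<le> s" "s \<le> t"
  shows "classical_energy (cell (Flat_Torus L)) t \<le> classical_energy (cell (Flat_Torus L)) s"
proof -
  define C where "C = cell (Flat_Torus L)"
  have C: "C \<in> sets borel" "C \<subseteq> \<Omega>" "C \<subseteq> closure \<Omega>" "C \<subseteq> cbox 0 L"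
    using borel_cell_torus[of L] cell_torus_subset_cbox[of L] \<Omega>_UNIV by (auto simp: C_def simp del: cell.simps)
  have v_eq: "v t x = dt u t x" if "t \<ge> 0" for t x using dt_u[OF that, of x] \<Omega>_UNIV by simp
  have v_per: "function_on (Flat_Torus L) (v t)" if t: "t \<ge> 0" for t
  proof -
    have "v t (x + (L \<bullet> b) *\<^sub>R b) = v t x" if b: "b \<in> Basis" for b x
    proof -
      have "((\<lambda>s. u s (x + (L \<bullet> b) *\<^sub>R b)) has_real_derivative v t x) (at t within {0..})"
        by (rule has_field_derivative_transform_within[OF u_t[OF t, of x], of 1]) (use per b t \<Omega>_UNIV in auto)
      then have "((\<lambda>s. u s (x + (L \<bullet> b) *\<^sub>R b)) has_vector_derivative v t x) (at t within {0..})"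
        by (simp add: has_real_derivative_iff_has_vector_derivative)
      then have "dt u t (x + (L \<bullet> b) *\<^sub>R b) = v t x"
        unfolding dt_def using at_within_atLeast_neq_bot[OF t] by (rule vector_derivative_within[rotated])
      then show ?thesis using v_eq[OF t] by simp
    qed
    then show ?thesis by simp
  qed
  have p_per: "p t (x + (L \<bullet> b) *\<^sub>R b) \<bullet> i = p t x \<bullet> i" if t: "t \<ge> 0" and b: "b \<in> Basis" and i: "i \<in> Basis" for t b i x
  proof -
    have "(\<lambda>s. u t (x + (L \<bullet> b) *\<^sub>R b + s *\<^sub>R i)) = (\<lambda>s. u t (x + s *\<^sub>R i))"
    proof
      fix s
      have shift: "x + (L \<bullet> b) *\<^sub>R b + s *\<^sub>R i = (x + s *\<^sub>R i) + (L \<bullet> b) *\<^sub>R b" by simp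
      show "u t (x + (L \<bullet> b) *\<^sub>R b + s *\<^sub>R i) = u t (x + s *\<^sub>R i)"
        unfolding shift using per[OF t] b by simp
    qed
    then show ?thesis
      using u_x[OF t _ i, of "x + (L \<bullet> b) *\<^sub>R b"] u_x[OF t _ i, of x] \<Omega>_UNIV DERIV_unique by fastforce
  qed
  have "(LINT x:C|lborel. 1 * energy_density t x) \<le> (LINT x:C|lborel. 1 * energy_density s x)"
  proof (rule weighted_energy_antimono[where wt = "\<lambda>t x. 0" and wx = "\<lambda>t x. 0", OF C(1,2) compact_cbox[of 0 L]])
    fix \<tau> :: real assume \<tau>: "\<tau> > 0"
    note cs = cont_x[OF cont_v less_imp_le[OF \<tau>]] cont_x[OF cont_p less_imp_le[OF \<tau>]]
      cont_x[OF cont_q less_imp_le[OF \<tau>]] cont_x[OF cont_S less_imp_le[OF \<tau>]]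
    define Q where "Q b x = v \<tau> x * S b \<tau> x + (q \<tau> x \<bullet> b) * (p \<tau> x \<bullet> b)" for b x
    have cQ: "continuous_on (closure \<Omega>) (Q b)" if "b \<in> Basis" for b
      unfolding Q_def by (intro continuous_intros cs that)
    have int: "set_integrable lborel C (Q b)" if "b \<in> Basis" for b
      by (rule set_integrable_compact_support[OF C(1,3) closed_closure compact_cbox[of 0 L] cQ[OF that]]) (use C in auto)
    have "(LINT x:C|lborel. Q b x) = 0" if b: "b \<in> Basis" for b
      unfolding C_def
    proof (rule integral_partial_deriv_eq_0_torus[OF L b])
      show "function_on (Flat_Torus L) (\<lambda>x. v \<tau> x * (p \<tau> x \<bullet> b))"
        using v_per[of \<tau>] p_per[of \<tau> _ b] \<tau> b by simp
      show "((\<lambda>s. v \<tau> (x + s *\<^sub>R b) * (p \<tau> (x + s *\<^sub>R b) \<bullet> b)) has_real_derivative Q b x) (at 0)" for x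
        using DERIV_mult[OF v_x[OF \<tau> _ b] p_x[OF \<tau> _ b], of x x] \<Omega>_UNIV by (simp add: Q_def algebra_simps)
      show "continuous_on UNIV (Q b)" using cQ[OF b] \<Omega>_UNIV by simp
    qed
    then have "(LINT x:C|lborel. \<Sum>b\<in>Basis. Q b x) = 0"
      using int unfolding set_integrable_def scaleR_sum_right set_lebesgue_integral_def
      by (subst Bochner_Integration.integral_sum) auto
    moreover have "(\<Sum>b\<in>Basis. Q b x) = v \<tau> x * (\<Sum>b\<in>Basis. S b \<tau> x) + q \<tau> x \<bullet> p \<tau> x" for x
      unfolding Q_def euclidean_inner[of "q \<tau> x" "p \<tau> x"]
      by (simp add: sum.distrib sum_distrib_left distrib_left)
    ultimately show "(LINT x:C|lborel. 1 * (v \<tau> x * (\<Sum>b\<in>Basis. S b \<tau> x) + q \<tau> x \<bullet> p \<tau> x) + v \<tau> x * (0 \<bullet> p \<tau> x)) = 0"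
      by simp
  qed (use st C in \<open>auto simp: case_prod_beta\<close>)
  moreover have "set_integrable lborel C (energy_density \<tau>)" if "\<tau> \<ge> 0" for \<tau>
    by (rule set_integrable_compact_support[OF C(1,3) closed_closure compact_cbox[of 0 L] cont_x[OF cont_energy_density that]]) (use C in auto)
  ultimately show ?thesis
    unfolding classical_energy_def C_def[symmetric] using st
    by (simp add: nn_integral_eq_set_integral energy_density_nonneg ennreal_leI)
qed

text \<open>
  The energy does not control \<open>u\<close> in \<open>L\<^sup>2\<close> on unbounded domains, but it controls \<open>\<partial>\<^sub>t u\<close>,
  and \<open>u(t) - u(s)\<close> is the time integral of \<open>\<partial>\<^sub>t u\<close>. Hence \<open>u(t)\<close> inherits square
  integrability from \<open>u(s)\<close>, and membership in \<open>H\<^sup>1\<close> is not lost.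
\<close>

lemma square_integral_finite:
  assumes C: "C \<in> sets borel" "C \<subseteq> \<Omega>" and st: "0 \<le> s" "s \<le> t"
    and mono: "\<And>\<tau>. s \<le> \<tau> \<Longrightarrow> classical_energy C \<tau> \<le> classical_energy C s"
    and fin: "classical_energy C s < \<infinity>" and us: "(\<integral>\<^sup>+x. ennreal ((u s x)\<^sup>2) * indicator C x \<partial>lborel) < \<infinity>"
  shows "(\<integral>\<^sup>+x. ennreal ((u t x)\<^sup>2) * indicator C x \<partial>lborel) < \<infinity>"
proof (cases "s = t")
  case False
  then have lt: "s < t" using st by simp
  interpret lborel_pair: pair_sigma_finite "lborel :: real measure" "lborel :: 'a measure" ..
  have C': "C \<subseteq> closure \<Omega>" using C closure_subset[of \<Omega>] by auto
  define g where "g \<tau> x = ennreal ((v \<tau> x)\<^sup>2) * indicator C x * indicator {s..t} \<tau>" for \<tau> x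
  have g_meas: "(\<lambda>(\<tau>, x). g \<tau> x) \<in> borel_measurable (lborel \<Otimes>\<^sub>M lborel)"
  proof -
    have "continuous_on ({0..} \<times> closure \<Omega>) (\<lambda>z. (v (fst z) (snd z))\<^sup>2)" by (intro continuous_intros conts)
    moreover have "{s..t} \<times> C \<in> sets borel" using C by (intro borel_Times) auto
    moreover have "{s..t} \<times> C \<subseteq> {0..} \<times> closure \<Omega>" using st C' by auto
    ultimately have "(\<lambda>z. ennreal ((v (fst z) (snd z))\<^sup>2) * indicator ({s..t} \<times> C) z) \<in> borel_measurable borel"
      by (intro borel_measurable_continuous_times_indicator)
    moreover have "ennreal ((v (fst z) (snd z))\<^sup>2) * indicator ({s..t} \<times> C) z = (case z of (\<tau>, x) \<Rightarrow> g \<tau> x)" for z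
      by (cases z) (auto simp: g_def indicator_def)
    ultimately show ?thesis by (simp add: lborel_prod)
  qed
  have [measurable]: "(\<lambda>x. ennreal ((u \<tau> x)\<^sup>2) * indicator C x) \<in> borel_measurable borel" if "\<tau> \<ge> 0" for \<tau>
    using that by (intro borel_measurable_continuous_times_indicator[OF C(1) C'] continuous_intros cont_x[OF cont_u])
  have pointwise: "ennreal ((u t x)\<^sup>2) * indicator C x
      \<le> 2 * (ennreal ((u s x)\<^sup>2) * indicator C x) + ennreal (2 * (t - s)) * (\<integral>\<^sup>+\<tau>. g \<tau> x \<partial>lborel)" for x
  proof (cases "x \<in> C")
    case True
    have cv: "continuous_on {s..t} (\<lambda>\<tau>. v \<tau> x)"
      by (rule continuous_on_subset[OF cont_t[OF cont_v]]) (use True C' st in auto)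
    have "(u t x - u s x)\<^sup>2 \<le> (t - s) * (LINT \<tau>:{s..t}|lborel. (v \<tau> x)\<^sup>2)"
    proof (rule mean_square_le[OF lt cv])
      show "((\<lambda>\<tau>. u \<tau> x) has_real_derivative v \<tau> x) (at \<tau> within {s..t})" if "\<tau> \<in> {s..t}" for \<tau>
        by (rule DERIV_subset[OF u_t]) (use True C' st that in auto)
    qed
    moreover have "(u t x)\<^sup>2 \<le> 2 * (u s x)\<^sup>2 + 2 * (u t x - u s x)\<^sup>2"
      using zero_le_power2[of "2 * u s x - u t x"] by (simp add: power2_eq_square algebra_simps)
    ultimately have "(u t x)\<^sup>2 \<le> 2 * (u s x)\<^sup>2 + 2 * (t - s) * (LINT \<tau>:{s..t}|lborel. (v \<tau> x)\<^sup>2)" by linarith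
    moreover have nn: "0 \<le> (LINT \<tau>:{s..t}|lborel. (v \<tau> x)\<^sup>2)"
      unfolding set_lebesgue_integral_def by (intro Bochner_Integration.integral_nonneg) auto
    ultimately have "ennreal ((u t x)\<^sup>2) \<le> ennreal (2 * (u s x)\<^sup>2) + ennreal (2 * (t - s)) * ennreal (LINT \<tau>:{s..t}|lborel. (v \<tau> x)\<^sup>2)"
      using lt by (subst ennreal_mult[symmetric]) (auto simp: ennreal_plus[symmetric] ennreal_leI simp del: ennreal_plus)
    also have "ennreal (LINT \<tau>:{s..t}|lborel. (v \<tau> x)\<^sup>2) = (\<integral>\<^sup>+\<tau>. g \<tau> x \<partial>lborel)"
      using True by (subst nn_integral_eq_set_integral[symmetric])
        (auto simp: g_def intro!: borel_integrable_atLeastAtMost' continuous_intros cv)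
    also have "ennreal (2 * (u s x)\<^sup>2) = 2 * ennreal ((u s x)\<^sup>2)" by (simp add: ennreal_mult)
    finally show ?thesis using True by simp
  qed simp
  have slice: "(\<integral>\<^sup>+x. g \<tau> x \<partial>lborel) \<le> ennreal (2 / \<epsilon>) * classical_energy C s * indicator {s..t} \<tau>" for \<tau>
  proof (cases "\<tau> \<in> {s..t}")
    case True
    have me: "(\<lambda>x. ennreal (energy_density \<tau> x) * indicator C x) \<in> borel_measurable lborel"
      using borel_measurable_continuous_times_indicator[OF C(1) C' cont_x[OF cont_energy_density]] True st by simp
    have "(\<integral>\<^sup>+x. g \<tau> x \<partial>lborel) \<le> (\<integral>\<^sup>+x. ennreal (2 / \<epsilon>) * (ennreal (energy_density \<tau> x) * indicator C x) \<partial>lborel)"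
    proof (rule nn_integral_mono)
      fix x
      have "(v \<tau> x)\<^sup>2 \<le> 2 / \<epsilon> * energy_density \<tau> x"
        using \<epsilon> W_nonneg[of "u \<tau> x"] by (simp add: energy_density_def field_simps)
      then have "ennreal ((v \<tau> x)\<^sup>2) \<le> ennreal (2 / \<epsilon>) * ennreal (energy_density \<tau> x)"
        using \<epsilon> energy_density_nonneg by (subst ennreal_mult[symmetric]) (auto intro: ennreal_leI)
      then show "g \<tau> x \<le> ennreal (2 / \<epsilon>) * (ennreal (energy_density \<tau> x) * indicator C x)"
        using True by (auto simp: g_def indicator_def)
    qed
    also have "\<dots> = ennreal (2 / \<epsilon>) * classical_energy C \<tau>"
      unfolding classical_energy_def by (rule nn_integral_cmult[OF me])
    also have "\<dots> \<le> ennreal (2 / \<epsilon>) * classical_energy C s" using mono True by (intro mult_left_mono) auto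
    finally show ?thesis using True by simp
  qed (simp add: g_def)
  have "(\<integral>\<^sup>+x. (\<integral>\<^sup>+\<tau>. g \<tau> x \<partial>lborel) \<partial>lborel) = (\<integral>\<^sup>+\<tau>. (\<integral>\<^sup>+x. g \<tau> x \<partial>lborel) \<partial>lborel)"
    by (rule lborel_pair.Fubini'[OF g_meas])
  also have "\<dots> \<le> (\<integral>\<^sup>+\<tau>. ennreal (2 / \<epsilon>) * classical_energy C s * indicator {s..t} \<tau> \<partial>lborel)"
    by (rule nn_integral_mono) (rule slice)
  also have "\<dots> = ennreal (2 / \<epsilon>) * classical_energy C s * ennreal (t - s)"
    using lt by (subst nn_integral_cmult_indicator) auto
  also have "\<dots> < \<infinity>" using fin by (simp add: ennreal_mult_less_top)
  finally have V: "(\<integral>\<^sup>+x. (\<integral>\<^sup>+\<tau>. g \<tau> x \<partial>lborel) \<partial>lborel) < \<infinity>" .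
  have mV: "(\<lambda>x. \<integral>\<^sup>+\<tau>. g \<tau> x \<partial>lborel) \<in> borel_measurable lborel"
    using lborel.borel_measurable_nn_integral[of "\<lambda>x \<tau>. g \<tau> x" lborel] measurable_pair_swap[OF g_meas]
    by simp
  have "(\<integral>\<^sup>+x. ennreal ((u t x)\<^sup>2) * indicator C x \<partial>lborel)
     \<le> (\<integral>\<^sup>+x. 2 * (ennreal ((u s x)\<^sup>2) * indicator C x) + ennreal (2 * (t - s)) * (\<integral>\<^sup>+\<tau>. g \<tau> x \<partial>lborel) \<partial>lborel)"
    by (rule nn_integral_mono) (rule pointwise)
  also have "\<dots> = 2 * (\<integral>\<^sup>+x. ennreal ((u s x)\<^sup>2) * indicator C x \<partial>lborel)
      + ennreal (2 * (t - s)) * (\<integral>\<^sup>+x. (\<integral>\<^sup>+\<tau>. g \<tau> x \<partial>lborel) \<partial>lborel)"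
    using mV st by (subst nn_integral_add) (auto simp: nn_integral_cmult)
  also have "\<dots> < \<infinity>" using us V by (simp add: ennreal_mult_less_top)
  finally show ?thesis .
qed (use us in simp)

end

section \<open>Uniqueness of weak gradients\<close>

text \<open>
  Boxes form an intersection-stable generator of the Borel sets, so the integrals over all Borel
  subsets vanish as well.
\<close>

lemma AE_0_if_box_integrals_0_on_cbox:
  fixes h :: "'a::euclidean_space \<Rightarrow> real"
  assumes int: "set_integrable lebesgue (cbox l r) h"
    and box: "\<And>a c. cbox a c \<subseteq> cbox l r \<Longrightarrow> box a c \<noteq> {} \<Longrightarrow> (LINT x:box a c|lebesgue. h x) = 0"
  shows "AE x in lebesgue. x \<in> cbox l r \<longrightarrow> h x = 0"
proof -
  \<comment> \<open>Extended by zero, \<open>h\<close> has integral zero over every box of the space, since two boxes meet in a box.\<close>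
  define hB where "hB x = indicat_real (box l r) x * h x" for x
  have AE_box: "AE x in lebesgue. x \<in> cbox l r \<longrightarrow> x \<in> box l r"
  proof (rule AE_I')
    show "cbox l r - box l r \<in> null_sets lebesgue"
      using negligible_frontier_interval[of l r] by (simp add: negligible_iff_null_sets)
  qed auto
  have "set_integrable lebesgue (box l r) h"
    by (rule set_integrable_subset[OF int]) (auto simp: box_subset_cbox)
  then have hB: "integrable lebesgue hB" by (simp add: set_integrable_def hB_def[abs_def])
  obtain h' where h': "h' \<in> borel_measurable lborel" "AE x in lborel. hB x = h' x"
    using completion_ex_borel_measurable_real[OF borel_measurable_integrable[OF hB]] by auto
  have AE': "AE x in lebesgue. hB x = h' x" using h'(2) by (rule AE_completion)
  have h'_leb: "h' \<in> borel_measurable lebesgue" using h'(1) by (rule measurable_completion)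
  have "integrable lebesgue h'"
    using hB integrable_cong_AE[OF borel_measurable_integrable[OF hB] h'_leb AE'] by simp
  then have h'_int: "integrable lborel h'" using integrable_completion[OF h'(1)] by simp
  have h'_set: "set_integrable lborel A h'" if "A \<in> sets borel" for A
    using that h'_int unfolding set_integrable_def by (intro integrable_mult_indicator) auto
  have on_box: "(LINT x:box a c|lborel. h' x) = 0" for a c
  proof -
    obtain a' c' where ac: "box a c \<inter> box l r = box a' c'" using box_Int_box[of a c l r] by blast
    have "(LINT x:box a c|lborel. h' x) = (LINT x:box a c|lebesgue. h' x)"
      unfolding set_lebesgue_integral_def using h'(1) by (intro integral_completion[symmetric]) auto
    also have "\<dots> = (LINT x:box a c|lebesgue. hB x)"
      unfolding set_lebesgue_integral_def
    proof (rule integral_cong_AE)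
      show "(\<lambda>x. indicat_real (box a c) x *\<^sub>R h' x) \<in> borel_measurable lebesgue"
        using h'_leb by (intro borel_measurable_scaleR borel_measurable_indicator) auto
      show "(\<lambda>x. indicat_real (box a c) x *\<^sub>R hB x) \<in> borel_measurable lebesgue"
        using borel_measurable_integrable[OF hB] by (intro borel_measurable_scaleR borel_measurable_indicator) auto
    qed (use AE' in auto)
    also have "\<dots> = (LINT x:box a' c'|lebesgue. h x)"
      unfolding set_lebesgue_integral_def hB_def ac[symmetric] by (intro Bochner_Integration.integral_cong) (auto simp: indicator_def)
    also have "\<dots> = 0"
    proof (cases "box a' c' = {}")
      case False
      then have "closure (box a' c') = cbox a' c'" by (rule closure_box)
      moreover have "closure (box a' c') \<subseteq> cbox l r"
        using ac box_subset_cbox[of l r] by (intro closure_minimal) auto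
      ultimately show ?thesis using box[of a' c'] False by simp
    qed (simp add: set_lebesgue_integral_def)
    finally show ?thesis .
  qed
  have "(LINT x:A|lborel. h' x) = 0" if "A \<in> sets borel" for A
  proof -
    have stable: "Int_stable (range (\<lambda>(a, b). box a b :: 'a set))"
      unfolding Int_stable_def by (auto simp: box_Int_box)
    have A: "A \<in> sigma_sets UNIV (range (\<lambda>(a, b). box a b :: 'a set))"
      using that unfolding borel_eq_box by simp
    have sub: "range (\<lambda>(a, b). box a b :: 'a set) \<subseteq> Pow UNIV" by simp
    from stable sub A show ?thesis
    proof (induct rule: sigma_sets_induct_disjoint)
      case (compl A)
      then have Ab: "A \<in> sets borel" unfolding borel_eq_box by simp
      have "(LINT x:UNIV|lborel. h' x) = (LINT x:box l r|lborel. h' x)"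
        unfolding set_lebesgue_integral_def using h' h'(2)
        by (intro integral_cong_AE) (auto simp: hB_def indicator_def)
      also have "\<dots> = 0" by (rule on_box)
      finally have U: "(LINT x:UNIV|lborel. h' x) = 0" .
      have "(LINT x:A \<union> (UNIV - A)|lborel. h' x) = (LINT x:A|lborel. h' x) + (LINT x:UNIV - A|lborel. h' x)"
        using Ab by (intro set_integral_Un h'_set) auto
      then show ?case using U compl by simp
    next
      case (union A)
      then have Ab: "A i \<in> sets borel" for i unfolding borel_eq_box by auto
      have "(LINT x:(\<Union>i. A i)|lborel. h' x) = (\<Sum>i. (LINT x:(A i)|lborel. h' x))"
        using union Ab by (intro lebesgue_integral_countable_add h'_set) (auto simp: disjoint_family_on_def)
      then show ?case using union by simp
    next
      case empty
      show ?case by (simp add: set_lebesgue_integral_def)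
    qed (auto simp: on_box)
  qed
  then have "AE x in lborel. h' x = 0" using density_unique_real[OF h'_int, of "\<lambda>x. 0"] by simp
  with h'(2) have "AE x in lborel. hB x = 0" by eventually_elim simp
  then have "AE x in lebesgue. hB x = 0" by (rule AE_completion)
  with AE_box show ?thesis by eventually_elim (auto simp: hB_def)
qed

lemma AE_0_if_box_integrals_0:
  fixes h :: "'a::euclidean_space \<Rightarrow> real"
  assumes G: "open G"
    and int: "\<And>a c. cbox a c \<subseteq> G \<Longrightarrow> set_integrable lebesgue (cbox a c) h"
    and box: "\<And>a c. cbox a c \<subseteq> G \<Longrightarrow> box a c \<noteq> {} \<Longrightarrow> (LINT x:box a c|lebesgue. h x) = 0"
  shows "AE x in lebesgue. x \<in> G \<longrightarrow> h x = 0"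
proof -
  obtain \<D> where \<D>: "countable \<D>" "\<D> \<subseteq> Pow G" "\<And>B. B \<in> \<D> \<Longrightarrow> \<exists>a b. B = cbox a b" "\<Union>\<D> = G"
    using open_countable_Union_open_cbox[OF G] by metis
  have "AE x in lebesgue. x \<in> B \<longrightarrow> h x = 0" if "B \<in> \<D>" for B
  proof -
    obtain l r where B: "B = cbox l r" using \<D>(3)[OF \<open>B \<in> \<D>\<close>] by blast
    then have "cbox l r \<subseteq> G" using \<D>(2) that by auto
    then show ?thesis unfolding B using int box by (intro AE_0_if_box_integrals_0_on_cbox) auto
  qed
  then have "AE x in lebesgue. \<forall>B\<in>\<D>. x \<in> B \<longrightarrow> h x = 0" by (subst AE_ball_countable[OF \<D>(1)]) blast
  then show ?thesis by eventually_elim (use \<D>(4) in auto)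
qed

text \<open>
  If \<open>\<psi> b\<close> is positive exactly on the \<open>b\<close>-th edge of a box, the functions \<open>\<phi> k\<close> approximate
  the indicator of the box: the sum counts the coordinates that fail to be well inside, and the outer
  \<open>step\<close> returns \<open>0\<close> as soon as one fails completely. A sum is easier to differentiate than the
  product of the one-dimensional bumps.
\<close>

lemma box_bump:
  fixes \<psi> \<psi>' :: "'a::euclidean_space \<Rightarrow> real \<Rightarrow> real"
  assumes \<psi>: "\<And>b z. (\<psi> b has_real_derivative \<psi>' b z) (at z)" "\<And>b. continuous_on UNIV (\<psi>' b)"
  defines "\<phi> \<equiv> \<lambda>(k::nat) x. step (1 - (\<Sum>b\<in>Basis. 1 - step (real k * \<psi> b (x \<bullet> b))))"
  shows "C1 (\<phi> k)" and "\<bar>\<phi> k x\<bar> \<le> 1"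
    and "\<exists>b\<in>Basis. \<psi> b (x \<bullet> b) \<le> 0 \<Longrightarrow> \<phi> k x = 0"
    and "\<forall>b\<in>Basis. \<psi> b (x \<bullet> b) > 0 \<Longrightarrow> (\<lambda>k. \<phi> k x) \<longlonglongrightarrow> 1"
proof -
  define s where "s x = 1 - (\<Sum>b\<in>Basis. 1 - step (real k * \<psi> b (x \<bullet> b)))" for x
  define D where "D x = (\<Sum>b\<in>Basis. (step' (real k * \<psi> b (x \<bullet> b)) * (real k * \<psi>' b (x \<bullet> b))) *\<^sub>R b)" for x
  have s: "GDERIV s x :> D x" for x
  proof -
    have "((\<lambda>x. step (real k * \<psi> b (x \<bullet> b))) has_derivative (\<lambda>h. h \<bullet> ((step' (real k * \<psi> b (x \<bullet> b)) * (real k * \<psi>' b (x \<bullet> b))) *\<^sub>R b))) (at x)" for b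
    proof -
      have "GDERIV (\<lambda>x. x \<bullet> b) x :> b" unfolding gderiv_def by (auto intro!: derivative_eq_intros)
      from GDERIV_compose[OF this DERIV_chain2[OF step_deriv DERIV_cmult[OF \<psi>(1)]]]
      show ?thesis by (simp add: gderiv_def)
    qed
    then have "(s has_derivative (\<lambda>h. 0 - (\<Sum>b\<in>Basis. 0 - h \<bullet> ((step' (real k * \<psi> b (x \<bullet> b)) * (real k * \<psi>' b (x \<bullet> b))) *\<^sub>R b)))) (at x)"
      unfolding s_def by (intro has_derivative_diff has_derivative_const has_derivative_sum)
    then show ?thesis
      unfolding gderiv_def D_def inner_sum_right by (simp add: sum_negf)
  qed
  have c\<psi>: "continuous_on A (\<psi> b)" for A b
    using \<psi>(1) DERIV_isCont by (intro continuous_at_imp_continuous_on) blast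
  have cD: "continuous_on UNIV D"
    unfolding D_def by (intro continuous_intros continuous_on_compose2[OF continuous_on_step'[of UNIV]]
        continuous_on_compose2[OF c\<psi>[of UNIV]] continuous_on_compose2[OF \<psi>(2)]) auto
  have "GDERIV (\<lambda>x. step (s x)) x :> step' (s x) *\<^sub>R D x" for x
    by (rule GDERIV_compose[OF s step_deriv])
  moreover have "continuous_on UNIV (\<lambda>x. step' (s x) *\<^sub>R D x)"
    by (intro continuous_intros cD continuous_on_compose2[OF continuous_on_step'[of UNIV]] GDERIV_continuous_on[OF s]) auto
  moreover have "\<phi> k = (\<lambda>x. step (s x))" by (simp add: \<phi>_def s_def)
  ultimately show "C1 (\<phi> k)" unfolding C1_def by auto
  show "\<bar>\<phi> k x\<bar> \<le> 1" using step_bounds by (simp add: \<phi>_def)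
  show "\<phi> k x = 0" if np: "\<exists>b\<in>Basis. \<psi> b (x \<bullet> b) \<le> 0"
  proof -
    obtain b where b: "b \<in> Basis" "\<psi> b (x \<bullet> b) \<le> 0" using np by auto
    have "step (real k * \<psi> b (x \<bullet> b)) = 0" using b by (intro step_eq_0 mult_nonneg_nonpos) auto
    then have "1 = 1 - step (real k * \<psi> b (x \<bullet> b))" by simp
    also have "\<dots> \<le> (\<Sum>b\<in>Basis. 1 - step (real k * \<psi> b (x \<bullet> b)))"
      using step_bounds b by (intro member_le_sum) auto
    finally show ?thesis unfolding \<phi>_def by (intro step_eq_0) simp
  qed
  show "(\<lambda>k. \<phi> k x) \<longlonglongrightarrow> 1" if pos: "\<forall>b\<in>Basis. \<psi> b (x \<bullet> b) > 0"
  proof (rule tendsto_eventually)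
    have "\<forall>b\<in>Basis. \<forall>\<^sub>F k in sequentially. 1 / \<psi> b (x \<bullet> b) \<le> real k"
      using filterlim_real_sequentially by (auto simp: filterlim_at_top)
    then have "\<forall>\<^sub>F k in sequentially. \<forall>b\<in>Basis. 1 / \<psi> b (x \<bullet> b) \<le> real k"
      by (simp add: eventually_ball_finite)
    then show "\<forall>\<^sub>F k in sequentially. \<phi> k x = 1"
    proof eventually_elim
      case (elim k)
      then have "step (real k * \<psi> b (x \<bullet> b)) = 1" if "b \<in> Basis" for b
        using pos that by (intro step_eq_1) (simp add: divide_le_eq)
      then show ?case by (simp add: \<phi>_def step_eq_1)
    qed
  qed
qed

text \<open>
  The open part of the cell, equal to it up to a null set. Uniqueness of weak gradients is tested on
  boxes inside it.
\<close>

fun cell_interior :: "'a::euclidean_space spatial_domain \<Rightarrow> 'a set" where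
  "cell_interior (Euclidean \<Omega>) = \<Omega>"
| "cell_interior (Flat_Torus L) = box 0 L"

lemma cell_interior:
  assumes "is_domain X"
  shows "open (cell_interior X)" "cell_interior X \<subseteq> cell X" "cell X \<in> sets borel" "open (points X)"
    "cell X \<subseteq> points X" "AE x in lebesgue. x \<in> cell X \<longrightarrow> x \<in> cell_interior X"
proof -
  have "open (cell_interior X) \<and> cell_interior X \<subseteq> cell X \<and> cell X \<in> sets borel \<and> open (points X) \<and>
    cell X \<subseteq> points X \<and> (AE x in lebesgue. x \<in> cell X \<longrightarrow> x \<in> cell_interior X)"
  proof (cases X)
    case (Euclidean \<Omega>)
    then show ?thesis using assms by auto
  next
    case (Flat_Torus L)
    have "AE x in lebesgue. x \<in> cell X \<longrightarrow> x \<in> cell_interior X"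
    proof (rule AE_I')
      show "cbox 0 L - box 0 L \<in> null_sets lebesgue"
        using negligible_frontier_interval[of 0 L] by (simp add: negligible_iff_null_sets)
    qed (use cell_torus_subset_cbox[of L] Flat_Torus in auto)
    moreover have "box 0 L \<subseteq> cell X" using Flat_Torus by (auto simp: mem_box less_imp_le)
    ultimately show ?thesis using Flat_Torus borel_cell_torus[of L] by (simp del: cell.simps) auto
  qed
  then show "open (cell_interior X)" "cell_interior X \<subseteq> cell X" "cell X \<in> sets borel" "open (points X)"
    "cell X \<subseteq> points X" "AE x in lebesgue. x \<in> cell X \<longrightarrow> x \<in> cell_interior X" by auto
qed

text \<open>
  In the Euclidean case \<open>\<psi> b\<close> is the quadratic polynomial with zeros \<open>a \<bullet> b\<close> and
  \<open>c \<bullet> b\<close>. On the torus its analogue is a product of two sines: shifting the argument by a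
  period changes the sign of both factors, so the product is periodic, and on one period it is
  positive exactly between \<open>a \<bullet> b\<close> and \<open>c \<bullet> b\<close>.
\<close>

lemma test_functions_approximate_box:
  fixes X :: "'a::euclidean_space spatial_domain"
  assumes X: "is_domain X" and ac: "cbox a c \<subseteq> cell_interior X" "box a c \<noteq> {}"
  obtains \<phi> :: "nat \<Rightarrow> 'a \<Rightarrow> real" where
    "\<And>k. \<phi> k \<in> test_functions X" "\<And>k x. \<bar>\<phi> k x\<bar> \<le> 1" "\<And>k x. x \<in> cell X - box a c \<Longrightarrow> \<phi> k x = 0"
    "\<And>x. x \<in> box a c \<Longrightarrow> (\<lambda>k. \<phi> k x) \<longlonglongrightarrow> 1"
proof (cases X)
  case (Euclidean \<Omega>)
  define \<psi> where "\<psi> b z = (z - a \<bullet> b) * (c \<bullet> b - z)" for b z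
  define \<psi>' where "\<psi>' b z = (c \<bullet> b - z) - (z - a \<bullet> b)" for b z
  have d: "(\<psi> b has_real_derivative \<psi>' b z) (at z)" for b z
    unfolding \<psi>_def \<psi>'_def by (auto intro!: derivative_eq_intros)
  have c: "continuous_on UNIV (\<psi>' b)" for b unfolding \<psi>'_def by (intro continuous_intros)
  note bump = box_bump[of \<psi> \<psi>', OF d c]
  define \<phi> where "\<phi> k x = step (1 - (\<Sum>b\<in>Basis. 1 - step (real k * \<psi> b (x \<bullet> b))))" for k :: nat and x
  have le: "a \<bullet> b < c \<bullet> b" if "b \<in> Basis" for b using ac(2) that by (auto simp: box_ne_empty)
  have out: "\<exists>b\<in>Basis. \<psi> b (x \<bullet> b) \<le> 0" if x: "x \<notin> box a c" for x
  proof -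
    obtain b where "b \<in> Basis" "\<not> (a \<bullet> b < x \<bullet> b \<and> x \<bullet> b < c \<bullet> b)" using x by (auto simp: mem_box)
    then show ?thesis using le[of b] by (intro bexI[of _ b]) (auto simp: \<psi>_def mult_le_0_iff)
  qed
  have zero: "\<phi> k x = 0" if "x \<notin> box a c" for k x
    using bump(3)[OF out[OF that]] by (simp add: \<phi>_def)
  show ?thesis
  proof (rule that[of \<phi>])
    show "\<phi> k \<in> test_functions X" for k
    proof -
      have sub: "{x. \<phi> k x \<noteq> 0} \<subseteq> cbox a c" using zero box_subset_cbox by blast
      have "closure {x. \<phi> k x \<noteq> 0} \<subseteq> cbox a c" by (rule closure_minimal[OF sub closed_cbox])
      moreover have "compact (closure {x. \<phi> k x \<noteq> 0})"
        using bounded_subset[OF bounded_cbox sub] by (simp add: compact_closure)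
      moreover have "C1 (\<phi> k)" using bump(1)[of k] by (simp add: \<phi>_def[abs_def])
      ultimately show ?thesis using Euclidean ac(1) by auto
    qed
    show "\<bar>\<phi> k x\<bar> \<le> 1" for k x using bump(2) by (simp add: \<phi>_def)
    show "\<phi> k x = 0" if "x \<in> cell X - box a c" for k x using zero that by auto
    show "(\<lambda>k. \<phi> k x) \<longlonglongrightarrow> 1" if "x \<in> box a c" for x
      using bump(4)[of x] that by (auto simp: \<phi>_def \<psi>_def mem_box)
  qed
next
  case (Flat_Torus L)
  define \<kappa> where "\<kappa> b = pi / (L \<bullet> b)" for b
  define \<psi> where "\<psi> b z = sin (\<kappa> b * (z - a \<bullet> b)) * sin (\<kappa> b * (c \<bullet> b - z))" for b z
  define \<psi>' where "\<psi>' b z = \<kappa> b * cos (\<kappa> b * (z - a \<bullet> b)) * sin (\<kappa> b * (c \<bullet> b - z))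
     - sin (\<kappa> b * (z - a \<bullet> b)) * (\<kappa> b * cos (\<kappa> b * (c \<bullet> b - z)))" for b z
  have L: "L \<bullet> b > 0" if "b \<in> Basis" for b using X Flat_Torus that by simp
  have d: "(\<psi> b has_real_derivative \<psi>' b z) (at z)" for b z
    unfolding \<psi>_def \<psi>'_def by (rule derivative_eq_intros refl)+ (simp add: algebra_simps)
  have c: "continuous_on UNIV (\<psi>' b)" for b
    unfolding \<psi>'_def by (intro continuous_intros)
  note bump = box_bump[of \<psi> \<psi>', OF d c]
  define \<phi> where "\<phi> k x = step (1 - (\<Sum>b\<in>Basis. 1 - step (real k * \<psi> b (x \<bullet> b))))" for k :: nat and x
  have le: "a \<bullet> b < c \<bullet> b" if "b \<in> Basis" for b using ac(2) that by (auto simp: box_ne_empty)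
  have bds: "0 < a \<bullet> b" "c \<bullet> b < L \<bullet> b" if b: "b \<in> Basis" for b
  proof -
    have "a \<in> cbox a c" "c \<in> cbox a c" using le by (auto simp: mem_box less_imp_le)
    then have "a \<in> box 0 L" "c \<in> box 0 L" using ac(1) Flat_Torus by auto
    then show "0 < a \<bullet> b" "c \<bullet> b < L \<bullet> b" using b by (auto simp: mem_box)
  qed
  have sin_pos: "sin (\<kappa> b * y) > 0" if "b \<in> Basis" "0 < y" "y < L \<bullet> b" for b y
    using L[OF that(1)] that by (intro sin_gt_zero) (auto simp: \<kappa>_def field_simps)
  have sin_nn: "sin (\<kappa> b * y) \<ge> 0" if "b \<in> Basis" "0 \<le> y" "y \<le> L \<bullet> b" for b y
    using L[OF that(1)] that by (intro sin_ge_zero) (auto simp: \<kappa>_def field_simps)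
  have sin_np: "sin (\<kappa> b * y) \<le> 0" if "b \<in> Basis" "- (L \<bullet> b) \<le> y" "y \<le> 0" for b y
    using sin_nn[OF that(1), of "- y"] that by simp
  have out: "\<exists>b\<in>Basis. \<psi> b (x \<bullet> b) \<le> 0" if x: "x \<in> cell X - box a c" for x
  proof -
    obtain b where b: "b \<in> Basis" "\<not> (a \<bullet> b < x \<bullet> b \<and> x \<bullet> b < c \<bullet> b)" using x by (auto simp: mem_box)
    have x0: "0 \<le> x \<bullet> b" "x \<bullet> b < L \<bullet> b" using x b Flat_Torus by auto
    have "\<psi> b (x \<bullet> b) \<le> 0"
    proof (cases "x \<bullet> b \<le> a \<bullet> b")
      case True
      then show ?thesis unfolding \<psi>_def using x0 b(1) le[OF b(1)] bds[OF b(1)]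
        by (intro mult_nonpos_nonneg sin_np sin_nn) auto
    next
      case False
      then show ?thesis unfolding \<psi>_def using x0 b le[OF b(1)] bds[OF b(1)]
        by (intro mult_nonneg_nonpos sin_np sin_nn) auto
    qed
    then show ?thesis using b by blast
  qed
  have per: "\<psi> b (z + L \<bullet> b) = \<psi> b z" if b: "b \<in> Basis" for b z
  proof -
    have "\<kappa> b * (z + L \<bullet> b - a \<bullet> b) = \<kappa> b * (z - a \<bullet> b) + pi"
      "\<kappa> b * (c \<bullet> b - (z + L \<bullet> b)) = \<kappa> b * (c \<bullet> b - z) - pi"
      using L[OF b] by (simp_all add: \<kappa>_def field_simps)
    then show ?thesis by (simp add: \<psi>_def sin_diff)
  qed
  show ?thesis
  proof (rule that[of \<phi>])
    show "\<phi> k \<in> test_functions X" for k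
    proof -
      have "\<phi> k (x + (L \<bullet> i) *\<^sub>R i) = \<phi> k x" if i: "i \<in> Basis" for x i
      proof -
        have "\<psi> b ((x + (L \<bullet> i) *\<^sub>R i) \<bullet> b) = \<psi> b (x \<bullet> b)" if b: "b \<in> Basis" for b
          using per[OF b, of "x \<bullet> b"] i b by (cases "b = i") (auto simp: inner_add_left inner_Basis)
        then show ?thesis by (simp add: \<phi>_def)
      qed
      moreover have "C1 (\<phi> k)" using bump(1)[of k] by (simp add: \<phi>_def[abs_def])
      ultimately show ?thesis using Flat_Torus by auto
    qed
    show "\<bar>\<phi> k x\<bar> \<le> 1" for k x using bump(2) by (simp add: \<phi>_def)
    show "\<phi> k x = 0" if "x \<in> cell X - box a c" for k x using bump(3)[OF out[OF that]] by (simp add: \<phi>_def)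
    show "(\<lambda>k. \<phi> k x) \<longlonglongrightarrow> 1" if x: "x \<in> box a c" for x
    proof -
      have "\<psi> b (x \<bullet> b) > 0" if b: "b \<in> Basis" for b
      proof -
        have "a \<bullet> b < x \<bullet> b" "x \<bullet> b < c \<bullet> b" using x b by (auto simp: mem_box)
        then show ?thesis unfolding \<psi>_def using b bds[OF b] by (intro mult_pos_pos sin_pos) auto
      qed
      then show ?thesis using bump(4)[of x] by (simp add: \<phi>_def)
    qed
  qed
qed

text \<open>
  The difference of two weak gradients is orthogonal to all test functions. These approximate
  indicators of boxes boundedly, so its integral over every box is zero.
\<close>

lemma weak_gradient_unique:
  fixes X :: "'a::euclidean_space spatial_domain"
  assumes X: "is_domain X" and g: "has_weak_gradient X f g" and p: "has_weak_gradient X f p"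
    and int: "\<And>a c. cbox a c \<subseteq> cell_interior X \<Longrightarrow> set_integrable lebesgue (cbox a c) g"
      "\<And>a c. cbox a c \<subseteq> cell_interior X \<Longrightarrow> set_integrable lebesgue (cbox a c) p"
  shows "AE x in lebesgue. x \<in> cell X \<longrightarrow> g x = p x"
proof -
  note ci = cell_interior[OF X]
  have "AE x in lebesgue. x \<in> cell_interior X \<longrightarrow> (g x - p x) \<bullet> b = 0" if b: "b \<in> Basis" for b
  proof (rule AE_0_if_box_integrals_0[OF ci(1)])
    fix a c assume sub: "cbox a c \<subseteq> cell_interior X"
    have cb: "set_integrable lebesgue (cbox a c) (\<lambda>x. g x - p x)"
      using int[OF sub] by (rule set_integral_diff(1))
    show "set_integrable lebesgue (cbox a c) (\<lambda>x. (g x - p x) \<bullet> b)"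
      using integrable_inner_left[OF cb[unfolded set_integrable_def], of b]
      by (simp add: set_integrable_def)
    assume ne: "box a c \<noteq> {}"
    obtain \<phi> where \<phi>: "\<And>k. \<phi> k \<in> test_functions X" "\<And>k x. \<bar>\<phi> k x\<bar> \<le> 1" "\<And>k x. x \<in> cell X - box a c \<Longrightarrow> \<phi> k x = 0"
      "\<And>x. x \<in> box a c \<Longrightarrow> (\<lambda>k. \<phi> k x) \<longlonglongrightarrow> 1"
      using test_functions_approximate_box[OF X sub ne] by blast
    have bc: "box a c \<subseteq> cell X" using sub box_subset_cbox ci(2) by blast
    have ib: "set_integrable lebesgue (box a c) g" "set_integrable lebesgue (box a c) p"
      by (rule set_integrable_subset[OF int(1)[OF sub]] set_integrable_subset[OF int(2)[OF sub]]; simp add: box_subset_cbox)+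
    have m\<phi>: "\<phi> k \<in> borel_measurable lebesgue" for k
    proof -
      have "C1 (\<phi> k)" using \<phi>(1)[of k] by (cases X) auto
      then obtain D where "\<And>x. GDERIV (\<phi> k) x :> D x" by (auto simp: C1_def)
      then have "continuous_on UNIV (\<phi> k)" by (rule GDERIV_continuous_on)
      then show ?thesis by (intro measurable_completion) (simp add: borel_measurable_continuous_onI)
    qed
    have i\<phi>: "set_integrable lebesgue (box a c) (\<lambda>x. \<phi> k x *\<^sub>R w x)" if "set_integrable lebesgue (box a c) w" for k and w :: "'a \<Rightarrow> 'a"
      unfolding set_integrable_def
    proof (rule Bochner_Integration.integrable_bound[OF that[unfolded set_integrable_def]])
      have "(\<lambda>x. \<phi> k x *\<^sub>R (indicat_real (box a c) x *\<^sub>R w x)) \<in> borel_measurable lebesgue"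
        using m\<phi> borel_measurable_integrable[OF that[unfolded set_integrable_def]] by (rule borel_measurable_scaleR)
      then show "(\<lambda>x. indicat_real (box a c) x *\<^sub>R \<phi> k x *\<^sub>R w x) \<in> borel_measurable lebesgue"
        by (simp add: mult.commute)
      show "AE x in lebesgue. norm (indicat_real (box a c) x *\<^sub>R \<phi> k x *\<^sub>R w x) \<le> norm (indicat_real (box a c) x *\<^sub>R w x)"
        using \<phi>(2) by (intro AE_I2) (auto simp: indicator_def mult_left_le_one_le)
    qed
    have conv: "(\<integral>x. \<phi> k x *\<^sub>R w x \<partial>lebesgue_on (cell X)) = (LINT x:box a c|lebesgue. \<phi> k x *\<^sub>R w x)" for k and w :: "'a \<Rightarrow> 'a"
      using ci(3) bc \<phi>(3)[of _ k] unfolding set_lebesgue_integral_def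
      by (subst integral_restrict_space) (auto simp: indicator_def intro!: Bochner_Integration.integral_cong)
    have test: "(LINT x:box a c|lebesgue. \<phi> k x * ((g x - p x) \<bullet> b)) = 0" for k
    proof -
      have "(\<integral>x. \<phi> k x *\<^sub>R g x \<partial>lebesgue_on (cell X)) = (\<integral>x. \<phi> k x *\<^sub>R p x \<partial>lebesgue_on (cell X))"
        using g p \<phi>(1)[of k] unfolding has_weak_gradient_def by (metis neg_equal_iff_equal)
      then have "(LINT x:box a c|lebesgue. \<phi> k x *\<^sub>R g x - \<phi> k x *\<^sub>R p x) = 0"
        using set_integral_diff(2)[OF i\<phi>[OF ib(1)] i\<phi>[OF ib(2)]] by (simp add: conv)
      moreover have "integrable lebesgue (\<lambda>x. indicat_real (box a c) x *\<^sub>R (\<phi> k x *\<^sub>R g x - \<phi> k x *\<^sub>R p x))"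
        using set_integral_diff(1)[OF i\<phi>[OF ib(1)] i\<phi>[OF ib(2)]] by (simp add: set_integrable_def)
      ultimately have "(LINT x|lebesgue. (indicat_real (box a c) x *\<^sub>R (\<phi> k x *\<^sub>R g x - \<phi> k x *\<^sub>R p x)) \<bullet> b) = 0"
        by (subst integral_inner_left) (auto simp: set_lebesgue_integral_def)
      then show ?thesis by (simp add: set_lebesgue_integral_def inner_diff_left algebra_simps)
    qed
    have "(\<lambda>k. LINT x:box a c|lebesgue. \<phi> k x * ((g x - p x) \<bullet> b)) \<longlonglongrightarrow> (LINT x:box a c|lebesgue. (g x - p x) \<bullet> b)"
      unfolding set_lebesgue_integral_def
    proof (rule integral_dominated_convergence)
      have i: "integrable lebesgue (\<lambda>x. indicat_real (box a c) x *\<^sub>R ((g x - p x) \<bullet> b))"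
        using integrable_inner_left[OF set_integral_diff(1)[OF ib, unfolded set_integrable_def], of b] by simp
      then show "integrable lebesgue (\<lambda>x. norm (indicat_real (box a c) x *\<^sub>R ((g x - p x) \<bullet> b)))" by (rule integrable_norm)
      from borel_measurable_integrable[OF i]
      show m: "(\<lambda>x. indicat_real (box a c) x *\<^sub>R ((g x - p x) \<bullet> b)) \<in> borel_measurable lebesgue" .
      show "(\<lambda>x. indicat_real (box a c) x *\<^sub>R (\<phi> k x * ((g x - p x) \<bullet> b))) \<in> borel_measurable lebesgue" for k
        using borel_measurable_times[OF m\<phi>[of k] m] by (simp add: mult.left_commute)
      show "AE x in lebesgue. norm (indicat_real (box a c) x *\<^sub>R (\<phi> k x * ((g x - p x) \<bullet> b))) \<le> norm (indicat_real (box a c) x *\<^sub>R ((g x - p x) \<bullet> b))" for k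
        using \<phi>(2) by (intro AE_I2) (auto simp: indicator_def abs_mult mult_left_le_one_le)
      show "AE x in lebesgue. (\<lambda>k. indicat_real (box a c) x *\<^sub>R (\<phi> k x * ((g x - p x) \<bullet> b))) \<longlonglongrightarrow> indicat_real (box a c) x *\<^sub>R ((g x - p x) \<bullet> b)"
      proof (rule AE_I2)
        fix x
        show "(\<lambda>k. indicat_real (box a c) x *\<^sub>R (\<phi> k x * ((g x - p x) \<bullet> b))) \<longlonglongrightarrow> indicat_real (box a c) x *\<^sub>R ((g x - p x) \<bullet> b)"
        proof (cases "x \<in> box a c")
          case True
          then have "(\<lambda>k. \<phi> k x * ((g x - p x) \<bullet> b)) \<longlonglongrightarrow> 1 * ((g x - p x) \<bullet> b)" using \<phi>(4) by (intro tendsto_intros) auto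
          then show ?thesis using True by simp
        qed simp
      qed
    qed
    then show "(LINT x:box a c|lebesgue. (g x - p x) \<bullet> b) = 0" by (simp add: test LIMSEQ_const_iff)
  qed
  then have "AE x in lebesgue. \<forall>b\<in>Basis. x \<in> cell_interior X \<longrightarrow> (g x - p x) \<bullet> b = 0" by (subst AE_finite_all) auto
  with ci(6) show ?thesis
    by eventually_elim (metis euclidean_all_zero_iff right_minus_eq)
qed

text \<open>
  \<open>norm (g x)\<close> is dominated by \<open>(norm (g x))\<^sup>2 + 1\<close>.
\<close>

lemma L2_locally_integrable:
  assumes X: "is_domain X" and g: "g \<in> L2 X" and sub: "cbox a c \<subseteq> cell_interior X"
  shows "set_integrable lebesgue (cbox a c) g"
proof -
  note ci = cell_interior[OF X]
  have C: "cell X \<in> sets lebesgue" using ci(3) by simp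
  have sub': "cbox a c \<subseteq> cell X" using sub ci(2) by blast
  have m: "(\<lambda>x. indicat_real (cell X) x *\<^sub>R g x) \<in> borel_measurable lebesgue"
  proof (rule borel_measurable_restrict_space_iff[THEN iffD1])
    show "cell X \<inter> space lebesgue \<in> sets lebesgue" using C by simp
    show "g \<in> borel_measurable (lebesgue_on (cell X))" using g by (simp add: L2_def)
  qed
  have "set_integrable lebesgue (cell X) (\<lambda>x. (norm (g x))\<^sup>2)"
    using g C by (simp add: L2_def integrable_restrict_space set_integrable_def)
  then have "set_integrable lebesgue (cbox a c) (\<lambda>x. (norm (g x))\<^sup>2)"
    by (rule set_integrable_subset) (use sub' in auto)
  moreover have "set_integrable lebesgue (cbox a c) (\<lambda>x. 1::real)"
    unfolding set_integrable_def using emeasure_lborel_cbox_finite[of a c]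
    by (simp add: integrable_indicator_iff emeasure_completion less_top)
  ultimately have i: "set_integrable lebesgue (cbox a c) (\<lambda>x. (norm (g x))\<^sup>2 + 1)" by (rule set_integral_add(1))
  show ?thesis
    unfolding set_integrable_def
  proof (rule Bochner_Integration.integrable_bound[OF i[unfolded set_integrable_def]])
    have "(\<lambda>x. indicat_real (cbox a c) x *\<^sub>R (indicat_real (cell X) x *\<^sub>R g x)) \<in> borel_measurable lebesgue"
      by (rule borel_measurable_scaleR[OF borel_measurable_indicator m]) simp
    moreover have "indicat_real (cbox a c) x *\<^sub>R (indicat_real (cell X) x *\<^sub>R g x) = indicat_real (cbox a c) x *\<^sub>R g x" for x
      using sub' by (auto simp: indicator_def)
    ultimately show "(\<lambda>x. indicat_real (cbox a c) x *\<^sub>R g x) \<in> borel_measurable lebesgue" by (simp only:)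
    have "y \<le> y\<^sup>2 + 1" for y :: real
    proof -
      have "2 * y \<le> y\<^sup>2 + 1" using zero_le_power2[of "y - 1"] by (simp add: power2_diff)
      then show ?thesis using zero_le_power2[of y] by linarith
    qed
    then show "AE x in lebesgue. norm (indicat_real (cbox a c) x *\<^sub>R g x) \<le> norm (indicat_real (cbox a c) x *\<^sub>R ((norm (g x))\<^sup>2 + 1))"
      by (intro AE_I2) (auto simp: indicator_def)
  qed
qed

section \<open>The total energy\<close>

lemma lebesgue_on_integral_cont:
  fixes f :: "'a::euclidean_space \<Rightarrow> 'b::euclidean_space"
  assumes C: "C \<in> sets borel" and f: "continuous_on C f"
  shows "integral\<^sup>L (lebesgue_on C) f = (LINT x:C|lborel. f x)"
proof -
  have "(\<lambda>x. indicat_real C x *\<^sub>R f x) \<in> borel_measurable borel"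
    using C f by (rule borel_measurable_continuous_on_indicator)
  then show ?thesis
    using C unfolding set_lebesgue_integral_def by (subst integral_restrict_space) (auto simp: integral_completion)
qed

lemma lebesgue_on_nn_integral:
  assumes "C \<in> sets borel"
  shows "nn_integral (lebesgue_on C) g = (\<integral>\<^sup>+x. g x * indicator C x \<partial>lborel)"
  using assms by (subst nn_integral_restrict_space) (auto simp: nn_integral_completion)

lemma L2_iff_finite_square_integral:
  fixes f :: "'a::euclidean_space \<Rightarrow> 'b::euclidean_space"
  assumes C: "cell X \<in> sets borel" and f: "continuous_on (cell X) f"
  shows "f \<in> L2 X \<longleftrightarrow> (\<integral>\<^sup>+x. ennreal ((norm (f x))\<^sup>2) * indicator (cell X) x \<partial>lborel) < \<infinity>"
proof -
  have ind: "(\<lambda>x. indicat_real (cell X) x *\<^sub>R f x) \<in> borel_measurable borel"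
    using C f by (rule borel_measurable_continuous_on_indicator)
  have m: "f \<in> borel_measurable (lebesgue_on (cell X))"
  proof (rule borel_measurable_restrict_space_iff[THEN iffD2])
    show "cell X \<inter> space lebesgue \<in> sets lebesgue" using C by simp
    show "(\<lambda>x. indicat_real (cell X) x *\<^sub>R f x) \<in> borel_measurable lebesgue"
      using ind by (intro measurable_completion) simp
  qed
  then have "(\<lambda>x. (norm (f x))\<^sup>2) \<in> borel_measurable (lebesgue_on (cell X))" by measurable
  then show ?thesis
    using m by (simp add: L2_def integrable_iff_bounded lebesgue_on_nn_integral[OF C] del: cell.simps)
qed

context C2_data
begin

lemma islimpt_frontier: "x \<in> frontier \<Omega> \<Longrightarrow> at x within \<Omega> \<noteq> bot"
  using \<Omega> by (auto simp: frontier_def interior_open closure_def trivial_limit_within)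

text \<open>
  The limit of the gradient from inside is its continuous extension \<open>p\<close>, and the normal is unique.
\<close>

lemma normal_deriv_eq:
  assumes t: "t > 0" and x: "x \<in> frontier \<Omega>" and \<nu>: "outer_unit_normal \<Omega> x \<nu>"
  shows "normal_deriv \<Omega> (u t) x = p t x \<bullet> \<nu>"
proof -
  have "(THE \<nu>. outer_unit_normal \<Omega> x \<nu>) = \<nu>"
    using \<nu> outer_unit_normal_unique[OF \<Omega> x] by blast
  moreover have "Lim (at x within \<Omega>) (grad (u t)) = p t x"
  proof (rule tendsto_Lim[OF islimpt_frontier[OF x]])
    have "continuous_on (closure \<Omega>) (p t)" using t by (intro cont_x_p) auto
    then have "(p t \<longlongrightarrow> p t x) (at x within closure \<Omega>)"
      using x by (auto simp: continuous_on_def frontier_def)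
    then have "(p t \<longlongrightarrow> p t x) (at x within \<Omega>)"
      by (rule tendsto_within_subset) (rule closure_subset)
    moreover have "\<forall>\<^sub>F y in at x within \<Omega>. p t y = grad (u t) y"
      using t by (auto simp: eventually_at_filter grad_u)
    ultimately show "(grad (u t) \<longlongrightarrow> p t x) (at x within \<Omega>)" by (rule Lim_transform_eventually)
  qed
  ultimately show ?thesis by (simp add: normal_deriv_def)
qed

text \<open>
  Integration by parts with \<open>u \<phi>\<close> in each coordinate direction: this product vanishes on the
  frontier, respectively is periodic.
\<close>

lemma has_weak_gradient_classical:
  fixes X :: "'a spatial_domain"
  assumes X: "is_domain X" "\<Omega> = points X" and per: "function_on X (u t)" and t: "t \<ge> 0"
  shows "has_weak_gradient X (u t) (p t)"
  unfolding has_weak_gradient_def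
proof
  fix \<phi> assume \<phi>: "\<phi> \<in> test_functions X"
  note ci = cell_interior[OF X(1)]
  have C: "cell X \<in> sets borel" "cell X \<subseteq> closure \<Omega>" using ci X(2) closure_subset[of \<Omega>] by auto
  have "C1 \<phi>" using \<phi> by (cases X) auto
  then obtain D where D: "\<And>x. GDERIV \<phi> x :> D x" "continuous_on UNIV D" by (auto simp: C1_def)
  have gr: "grad \<phi> = D" using grad_eqI[OF D(1)] by auto
  obtain K where K: "compact K" "\<And>x. x \<in> cell X - K \<Longrightarrow> \<phi> x = 0 \<and> D x = 0" "\<And>\<Omega>'. X = Euclidean \<Omega>' \<Longrightarrow> K \<subseteq> \<Omega>' \<and> (\<forall>x. x \<notin> K \<longrightarrow> \<phi> x = 0)"
  proof (cases X)
    case (Euclidean \<Omega>')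
    define K where "K = closure {x. \<phi> x \<noteq> 0}"
    have out: "\<phi> x = 0" if "x \<notin> K" for x using that closure_subset[of "{x. \<phi> x \<noteq> 0}"] by (auto simp: K_def)
    have out': "D x = 0" if "x \<notin> K" for x
    proof -
      have "GDERIV \<phi> x :> 0"
      proof (rule GDERIV_transform_open[OF GDERIV_const])
        show "open (- K)" by (simp add: K_def open_Compl)
        show "x \<in> - K" using that by simp
        show "0 = \<phi> y" if "y \<in> - K" for y using out[of y] that by simp
      qed
      then show ?thesis using grad_eqI gr by metis
    qed
    have K: "compact K" "K \<subseteq> \<Omega>'" using \<phi> Euclidean by (simp_all add: K_def)
    show ?thesis
    proof (rule that[OF K(1)])
      show "\<phi> x = 0 \<and> D x = 0" if "x \<in> cell X - K" for x using out[of x] out'[of x] that by blast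
      show "K \<subseteq> \<Omega>'' \<and> (\<forall>x. x \<notin> K \<longrightarrow> \<phi> x = 0)" if "X = Euclidean \<Omega>''" for \<Omega>''
        using K(2) out that Euclidean by simp
    qed
  next
    case (Flat_Torus L)
    show ?thesis
    proof (rule that[OF compact_cbox[of 0 L]])
      show "\<phi> x = 0 \<and> D x = 0" if "x \<in> cell X - cbox 0 L" for x
        using that cell_torus_subset_cbox[of L] Flat_Torus by blast
    qed (use Flat_Torus in simp)
  qed
  have cu: "continuous_on (closure \<Omega>) (u t)" and cp: "continuous_on (closure \<Omega>) (p t)"
    using t by (auto intro: cont_x_u cont_x_p)
  have c\<phi>: "continuous_on A \<phi>" "continuous_on A D" for A
    using GDERIV_continuous_on[OF D(1)] continuous_on_subset[OF D(2)] by auto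
  have i1: "set_integrable lborel (cell X) (\<lambda>x. u t x *\<^sub>R D x)"
    by (rule set_integrable_compact_support[OF C closed_closure K(1)]) (auto intro!: continuous_intros cu c\<phi> simp: K(2))
  have i2: "set_integrable lborel (cell X) (\<lambda>x. \<phi> x *\<^sub>R p t x)"
    by (rule set_integrable_compact_support[OF C closed_closure K(1)]) (auto intro!: continuous_intros cp c\<phi> simp: K(2))
  have comp: "(LINT x:cell X|lborel. u t x * (D x \<bullet> b) + \<phi> x * (p t x \<bullet> b)) = 0" if b: "b \<in> Basis" for b
  proof -
    have cF': "continuous_on (closure \<Omega>) (\<lambda>x. u t x * (D x \<bullet> b) + \<phi> x * (p t x \<bullet> b))"
      by (intro continuous_intros cu cp c\<phi>)
    have der: "((\<lambda>s. u t (x + s *\<^sub>R b) * \<phi> (x + s *\<^sub>R b)) has_real_derivative u t x * (D x \<bullet> b) + \<phi> x * (p t x \<bullet> b)) (at 0)"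
      if "x \<in> \<Omega>" for x
      using DERIV_mult[OF u_x[OF t that b] GDERIV_directional[OF D(1)[of x], of b]] by (simp add: algebra_simps)
    show ?thesis
    proof (cases X)
      case (Euclidean \<Omega>')
      then have eq: "cell X = \<Omega>" "\<Omega>' = \<Omega>" using X by auto
      have K': "K \<subseteq> \<Omega>" "\<And>x. x \<notin> K \<Longrightarrow> \<phi> x = 0" using K(3)[OF Euclidean] eq by auto
      show ?thesis unfolding eq
      proof (rule integral_partial_deriv_eq_0[OF \<Omega> K(1) b, where F = "\<lambda>x. u t x * \<phi> x"])
        show "continuous_on (closure \<Omega>) (\<lambda>x. u t x * \<phi> x)" by (intro continuous_intros cu c\<phi>)
        show "u t x * \<phi> x = 0" if "x \<in> frontier \<Omega>" for x
          using that K' \<Omega> by (auto simp: frontier_def interior_open)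
        show "continuous_on \<Omega> (\<lambda>x. u t x * (D x \<bullet> b) + \<phi> x * (p t x \<bullet> b))"
          using continuous_on_subset[OF cF' closure_subset] .
        have "compact (closure \<Omega> \<inter> K)" using K(1) by (simp add: closed_Int_compact)
        then have "bounded ((\<lambda>x. u t x * (D x \<bullet> b) + \<phi> x * (p t x \<bullet> b)) ` (closure \<Omega> \<inter> K))"
          using continuous_on_subset[OF cF'] by (intro compact_imp_bounded compact_continuous_image) auto
        then show "bounded ((\<lambda>x. u t x * (D x \<bullet> b) + \<phi> x * (p t x \<bullet> b)) ` (\<Omega> \<inter> K))"
          by (rule bounded_subset) (use closure_subset[of \<Omega>] in auto)
      qed (use der K' in auto)
    next
      case (Flat_Torus L)
      then have U: "\<Omega> = UNIV" using X by simp
      show ?thesis unfolding Flat_Torus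
      proof (rule integral_partial_deriv_eq_0_torus[OF _ b])
        show "is_domain (Flat_Torus L)" using X Flat_Torus by simp
        show "function_on (Flat_Torus L) (\<lambda>x. u t x * \<phi> x)" using per \<phi> Flat_Torus by simp
      qed (use der cF' U in auto)
    qed
  qed
  have "(LINT x:cell X|lborel. u t x *\<^sub>R D x + \<phi> x *\<^sub>R p t x) = 0"
  proof (rule euclidean_eqI)
    fix b :: 'a assume b: "b \<in> Basis"
    have "integrable lborel (\<lambda>x. indicat_real (cell X) x *\<^sub>R (u t x *\<^sub>R D x + \<phi> x *\<^sub>R p t x))"
      using set_integral_add(1)[OF i1 i2] by (simp add: set_integrable_def)
    then have "(LINT x:cell X|lborel. u t x *\<^sub>R D x + \<phi> x *\<^sub>R p t x) \<bullet> b =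
      (LINT x|lborel. (indicat_real (cell X) x *\<^sub>R (u t x *\<^sub>R D x + \<phi> x *\<^sub>R p t x)) \<bullet> b)"
      unfolding set_lebesgue_integral_def by (intro integral_inner_left[symmetric]) auto
    also have "\<dots> = (LINT x:cell X|lborel. u t x * (D x \<bullet> b) + \<phi> x * (p t x \<bullet> b))"
      by (simp add: set_lebesgue_integral_def inner_add_left)
    finally show "(LINT x:cell X|lborel. u t x *\<^sub>R D x + \<phi> x *\<^sub>R p t x) \<bullet> b = 0 \<bullet> b" using comp[OF b] by simp
  qed
  then have "(LINT x:cell X|lborel. u t x *\<^sub>R D x) = - (LINT x:cell X|lborel. \<phi> x *\<^sub>R p t x)"
    using set_integral_add(2)[OF i1 i2] by (simp add: eq_neg_iff_add_eq_0)
  moreover have "integral\<^sup>L (lebesgue_on (cell X)) (\<lambda>x. u t x *\<^sub>R D x) = (LINT x:cell X|lborel. u t x *\<^sub>R D x)"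
    by (rule lebesgue_on_integral_cont[OF C(1)]) (intro continuous_intros continuous_on_subset[OF cu C(2)] c\<phi>)
  moreover have "integral\<^sup>L (lebesgue_on (cell X)) (\<lambda>x. \<phi> x *\<^sub>R p t x) = (LINT x:cell X|lborel. \<phi> x *\<^sub>R p t x)"
    by (rule lebesgue_on_integral_cont[OF C(1)]) (intro continuous_intros continuous_on_subset[OF cp C(2)] c\<phi>)
  ultimately show "(\<integral>x. u t x *\<^sub>R grad \<phi> x \<partial>lebesgue_on (cell X)) = - (\<integral>x. \<phi> x *\<^sub>R p t x \<partial>lebesgue_on (cell X))"
    unfolding gr by simp
qed

end

context damped_wave
begin

text \<open>
  The weak gradient chosen in \<open>GL_energy\<close> agrees almost everywhere with \<open>p\<close>.
\<close>

lemma total_energy_eq_classical_energy: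
  fixes X :: "'a spatial_domain"
  assumes X: "is_domain X" "\<Omega> = points X" and per: "function_on X (u t)" and t: "t \<ge> 0" and H: "u t \<in> H1 X"
  shows "total_energy W \<epsilon> X u t = classical_energy (cell X) t"
proof -
  note ci = cell_interior[OF X(1)]
  have C: "cell X \<in> sets borel" "cell X \<subseteq> closure \<Omega>" using ci X(2) closure_subset[of \<Omega>] by auto
  define g where "g = weak_gradient X (u t)"
  have g: "g \<in> L2 X" "has_weak_gradient X (u t) g"
    using H someI_ex[of "\<lambda>g. g \<in> L2 X \<and> has_weak_gradient X (u t) g"]
    unfolding g_def weak_gradient_def H1_def by auto
  have cp: "continuous_on (closure \<Omega>) (p t)" and cu: "continuous_on (closure \<Omega>) (u t)" and cv: "continuous_on (closure \<Omega>) (v t)"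
    using t by (auto intro: cont_x_u cont_x_p cont_x_v)
  have AE: "AE x in lebesgue. x \<in> cell X \<longrightarrow> g x = p t x"
  proof (rule weak_gradient_unique[OF X(1) g(2) has_weak_gradient_classical[OF X per t] L2_locally_integrable[OF X(1) g(1)]])
    fix a c assume "cbox a c \<subseteq> cell_interior X"
    then have "cbox a c \<subseteq> closure \<Omega>" using ci(2) C(2) by blast
    then have cpc: "continuous_on (cbox a c) (p t)" using cp continuous_on_subset by blast
    then have "set_integrable lborel (cbox a c) (p t)"
      by (intro continuous_bounded_set_integrable compact_imp_bounded compact_continuous_image) auto
    moreover have "(\<lambda>x. indicat_real (cbox a c) x *\<^sub>R p t x) \<in> borel_measurable lborel"
      using borel_measurable_continuous_on_indicator[OF _ cpc] by simp
    ultimately show "set_integrable lebesgue (cbox a c) (p t)"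
      unfolding set_integrable_def by (simp add: integrable_completion)
  qed
  have "GL_energy W \<epsilon> X (u t)
     = (\<integral>\<^sup>+x. ennreal (\<epsilon> / 2 * (norm (g x))\<^sup>2 + W (u t x) / \<epsilon>) * indicator (cell X) x \<partial>lebesgue)"
    using H C(1) unfolding GL_energy_def g_def by (subst nn_integral_restrict_space[symmetric]) auto
  also have "\<dots> = (\<integral>\<^sup>+x. ennreal (\<epsilon> / 2 * (norm (p t x))\<^sup>2 + W (u t x) / \<epsilon>) * indicator (cell X) x \<partial>lebesgue)"
  proof (rule nn_integral_cong_AE)
    show "AE x in lebesgue. ennreal (\<epsilon> / 2 * (norm (g x))\<^sup>2 + W (u t x) / \<epsilon>) * indicator (cell X) x =
      ennreal (\<epsilon> / 2 * (norm (p t x))\<^sup>2 + W (u t x) / \<epsilon>) * indicator (cell X) x"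
      using AE by eventually_elim (simp add: indicator_def del: cell.simps)
  qed
  also have "\<dots> = (\<integral>\<^sup>+x. ennreal (\<epsilon> / 2 * (norm (p t x))\<^sup>2 + W (u t x) / \<epsilon>) * indicator (cell X) x \<partial>lborel)"
    by (rule nn_integral_completion)
  finally have GL: "GL_energy W \<epsilon> X (u t) = \<dots>" .
  have cW: "continuous_on (closure \<Omega>) (\<lambda>x. \<epsilon> / 2 * (norm (p t x))\<^sup>2 + W (u t x) / \<epsilon>)"
    using \<epsilon> by (intro continuous_intros cp continuous_on_compose2[OF W_cont[of UNIV] cu]) auto
  have cv2: "continuous_on (closure \<Omega>) (\<lambda>x. (v t x)\<^sup>2)" by (intro continuous_intros cv)
  note mW = borel_measurable_continuous_times_indicator[OF C cW] and mv = borel_measurable_continuous_times_indicator[OF C cv2]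
  have "(\<integral>\<^sup>+x. ennreal ((dt u t x)\<^sup>2) \<partial>lebesgue_on (cell X)) = (\<integral>\<^sup>+x. ennreal ((v t x)\<^sup>2) * indicator (cell X) x \<partial>lborel)"
    unfolding lebesgue_on_nn_integral[OF C(1)]
    using C(2) dt_u[OF t] by (intro nn_integral_cong) (auto simp: indicator_def subset_eq)
  then have "ennreal (\<epsilon> / 2) * (\<integral>\<^sup>+x. ennreal ((dt u t x)\<^sup>2) \<partial>lebesgue_on (cell X))
     = (\<integral>\<^sup>+x. ennreal (\<epsilon> / 2) * (ennreal ((v t x)\<^sup>2) * indicator (cell X) x) \<partial>lborel)"
    using mv by (simp add: nn_integral_cmult)
  then have "total_energy W \<epsilon> X u t = (\<integral>\<^sup>+x. ennreal (\<epsilon> / 2 * (norm (p t x))\<^sup>2 + W (u t x) / \<epsilon>) * indicator (cell X) x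
      + ennreal (\<epsilon> / 2) * (ennreal ((v t x)\<^sup>2) * indicator (cell X) x) \<partial>lborel)"
    unfolding total_energy_def GL using mW mv by (subst nn_integral_add) auto
  also have "\<dots> = classical_energy (cell X) t"
    unfolding classical_energy_def
  proof (rule nn_integral_cong)
    fix x
    have "ennreal (\<epsilon> / 2 * (norm (p t x))\<^sup>2 + W (u t x) / \<epsilon>) + ennreal (\<epsilon> / 2) * ennreal ((v t x)\<^sup>2) = ennreal (energy_density t x)"
      using \<epsilon> W_nonneg[of "u t x"]
      by (simp add: energy_density_def ennreal_mult[symmetric] ennreal_plus[symmetric] del: ennreal_plus)
    then show "ennreal (\<epsilon> / 2 * (norm (p t x))\<^sup>2 + W (u t x) / \<epsilon>) * indicator (cell X) x
      + ennreal (\<epsilon> / 2) * (ennreal ((v t x)\<^sup>2) * indicator (cell X) x) = ennreal (energy_density t x) * indicator (cell X) x"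
      by (simp add: indicator_def)
  qed
  finally show ?thesis .
qed

text \<open>
  Only a finite energy at time \<open>s\<close> has to be considered. Then \<open>u(s)\<close> is in \<open>H\<^sup>1\<close>, so is
  \<open>u(t)\<close>, and both total energies are the classical ones.
\<close>

lemma total_energy_antimono:
  fixes X :: "'a spatial_domain"
  assumes X: "is_domain X" "\<Omega> = points X" and per: "\<And>t. t \<ge> 0 \<Longrightarrow> function_on X (u t)"
    and mono: "\<And>s t. 0 \<le> s \<Longrightarrow> s \<le> t \<Longrightarrow> classical_energy (cell X) t \<le> classical_energy (cell X) s"
  shows "antimono_on {0..} (total_energy W \<epsilon> X u)"
proof (rule monotone_onI)
  fix s t :: real assume "s \<in> {0..}" "t \<in> {0..}" "s \<le> t"
  then have st: "0 \<le> s" "s \<le> t" "0 \<le> t" by auto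
  note ci = cell_interior[OF X(1)]
  have C: "cell X \<in> sets borel" "cell X \<subseteq> \<Omega>" "cell X \<subseteq> closure \<Omega>" using ci X(2) closure_subset[of \<Omega>] by auto
  show "total_energy W \<epsilon> X u t \<le> total_energy W \<epsilon> X u s"
  proof (cases "u s \<in> H1 X \<and> classical_energy (cell X) s < \<infinity>")
    case False
    then have "total_energy W \<epsilon> X u s = \<infinity>"
      using total_energy_eq_classical_energy[OF X per[OF st(1)] st(1)]
      by (cases "u s \<in> H1 X") (auto simp: total_energy_def GL_energy_def not_less top_unique)
    then show ?thesis by simp
  next
    case True
    have cu: "continuous_on (cell X) (u \<tau>)" "continuous_on (cell X) (p \<tau>)" "continuous_on (closure \<Omega>) (energy_density \<tau>)" if "\<tau> \<ge> 0" for \<tau>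
      using that C(3) cont_x_u[OF that] cont_x_p[OF that] cont_x[OF cont_energy_density that] by (auto intro: continuous_on_subset)
    have "u s \<in> L2 X" using True by (simp add: H1_def)
    then have "(\<integral>\<^sup>+x. ennreal ((u s x)\<^sup>2) * indicator (cell X) x \<partial>lborel) < \<infinity>"
      using L2_iff_finite_square_integral[OF C(1) cu(1)[OF st(1)]] by simp
    then have "(\<integral>\<^sup>+x. ennreal ((u t x)\<^sup>2) * indicator (cell X) x \<partial>lborel) < \<infinity>"
      using True st mono[OF st(1)] by (intro square_integral_finite[OF C(1,2) st(1,2)]) auto
    then have uL: "u t \<in> L2 X" using L2_iff_finite_square_integral[OF C(1) cu(1)[OF st(3)]] by simp
    have "(\<integral>\<^sup>+x. ennreal ((norm (p t x))\<^sup>2) * indicator (cell X) x \<partial>lborel)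
      \<le> (\<integral>\<^sup>+x. ennreal (2 / \<epsilon>) * (ennreal (energy_density t x) * indicator (cell X) x) \<partial>lborel)"
    proof (rule nn_integral_mono)
      fix x
      have "(norm (p t x))\<^sup>2 \<le> 2 / \<epsilon> * energy_density t x"
        using \<epsilon> W_nonneg[of "u t x"] by (simp add: energy_density_def field_simps)
      then have "ennreal ((norm (p t x))\<^sup>2) \<le> ennreal (2 / \<epsilon>) * ennreal (energy_density t x)"
        using \<epsilon> energy_density_nonneg by (subst ennreal_mult[symmetric]) (auto intro: ennreal_leI)
      then show "ennreal ((norm (p t x))\<^sup>2) * indicator (cell X) x \<le> ennreal (2 / \<epsilon>) * (ennreal (energy_density t x) * indicator (cell X) x)"
        by (auto simp: indicator_def)
    qed
    also have "\<dots> = ennreal (2 / \<epsilon>) * classical_energy (cell X) t"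
      using borel_measurable_continuous_times_indicator[OF C(1,3) cu(3)[OF st(3)]]
      unfolding classical_energy_def by (intro nn_integral_cmult) simp
    also have "\<dots> < \<infinity>"
      using mono[OF st(1,2)] True by (auto simp: ennreal_mult_less_top)
    finally have "p t \<in> L2 X" using L2_iff_finite_square_integral[OF C(1) cu(2)[OF st(3)]] by simp
    then have "u t \<in> H1 X"
      using uL has_weak_gradient_classical[OF X per[OF st(3)] st(3)] by (auto simp: H1_def)
    then show ?thesis
      using True mono[OF st(1,2)] total_energy_eq_classical_energy[OF X per[OF st(1)] st(1)]
        total_energy_eq_classical_energy[OF X per[OF st(3)] st(3)] by simp
  qed
qed

end

theorem theorem3p1:
  fixes \<alpha> \<epsilon> :: real
    and W :: "real \<Rightarrow> real"
    and X :: "'a::euclidean_space spatial_domain"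
    and u :: "real \<Rightarrow> 'a \<Rightarrow> real"
  assumes "\<alpha> > 0" and "\<epsilon> > 0"
    and "C2_closure UNIV W"
    and "\<And>z. W z \<ge> 0"
    and "W \<in> O[at_infinity](\<lambda>z. z\<^sup>2)"
    and "\<And>z. W z = 0 \<longleftrightarrow> z \<in> {0, 1}"
    and "is_domain X"
    and "\<And>t. t \<ge> 0 \<Longrightarrow> function_on X (u t)"
    and "C2_closure ({0<..} \<times> points X) (\<lambda>(t, x). u t x)"
    and "\<And>t x. t > 0 \<Longrightarrow> x \<in> points X \<Longrightarrow>
           dt (dt u) t x + \<alpha> * dt u t x = laplacian (u t) x - 1 / \<epsilon>\<^sup>2 * deriv W (u t x)"
    and "(\<forall>t>0. \<forall>x\<in>frontier (points X). dt u t x = 0) \<or>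
         (C1_boundary (points X) \<and>
           (\<forall>t>0. \<forall>x\<in>frontier (points X). normal_deriv (points X) (u t) x = 0)) \<or>
         frontier (points X) = {}"
  shows "antimono_on {0..} (total_energy W \<epsilon> X u)"
proof -
  have op: "open (points X)" by (rule cell_interior(4)[OF assms(7)])
  obtain W' where W': "continuous_on UNIV W'" "\<And>z. (W has_real_derivative W' z) (at z)"
    using assms(3) by (auto simp: C2_closure_def)
  obtain v a p q S where "C2_data (points X) u v a p q S"
    using C2_closure_imp_C2_data[OF op assms(9)] by blast
  then interpret C2_data "points X" u v a p q S .
  interpret damped_wave "points X" u v a p q S \<alpha> \<epsilon> W W'
  proof
    fix t x assume tx: "t > (0::real)" "x \<in> points X"
    then have "x \<in> closure (points X)" using closure_subset by blast
    then show "a t x + \<alpha> * v t x = (\<Sum>b\<in>Basis. S b t x) - 1 / \<epsilon>\<^sup>2 * W' (u t x)"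
      using assms(10)[OF tx] dt_dt_u[OF tx] dt_u[of t x] laplacian_u[OF tx] tx DERIV_imp_deriv[OF W'(2)] by simp
  qed (use assms(1,2,4) W' in auto)
  show ?thesis
  proof (rule total_energy_antimono[OF assms(7) refl assms(8)])
    fix s t :: real assume st: "0 \<le> s" "s \<le> t"
    show "classical_energy (cell X) t \<le> classical_energy (cell X) s"
    proof (cases X)
      case (Flat_Torus L)
      show ?thesis unfolding Flat_Torus
        by (rule classical_energy_antimono_torus) (use assms(7,8) Flat_Torus st in auto)
    next
      case (Euclidean \<Omega>)
      have "v t x = dt u t x" if "t > 0" "x \<in> frontier (points X)" for t x
        using dt_u[of t x] that by (simp add: frontier_def)
      then have "(\<forall>t>0. \<forall>x\<in>frontier (points X). v t x = 0) \<or> (C1_boundary (points X) \<and>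
          (\<forall>t>0. \<forall>x\<in>frontier (points X). \<forall>\<nu>. outer_unit_normal (points X) x \<nu> \<longrightarrow> p t x \<bullet> \<nu> = 0))"
        using assms(11) normal_deriv_eq by force
      then show ?thesis using classical_energy_antimono_euclidean[OF _ st] Euclidean by simp
    qed
  qed auto
qed

end
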